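(* Let $G$ be a non-discrete locally compact group. Then for every function $f:\mathbb N\to\mathbb N\setminus\{0\}$ the group $G$ contains an unconditionally $f$-productive sequence.
   Context: All topological groups are Hausdorff; $\mathbb N=\{0,1,2,\dots\}$. Products are ordered: $\prod_{n=0}^m b_n=b_0b_1\cdots b_m$. A sequence $\{b_n:n\in\mathbb N\}$ in a topological group $G$ is productive if $\{\prod_{n=0}^m b_n:m\in\mathbb N\}$ converges to some element of $G$. For $f:\mathbb N\to\mathbb N\setminus\{0\}$, a sequence $\{a_n:n\in\mathbb N\}$ of elements of $G$ is $f$-productive if it is faithfully indexed ($a_n\ne a_m$ for $n\neq m$) and $\{a_n^{z(n)}:n\in\mathbb N\}$ is productive in $G$ for every $z:\mathbb N\to\mathbb Z$ with $|z(n)|\le f(n)$ for all $n\in\mathbb N$. It is unconditionally $f$-productive if it is faithfully indexed and $\{a_{\varphi(n)}:n\in\mathbb N\}$ is $(f\circ\varphi)$-productive for every bijection $\varphi:\mathbb N\to\mathbb N$. *)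

theory Defs
  imports "HOL-Analysis.Analysis" "HOL-Algebra.Group"
begin

text \<open>Topological groups are Hausdorff by convention. Multiplication and inversion are only
  constrained on the carrier, which is the underlying set of the topology.\<close>

locale hausdorff_topological_group = group G for G (structure) +
  fixes T :: "'a topology"
  assumes topspace_eq_carrier: "topspace T = carrier G"
    and continuous_mult: "continuous_map (prod_topology T T) T (\<lambda>(x, y). x \<otimes> y)"
    and continuous_inv: "continuous_map T T (\<lambda>x. inv x)"
    and Hausdorff: "Hausdorff_space T"

text \<open>The group need not be commutative, so finite products are taken in order:
  \<open>ordered_prod G b m = b 0 \<otimes> b 1 \<otimes> \<dots> \<otimes> b m\<close>, with \<open>m\<close> included.\<close>

primrec ordered_prod :: "('a, 'b) monoid_scheme \<Rightarrow> (nat \<Rightarrow> 'a) \<Rightarrow> nat \<Rightarrow> 'a" where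
  "ordered_prod G b 0 = b 0"
| "ordered_prod G b (Suc m) = ordered_prod G b m \<otimes>\<^bsub>G\<^esub> b (Suc m)"

definition productive :: "('a, 'b) monoid_scheme \<Rightarrow> 'a topology \<Rightarrow> (nat \<Rightarrow> 'a) \<Rightarrow> bool" where
  "productive G T b \<longleftrightarrow>
     range b \<subseteq> carrier G \<and> (\<exists>l\<in>carrier G. limitin T (ordered_prod G b) l sequentially)"

definition f_productive ::
  "('a, 'b) monoid_scheme \<Rightarrow> 'a topology \<Rightarrow> (nat \<Rightarrow> nat) \<Rightarrow> (nat \<Rightarrow> 'a) \<Rightarrow> bool" where
  "f_productive G T f a \<longleftrightarrow>
     range a \<subseteq> carrier G \<and> inj a \<and>
     (\<forall>z :: nat \<Rightarrow> int. (\<forall>n. \<bar>z n\<bar> \<le> int (f n)) \<longrightarrow> productive G T (\<lambda>n. a n [^]\<^bsub>G\<^esub> z n))"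

definition unconditionally_f_productive ::
  "('a, 'b) monoid_scheme \<Rightarrow> 'a topology \<Rightarrow> (nat \<Rightarrow> nat) \<Rightarrow> (nat \<Rightarrow> 'a) \<Rightarrow> bool" where
  "unconditionally_f_productive G T f a \<longleftrightarrow>
     range a \<subseteq> carrier G \<and> inj a \<and>
     (\<forall>\<phi> :: nat \<Rightarrow> nat. bij \<phi> \<longrightarrow> f_productive G T (f \<circ> \<phi>) (\<lambda>n. a (\<phi> n)))"

end

theory Submission
  imports Defs "HOL-Algebra.Coset" "Jordan_Normal_Form.Schur_Decomposition" "HOL-Complex_Analysis.Great_Picard"
begin

text \<open>If all products of admissible powers of the \<open>a i\<close> over distinct large indices, in any order, lie
  near \<open>\<one>\<close> (\<open>summable_mod f {\<one>} a\<close>), then completeness makes an injective sequence unconditionally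
  \<open>f\<close>-productive. A decreasing chain of neighbourhoods \<open>V n\<close> with \<open>V (n + 1)\<^sup>3 \<subseteq> V n\<close> yields sequences
  that are summable modulo \<open>L = \<Inter>n. V n\<close>. For finite \<open>L\<close> a second chain with trivial intersection
  settles the matter; otherwise \<open>L\<close> is an infinite compact group, and it suffices to treat those.

  In a compact group summable sequences lift over a closed normal subgroup \<open>N\<close> that contains no
  connected set joining \<open>\<one>\<close> to another point: by Zorn's lemma, as the nontrivial normal subgroups in \<open>N\<close>
  have smaller relatively open ones. This covers the case that the group itself contains no such
  connected set \<open>K\<close>. If it does, the Peter-Weyl argument gives a finite-dimensional translation invariant
  function space on which the trace is not constant on \<open>K\<close>, so some \<open>x \<in> K\<close> has an eigenvalue that is not
  a root of unity. It defines a character of a closed abelian subgroup onto the circle. In a minimal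
  closed subgroup mapped onto the circle, the kernel contains no \<open>K\<close> as above, for otherwise a second
  character obtained from \<open>K\<close> would have a smaller kernel still mapped onto the circle. So the sequence
  can be chosen in the circle and lifted.\<close>

section \<open>Neighbourhoods of the identity\<close>

text \<open>Two obstacles shape the proof. Over a subgroup \<open>L'\<close> that is open in
  \<open>L\<close>, a product of small factors that stays near \<open>L\<close> cannot jump from one
  coset of \<open>L'\<close> to another, so summability lifts from \<open>L\<close> to
  \<open>L'\<close>. A connected kernel has no proper open subgroup, which is why connected sets
  must be kept out of it. In the connected case characters have to be produced in a group that need
  be neither commutative nor metrizable. An eigenfunction of translations gives a character only on
  the closed subgroup \<open>D\<close> that preserves its line. This character is not extended: its
  value \<open>c\<close> at \<open>x\<close> is matched by a \<open>y\<close> at which the old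
  character has the value \<open>c\<close>, and the eigenfunction is taken common to
  \<open>x\<close> and \<open>y\<close>; so \<open>D\<close> contains \<open>y\<close>, is mapped
  onto the circle, and is the whole minimal group. Integration is a mean of continuous functions
  built from finite averages of translates. Since continuous functions are not complete for the
  resulting inner product, limits are taken uniformly, after the convolution operator has made the
  functions equicontinuous.\<close>

definition (in hausdorff_topological_group) nhd :: "'a set \<Rightarrow> bool" where
  "nhd U \<longleftrightarrow> openin T U \<and> \<one> \<in> U"

lemma openin_prod_rectangle:
  assumes "openin (prod_topology X Y) S" "(x, y) \<in> S"
  obtains U V where "openin X U" "openin Y V" "x \<in> U" "y \<in> V" "U \<times> V \<subseteq> S"
  using assms unfolding openin_prod_topology_alt by meson

context group
begin

lemma inv_mult_cancel [simp]:
  assumes "x \<in> carrier G" "y \<in> carrier G"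
  shows "inv x \<otimes> (x \<otimes> y) = y" "x \<otimes> (inv x \<otimes> y) = y"
  using assms by (simp_all add: m_assoc [symmetric])

end

context hausdorff_topological_group
begin

lemma topspace [simp]: "topspace T = carrier G"
  by (rule topspace_eq_carrier)

lemma openin_carrier: "openin T U \<Longrightarrow> U \<subseteq> carrier G"
  using openin_subset by fastforce

lemma compactin_carrier: "compactin T U \<Longrightarrow> U \<subseteq> carrier G"
  using compactin_subset_topspace by fastforce

lemma nhd_carrier: "nhd U \<Longrightarrow> U \<subseteq> carrier G"
  by (simp add: nhd_def openin_carrier)

lemma nhd_Int: "nhd U \<Longrightarrow> nhd V \<Longrightarrow> nhd (U \<inter> V)"
  by (auto simp: nhd_def)

lemma nhd_UNIV: "nhd (carrier G)"
  using openin_topspace[of T] by (auto simp: nhd_def)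

lemma continuous_map_mult:
  assumes "continuous_map X T f" "continuous_map X T g"
  shows "continuous_map X T (\<lambda>x. f x \<otimes> g x)"
proof -
  have "continuous_map X (prod_topology T T) (\<lambda>x. (f x, g x))"
    using assms by (simp add: continuous_map_paired)
  from continuous_map_compose[OF this continuous_mult] show ?thesis
    by (simp add: o_def)
qed

lemma continuous_map_inv:
  "continuous_map X T f \<Longrightarrow> continuous_map X T (\<lambda>x. inv (f x))"
  using continuous_map_compose[OF _ continuous_inv, of X f] by (simp add: o_def)

lemma openin_preimage:
  assumes "continuous_map X T f" "openin T U"
  shows "openin X {x \<in> topspace X. f x \<in> U}"
  using assms by (rule openin_continuous_map_preimage)

lemma closedin_preimage:
  assumes "continuous_map X T f" "closedin T U"
  shows "closedin X {x \<in> topspace X. f x \<in> U}"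
  using assms by (rule closedin_continuous_map_preimage)

lemma continuous_map_pow:
  assumes "continuous_map X T f"
  shows "continuous_map X T (\<lambda>x. f x [^] (z::int))"
proof -
  have *: "continuous_map X T (\<lambda>x. f x [^] (n::nat))" for n
    by (induction n) (auto intro!: continuous_map_mult assms)
  show ?thesis
    using continuous_map_inv[OF *[of "nat (- z)"]] *[of "nat z"]
    unfolding int_pow_def2 by (cases "z < 0") simp_all
qed

lemma nhd_preimage:
  assumes "continuous_map T T f" "f \<one> \<in> U" "openin T U"
  shows "nhd {x \<in> carrier G. f x \<in> U}"
  using openin_preimage[OF assms(1,3)] assms by (auto simp: nhd_def)

lemma nhd_preimage_one:
  assumes "continuous_map T T f" "f \<one> = \<one>" "nhd U"
  shows "nhd {x \<in> carrier G. f x \<in> U}"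
  using nhd_preimage[of f U] assms by (auto simp: nhd_def)

lemma openin_ltranslate:
  assumes "openin T U" "a \<in> carrier G"
  shows "openin T {x \<in> carrier G. a \<otimes> x \<in> U}"
  using openin_preimage[of T "\<lambda>x. a \<otimes> x" U] assms by (simp add: continuous_map_mult)

lemma openin_rtranslate:
  assumes "openin T U" "a \<in> carrier G"
  shows "openin T {x \<in> carrier G. x \<otimes> a \<in> U}"
  using openin_preimage[of T "\<lambda>x. x \<otimes> a" U] assms by (simp add: continuous_map_mult)

lemma openin_set_mult:
  assumes "openin T U" "L \<subseteq> carrier G"
  shows "openin T (U <#> L)"
proof -
  have "U <#> L = (\<Union>l\<in>L. {x \<in> carrier G. x \<otimes> inv l \<in> U})"
  proof (intro equalityI subsetI)
    fix x assume "x \<in> U <#> L"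
    then obtain u l where *: "u \<in> U" "l \<in> L" "x = u \<otimes> l" by (auto simp: set_mult_def)
    moreover have "u \<in> carrier G" "l \<in> carrier G" using * assms openin_carrier by blast+
    ultimately show "x \<in> (\<Union>l\<in>L. {x \<in> carrier G. x \<otimes> inv l \<in> U})" by (force simp: m_assoc)
  next
    fix x assume "x \<in> (\<Union>l\<in>L. {x \<in> carrier G. x \<otimes> inv l \<in> U})"
    then obtain l where *: "l \<in> L" "x \<in> carrier G" "x \<otimes> inv l \<in> U" by blast
    moreover have "l \<in> carrier G" using * assms by blast
    ultimately have "x = (x \<otimes> inv l) \<otimes> l" by (simp add: m_assoc)
    then show "x \<in> U <#> L" using * unfolding set_mult_def by blast
  qed
  then show ?thesis using openin_rtranslate[OF assms(1)] assms(2) by (auto intro!: openin_Union)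
qed

lemma closedin_one: "closedin T {\<one>}"
  using Hausdorff by (simp add: closedin_Hausdorff_sing_eq)

lemma nhd_cube:
  assumes "nhd W"
  obtains V where "nhd V" "\<And>x. x \<in> V \<Longrightarrow> inv x \<in> V"
    "\<And>x y z. x \<in> V \<Longrightarrow> y \<in> V \<Longrightarrow> z \<in> V \<Longrightarrow> x \<otimes> y \<otimes> z \<in> W"
proof -
  let ?X = "prod_topology T (prod_topology T T)"
  have cm: "continuous_map ?X T (\<lambda>p. fst p \<otimes> fst (snd p) \<otimes> snd (snd p))"
    by (intro continuous_map_mult continuous_map_fst
        continuous_map_compose[OF continuous_map_snd continuous_map_fst, unfolded o_def]
        continuous_map_compose[OF continuous_map_snd continuous_map_snd, unfolded o_def])
  define S where "S = {p \<in> topspace ?X. fst p \<otimes> fst (snd p) \<otimes> snd (snd p) \<in> W}"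
  have S: "openin ?X S"
    using openin_preimage[OF cm] assms by (simp add: nhd_def S_def)
  have "(\<one>, \<one>, \<one>) \<in> S" using assms by (auto simp: nhd_def S_def)
  from openin_prod_rectangle[OF S this]
  obtain A B where AB: "openin T A" "openin (prod_topology T T) B" "\<one> \<in> A" "(\<one>,\<one>) \<in> B" "A \<times> B \<subseteq> S" .
  from openin_prod_rectangle[OF AB(2) AB(4)]
  obtain C D where CD: "openin T C" "openin T D" "\<one> \<in> C" "\<one> \<in> D" "C \<times> D \<subseteq> B" .
  define V0 where "V0 = A \<inter> C \<inter> D"
  have V0: "nhd V0" using AB CD by (auto simp: nhd_def V0_def)
  define V where "V = V0 \<inter> {x \<in> carrier G. inv x \<in> V0}"
  have "nhd V" unfolding V_def
    using V0 by (intro nhd_Int nhd_preimage_one continuous_inv) auto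
  moreover have "\<forall>x\<in>V. inv x \<in> V" using nhd_carrier[OF V0] by (auto simp: V_def)
  moreover have "\<forall>x\<in>V. \<forall>y\<in>V. \<forall>z\<in>V. x \<otimes> y \<otimes> z \<in> W"
  proof (intro ballI)
    fix x y z assume "x \<in> V" "y \<in> V" "z \<in> V"
    then have "(x, y, z) \<in> A \<times> B" using CD by (auto simp: V_def V0_def)
    then have "(x, y, z) \<in> S" using AB by blast
    then show "x \<otimes> y \<otimes> z \<in> W" by (simp add: S_def)
  qed
  ultimately show thesis using that[of V] by blast
qed

lemma nhd_power:
  assumes "nhd W"
  shows "\<exists>V. nhd V \<and> V \<subseteq> W \<and> (\<forall>x\<in>V. \<forall>z::int. \<bar>z\<bar> \<le> int k \<longrightarrow> x [^] z \<in> W)"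
proof -
  let ?V = "W \<inter> (\<Inter>z\<in>{- int k..int k}. {x \<in> carrier G. x [^] z \<in> W})"
  have *: "nhd {x \<in> carrier G. x [^] z \<in> W}" for z :: int
    using assms by (intro nhd_preimage_one continuous_map_pow continuous_map_id) auto
  have "openin T (\<Inter>z\<in>{- int k..int k}. {x \<in> carrier G. x [^] z \<in> W})"
    using * by (intro openin_INT2) (auto simp: nhd_def)
  then have "nhd ?V" using assms * by (auto simp: nhd_def)
  moreover have "\<forall>x\<in>?V. \<forall>z::int. \<bar>z\<bar> \<le> int k \<longrightarrow> x [^] z \<in> W" by (auto simp: abs_le_iff)
  ultimately show ?thesis by blast
qed

text \<open>Compactness of \<open>C\<close> enters through the tube lemma: a single \<open>V\<close>
  has to serve all \<open>g\<close> at once. With \<open>C\<close> the whole compact group this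
  later makes the intersection of a chain normal.\<close>

lemma nhd_conj:
  assumes "nhd W" "compactin T C"
  shows "\<exists>V. nhd V \<and> V \<subseteq> W \<and> (\<forall>g\<in>C. \<forall>x\<in>V. g \<otimes> x \<otimes> inv g \<in> W)"
proof -
  let ?X = "prod_topology T T"
  have cm: "continuous_map ?X T (\<lambda>p. fst p \<otimes> snd p \<otimes> inv (fst p))"
    by (intro continuous_map_mult continuous_map_inv continuous_map_fst continuous_map_snd)
  let ?S = "{p \<in> topspace ?X. fst p \<otimes> snd p \<otimes> inv (fst p) \<in> W}"
  have S: "openin ?X ?S"
    using openin_preimage[OF cm] assms by (simp add: nhd_def)
  have "C \<times> {\<one>} \<subseteq> ?S" using assms compactin_carrier[of C] by (auto simp: nhd_def)
  from tube_lemma_left[OF S assms(2) _ this]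
  obtain U V where UV: "openin T U" "openin T V" "C \<subseteq> U" "\<one> \<in> V" "U \<times> V \<subseteq> ?S" by auto
  then have "nhd (V \<inter> W)" using assms by (auto simp: nhd_def)
  moreover have "\<forall>g\<in>C. \<forall>x\<in>V \<inter> W. g \<otimes> x \<otimes> inv g \<in> W" using UV by force
  ultimately show ?thesis by blast
qed

lemma closure_of_subset_nhd:
  assumes "nhd V" "\<And>x. x \<in> V \<Longrightarrow> inv x \<in> V" "\<And>x y. x \<in> V \<Longrightarrow> y \<in> V \<Longrightarrow> x \<otimes> y \<in> W"
  shows "Abstract_Topology.closure_of T V \<subseteq> W"
proof
  fix x assume x: "x \<in> Abstract_Topology.closure_of T V"
  then have xc: "x \<in> carrier G" using closure_of_subset_topspace by fastforce
  \<comment> \<open>The translate of \<open>V\<close> by \<open>x\<close> is open around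
    \<open>x\<close>, so it meets \<open>V\<close>; a common point \<open>y\<close> writes
    \<open>x\<close> as \<open>y\<close> times the inverse of \<open>inv x \<otimes> y\<close>, a
    product of two elements of \<open>V\<close>.\<close>
  let ?U = "{y \<in> carrier G. inv x \<otimes> y \<in> V}"
  have "x \<in> ?U" "openin T ?U" using xc assms openin_ltranslate[of V "inv x"] by (auto simp: nhd_def)
  then obtain y where y: "y \<in> V" "y \<in> carrier G" "inv x \<otimes> y \<in> V"
    using x conjunct2[OF x[unfolded in_closure_of], rule_format, of ?U] by auto
  then have "y \<otimes> inv (inv x \<otimes> y) \<in> W" using assms by blast
  then show "x \<in> W" using xc y by (simp add: inv_mult_group)
qed

text \<open>Otherwise the sets \<open>C n - U\<close> would be a decreasing sequence of nonempty
  closed subsets of a compact set with empty intersection.\<close>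

lemma nhd_subset_of_Int_closed:
  assumes clo: "\<And>n::nat. closedin T (C n)" and dec: "decseq C" and K: "compactin T K" "C 0 \<subseteq> K"
    and U: "openin T U" "(\<Inter>n. C n) \<subseteq> U"
  shows "\<exists>n. C n \<subseteq> U"
proof (rule ccontr)
  assume "\<nexists>n. C n \<subseteq> U"
  then have ne: "C n - U \<noteq> {}" for n by blast
  let ?X = "subtopology T K"
  have "(\<Inter>n. C n - U) \<noteq> {}"
  proof (rule compact_space_imp_nest)
    show "compact_space ?X" using K compact_space_subtopology by blast
    show "closedin ?X (C n - U)" for n
    proof -
      have "C n \<subseteq> K" using dec K(2) by (metis decseqD le0 order_trans)
      moreover have "closedin T (C n - U)" using clo U by (simp add: closedin_diff)
      ultimately show ?thesis using K
        by (metis Diff_subset closedin_subset_topspace order_trans)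
    qed
    show "decseq (\<lambda>n. C n - U)" using dec unfolding decseq_def by blast
  qed (use ne in auto)
  then show False using U by blast
qed

lemma discrete_if_nhd_one:
  assumes "openin T {\<one>}"
  shows "T = discrete_topology (carrier G)"
proof -
  have "openin T {x}" if x: "x \<in> carrier G" for x
  proof -
    have "{y \<in> carrier G. inv x \<otimes> y \<in> {\<one>}} = {x}"
      using x by (auto simp: inv_solve_left' intro: inv_equality)
    then show ?thesis using openin_ltranslate[OF assms, of "inv x"] x by simp
  qed
  then show ?thesis by (metis discrete_topology_unique topspace)
qed

end

section \<open>Summability modulo a subgroup\<close>

text \<open>Indexing by a list leaves the order of the noncommutative product free, so that the
  tails of all rearrangements are words in one and the same sequence.\<close>

definition (in group) word :: "(nat \<Rightarrow> 'a) \<Rightarrow> (nat \<Rightarrow> int) \<Rightarrow> nat list \<Rightarrow> 'a" where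
  "word a z js = foldr (\<lambda>i p. a i [^] z i \<otimes> p) js \<one>"

definition admissible :: "(nat \<Rightarrow> nat) \<Rightarrow> nat \<Rightarrow> (nat \<Rightarrow> int) \<Rightarrow> nat list \<Rightarrow> bool" where
  "admissible f n z js \<longleftrightarrow> distinct js \<and> (\<forall>i\<in>set js. n \<le> i \<and> \<bar>z i\<bar> \<le> int (f i))"

lemma admissible_Cons:
  "admissible f n z (i # js) \<Longrightarrow> admissible f n z js \<and> n \<le> i \<and> \<bar>z i\<bar> \<le> int (f i)"
  by (auto simp: admissible_def)

lemma admissible_mono: "admissible f n z js \<Longrightarrow> m \<le> n \<Longrightarrow> admissible f m z js"
  by (auto simp: admissible_def)

context group
begin

lemma word_Nil [simp]: "word a z [] = \<one>"
  and word_Cons [simp]: "word a z (i # js) = a i [^] z i \<otimes> word a z js"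
  by (simp_all add: word_def)

lemma word_closed [simp, intro]:
  assumes "range a \<subseteq> carrier G"
  shows "word a z js \<in> carrier G"
proof -
  have "a i \<in> carrier G" for i using assms by blast
  then show ?thesis by (induction js) auto
qed

lemma word_append:
  assumes "range a \<subseteq> carrier G"
  shows "word a z (is @ js) = word a z is \<otimes> word a z js"
proof -
  have "a i \<in> carrier G" for i using assms by blast
  then show ?thesis using assms by (induction "is") (simp_all add: m_assoc)
qed

text \<open>Splitting at the smallest index leaves two words of strictly larger indices, so that
  cubes suffice although the indices come in arbitrary order.\<close>

lemma word_in_nested:
  assumes a: "range a \<subseteq> carrier G"
    and one: "\<And>n. \<one> \<in> V n" and car: "\<And>n. V n \<subseteq> carrier G"
    and cube: "\<And>n x y z. x \<in> V (Suc n) \<Longrightarrow> y \<in> V (Suc n) \<Longrightarrow> z \<in> V (Suc n) \<Longrightarrow> x \<otimes> y \<otimes> z \<in> V n"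
    and "distinct js" "\<And>i. i \<in> set js \<Longrightarrow> n \<le> i \<and> a i [^] z i \<in> V (Suc i)"
  shows "word a z js \<in> V n"
  using assms(5-6)
proof (induction "length js" arbitrary: js n rule: less_induct)
  case less
  have ac: "a i \<in> carrier G" for i using a by blast
  have dec: "V (Suc n) \<subseteq> V n" for n
    using cube[OF _ one one] car by fastforce
  then have decs: "V m \<subseteq> V n" if "n \<le> m" for n m
    using that by (metis lift_Suc_antimono_le)
  show ?case
  proof (cases "js = []")
    case False
    define i where "i = Min (set js)"
    have i: "i \<in> set js" "\<And>j. j \<in> set js \<Longrightarrow> i \<le> j" using False by (auto simp: i_def)
    then obtain us vs where js: "js = us @ i # vs" by (meson split_list)
    have gt: "Suc i \<le> j" if "j \<in> set us \<union> set vs" for j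
      using that i(2)[of j] less.prems(1) by (cases "i = j") (auto simp: js)
    have "word a z us \<in> V (Suc i)" "word a z vs \<in> V (Suc i)"
      using less.prems gt by (auto intro!: less.hyps simp: js)
    then have "word a z us \<otimes> a i [^] z i \<otimes> word a z vs \<in> V i"
      using less.prems(2)[OF i(1)] by (intro cube) auto
    moreover have "word a z js = word a z us \<otimes> a i [^] z i \<otimes> word a z vs"
      using a ac by (simp add: js word_append m_assoc)
    ultimately show ?thesis using decs less.prems(2)[OF i(1)] by auto
  qed (simp add: one)
qed

end

section \<open>Chains of neighbourhoods and sequences summable modulo their intersection\<close>

context hausdorff_topological_group
begin

text \<open>A Cauchy condition in the coset space of \<open>L\<close>, uniform over all orders and
  all admissible exponents. The set \<open>U <#> L\<close> is the preimage of a neighbourhood of the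
  trivial coset, so that the argument stays in \<open>G\<close> and forms no quotient.\<close>

definition summable_mod :: "(nat \<Rightarrow> nat) \<Rightarrow> 'a set \<Rightarrow> (nat \<Rightarrow> 'a) \<Rightarrow> bool" where
  "summable_mod f L a \<longleftrightarrow> range a \<subseteq> carrier G \<and>
     (\<forall>U. nhd U \<longrightarrow> (\<exists>n. \<forall>z js. admissible f n z js \<longrightarrow> word a z js \<in> U <#> L))"

text \<open>The strictness \<open>V (Suc n) \<noteq> V n\<close> keeps the intersection from being
  open (\<open>Inter_chain_not_nhd\<close>), so that elements outside it exist arbitrarily close to
  \<open>\<one>\<close>.\<close>

definition nhd_chain :: "(nat \<Rightarrow> 'a set) \<Rightarrow> bool" where
  "nhd_chain V \<longleftrightarrow> (\<forall>n. nhd (V n) \<and> (\<forall>x\<in>V n. inv x \<in> V n) \<and>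
     (\<forall>x\<in>V (Suc n). \<forall>y\<in>V (Suc n). \<forall>z\<in>V (Suc n). x \<otimes> y \<otimes> z \<in> V n) \<and> V (Suc n) \<noteq> V n)"

lemma nhd_chainD:
  assumes "nhd_chain V"
  shows "nhd (V n)" "\<one> \<in> V n" "V n \<subseteq> carrier G" "x \<in> V n \<Longrightarrow> inv x \<in> V n"
    "x \<in> V (Suc n) \<Longrightarrow> y \<in> V (Suc n) \<Longrightarrow> z \<in> V (Suc n) \<Longrightarrow> x \<otimes> y \<otimes> z \<in> V n"
    "x \<in> V (Suc n) \<Longrightarrow> y \<in> V (Suc n) \<Longrightarrow> x \<otimes> y \<in> V n"
    "V (Suc n) \<subseteq> V n" "V (Suc n) \<noteq> V n" "decseq V"
proof -
  show 1: "nhd (V n)" "x \<in> V n \<Longrightarrow> inv x \<in> V n" "V (Suc n) \<noteq> V n"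
    and c: "x \<in> V (Suc n) \<Longrightarrow> y \<in> V (Suc n) \<Longrightarrow> z \<in> V (Suc n) \<Longrightarrow> x \<otimes> y \<otimes> z \<in> V n" for x y z n
    using assms by (simp_all add: nhd_chain_def)
  show 2: "\<one> \<in> V n" "V n \<subseteq> carrier G" for n
    using 1(1)[of n] nhd_carrier by (auto simp: nhd_def)
  have xc: "x \<in> carrier G" if "x \<in> V n" for x n using that 2(2)[of n] by blast
  show "x \<in> V (Suc n) \<Longrightarrow> y \<in> V (Suc n) \<Longrightarrow> x \<otimes> y \<in> V n"
    using c[of x n y \<one>] 2(1) xc[of x] xc[of y] by simp
  show 3: "V (Suc n) \<subseteq> V n" for n
    using c[OF _ 2(1) 2(1), of _ n] xc by fastforce
  then show "decseq V" by (simp add: decseq_Suc_iff)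
qed

lemma subgroup_Inter_chain:
  assumes "nhd_chain V"
  shows "subgroup (\<Inter>n. V n) G"
proof (rule subgroupI)
  show "(\<Inter>n. V n) \<noteq> {}" "(\<Inter>n. V n) \<subseteq> carrier G"
    using nhd_chainD(2)[OF assms] nhd_chainD(3)[OF assms, of 0] by auto
  show "inv x \<in> (\<Inter>n. V n)" if "x \<in> (\<Inter>n. V n)" for x
    using that nhd_chainD(4)[OF assms] by simp
  show "x \<otimes> y \<in> (\<Inter>n. V n)" if "x \<in> (\<Inter>n. V n)" "y \<in> (\<Inter>n. V n)" for x y
    using that nhd_chainD(6)[OF assms] by simp
qed

lemma closure_of_chain:
  assumes "nhd_chain V"
  shows "Abstract_Topology.closure_of T (V (Suc n)) \<subseteq> V n"
  by (rule closure_of_subset_nhd) (simp_all add: nhd_chainD[OF assms])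

lemma Inter_closure_of_chain:
  assumes "nhd_chain V"
  shows "(\<Inter>n. Abstract_Topology.closure_of T (V (Suc n))) = (\<Inter>n. V n)"
proof -
  have "V (Suc n) \<subseteq> Abstract_Topology.closure_of T (V (Suc n))" for n
    using nhd_chainD(3)[OF assms] by (intro closure_of_subset) auto
  then have "(\<Inter>n. V n) \<subseteq> Abstract_Topology.closure_of T (V (Suc n))" for n
    by (rule order_trans[OF INT_lower[OF UNIV_I]])
  moreover have "(\<Inter>n. Abstract_Topology.closure_of T (V (Suc n))) \<subseteq> V n" for n
    using closure_of_chain[OF assms] by (rule order_trans[OF INT_lower[OF UNIV_I]])
  ultimately show ?thesis
    by (intro equalityI INT_greatest)
qed

lemma closedin_Inter_chain:
  assumes "nhd_chain V"
  shows "closedin T (\<Inter>n. V n)"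
  unfolding Inter_closure_of_chain[OF assms, symmetric] by (intro closedin_Inter) auto

text \<open>The closures of the sets \<open>V (Suc n)\<close> decrease to the intersection
  \<open>L\<close> inside the compact set \<open>K\<close>, so one of them falls into the open set
  \<open>U <#> L\<close>. Modulo \<open>L\<close> the chain is therefore a base at the
  identity.\<close>

lemma nhd_chain_base:
  assumes V: "nhd_chain V" and K: "compactin T K" "V 0 \<subseteq> K" and U: "nhd U"
  shows "\<exists>n. V n \<subseteq> U <#> (\<Inter>n. V n)"
proof -
  let ?L = "\<Inter>n. V n"
  have L: "subgroup ?L G" by (rule subgroup_Inter_chain[OF V])
  have "\<exists>n. Abstract_Topology.closure_of T (V (Suc n)) \<subseteq> U <#> ?L"
  proof (rule nhd_subset_of_Int_closed[OF _ _ K(1)])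
    show "openin T (U <#> ?L)"
      using U L by (simp add: openin_set_mult nhd_def subgroup.subset)
    show "decseq (\<lambda>n. Abstract_Topology.closure_of T (V (Suc n)))"
      using nhd_chainD(7)[OF V] by (auto simp: decseq_Suc_iff intro!: closure_of_mono)
    show "(\<Inter>n. Abstract_Topology.closure_of T (V (Suc n))) \<subseteq> U <#> ?L"
    proof
      fix x assume "x \<in> (\<Inter>n. Abstract_Topology.closure_of T (V (Suc n)))"
      then have x: "x \<in> ?L" by (simp only: Inter_closure_of_chain[OF V])
      then have "x = \<one> \<otimes> x" using subgroup.mem_carrier[OF L] by simp
      then show "x \<in> U <#> ?L" using x U unfolding set_mult_def nhd_def by blast
    qed
  qed (use closure_of_chain[OF V, of 0] K(2) in auto)
  moreover have "V (Suc n) \<subseteq> Abstract_Topology.closure_of T (V (Suc n))" for n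
    using nhd_chainD(3)[OF V] by (intro closure_of_subset) auto
  ultimately show ?thesis by blast
qed

text \<open>An open \<open>W\<close> inside the subgroup \<open>L\<close> would give
  \<open>V n \<subseteq> W <#> L \<subseteq> L \<subseteq> V (Suc n)\<close> for some
  \<open>n\<close>, against strictness.\<close>

lemma Inter_chain_not_nhd:
  assumes V: "nhd_chain V" and K: "compactin T K" "V 0 \<subseteq> K" and W: "nhd W"
  shows "\<not> W \<subseteq> (\<Inter>n. V n)"
proof
  let ?L = "\<Inter>n. V n"
  assume sub: "W \<subseteq> ?L"
  obtain n where n: "V n \<subseteq> W <#> ?L" using nhd_chain_base[OF V K W] by blast
  also have "W <#> ?L \<subseteq> ?L"
  proof
    fix x assume "x \<in> W <#> ?L"
    then obtain w l where "x = w \<otimes> l" "w \<in> W" "l \<in> ?L" unfolding set_mult_def by blast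
    then show "x \<in> ?L" using sub subgroup.m_closed[OF subgroup_Inter_chain[OF V], of w l] by (simp add: subset_iff)
  qed
  also have "?L \<subseteq> V (Suc n)" by (rule INT_lower) simp
  finally show False using nhd_chainD(7,8)[OF V, of n] by (simp add: subset_antisym)
qed

text \<open>Non-discreteness supplies at each stage a point \<open>q \<noteq> \<one>\<close> of the
  current set which the next set leaves out. The condition on \<open>C\<close> makes the
  intersection stable under conjugation by \<open>C\<close>, which is taken to be the whole group
  when a normal subgroup is wanted and empty otherwise.\<close>

lemma nhd_chain_exists:
  assumes nd: "\<not> openin T {\<one>}" and U: "\<And>n::nat. nhd (U n)" and C: "compactin T C"
  shows "\<exists>V. nhd_chain V \<and> (\<forall>n. V n \<subseteq> U n) \<and> (\<forall>n. \<forall>g\<in>C. \<forall>x\<in>V (Suc n). g \<otimes> x \<otimes> inv g \<in> V n)"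
proof -
  define P where "P = (\<lambda>n V. nhd V \<and> (\<forall>x\<in>V. inv x \<in> V) \<and> V \<subseteq> U n)"
  define Q where "Q = (\<lambda>(n::nat) W V. (\<forall>x\<in>V. \<forall>y\<in>V. \<forall>z\<in>V. x \<otimes> y \<otimes> z \<in> W) \<and> V \<noteq> W \<and>
    (\<forall>g\<in>C. \<forall>x\<in>V. g \<otimes> x \<otimes> inv g \<in> W))"
  have step: "\<exists>V. P n V \<and> Q m W V" if W: "nhd W" for n m W
  proof -
    have "W \<noteq> {\<one>}" using nd W by (auto simp: nhd_def)
    then obtain q where q: "q \<in> W" "q \<noteq> \<one>" using W by (auto simp: nhd_def)
    then have qc: "q \<in> carrier G" using W nhd_carrier by blast
    have "closedin T {q}" using Hausdorff qc by (simp add: closedin_Hausdorff_sing_eq)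
    then have nq: "nhd (carrier G - {q})"
      using q by (auto simp: nhd_def closedin_def)
    obtain W' where W': "nhd W'" "W' \<subseteq> W" "\<And>g x. g \<in> C \<Longrightarrow> x \<in> W' \<Longrightarrow> g \<otimes> x \<otimes> inv g \<in> W"
      using nhd_conj[OF W C] by blast
    let ?Z = "W' \<inter> (carrier G - {q}) \<inter> U n"
    have Z: "nhd ?Z" using W' nq U by (intro nhd_Int)
    obtain V where V: "nhd V" "\<And>x. x \<in> V \<Longrightarrow> inv x \<in> V"
      "\<And>x y z. x \<in> V \<Longrightarrow> y \<in> V \<Longrightarrow> z \<in> V \<Longrightarrow> x \<otimes> y \<otimes> z \<in> ?Z"
      using nhd_cube[OF Z] by metis
    have "V \<subseteq> ?Z"
    proof
      fix x assume x: "x \<in> V"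
      then have "x \<otimes> \<one> \<otimes> \<one> \<in> ?Z" using V by (intro V(3)) (auto simp: nhd_def)
      then show "x \<in> ?Z" using x V(1) nhd_carrier[OF V(1)] by auto
    qed
    then have "P n V" "Q m W V"
      using V W' q unfolding P_def Q_def by blast+
    then show ?thesis by blast
  qed
  have "\<exists>V. \<forall>n. P n (V n) \<and> Q n (V n) (V (Suc n))"
  proof (rule dependent_nat_choice)
    show "\<exists>x. P 0 x" using step[OF nhd_UNIV] by blast
    show "\<exists>y. P (Suc n) y \<and> Q n x y" if "P n x" for n x
      using that step by (simp add: P_def)
  qed
  then obtain V where V: "\<And>n. P n (V n)" "\<And>n. Q n (V n) (V (Suc n))" by blast
  then have "nhd_chain V" unfolding nhd_chain_def P_def Q_def by simp
  then show ?thesis using V unfolding P_def Q_def by blast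
qed

text \<open>The elements are chosen so small that their admissible powers fit
  \<open>word_in_nested\<close>. Being pairwise incongruent modulo \<open>L\<close> makes every
  later lift along the cosets of \<open>L\<close> injective.\<close>

lemma summable_mod_exists:
  assumes V: "nhd_chain V" and K: "compactin T K" "V 0 \<subseteq> K" and L: "L = (\<Inter>n. V n)"
  shows "\<exists>a. summable_mod f L a \<and> (\<forall>m n. m < n \<longrightarrow> inv (a m) \<otimes> a n \<notin> L)"
proof -
  have Lc: "closedin T L" and Ls: "subgroup L G"
    using closedin_Inter_chain[OF V] subgroup_Inter_chain[OF V] by (simp_all add: L)
  \<comment> \<open>The index is shifted: powers of the \<open>n\<close>-th element lie in
    \<open>V (Suc n)\<close>, since \<open>word_in_nested\<close> multiplies such a power by two
    words over larger indices, which lie in \<open>V (Suc n)\<close> as well.\<close>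
  define P where "P = (\<lambda>n (W, a). nhd W \<and> a \<in> W \<and> a \<notin> L \<and>
    (\<forall>x\<in>W. \<forall>z::int. \<bar>z\<bar> \<le> int (f n) \<longrightarrow> x [^] z \<in> V (Suc n)))"
  define Q where "Q = (\<lambda>(n::nat) (W, a) (W', a' :: 'a). W' \<subseteq> W \<and> (\<forall>x\<in>W'. inv a \<otimes> x \<notin> L))"
  have step: "\<exists>p. P n p \<and> fst p \<subseteq> W" if W: "nhd W" for n W
  proof -
    obtain W' where W': "nhd W'" "\<And>x z::int. x \<in> W' \<Longrightarrow> \<bar>z\<bar> \<le> int (f n) \<Longrightarrow> x [^] z \<in> V (Suc n)"
      using nhd_power[OF nhd_chainD(1)[OF V, of "Suc n"], of "f n"] by blast
    have "nhd (W' \<inter> W)" using W W' by (intro nhd_Int)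
    moreover from Inter_chain_not_nhd[OF V K this] obtain a where "a \<in> W' \<inter> W" "a \<notin> L"
      by (auto simp: L)
    ultimately have "P n (W' \<inter> W, a)" using W' by (auto simp: P_def)
    then show ?thesis by force
  qed
  have "\<exists>p. \<forall>n. P n (p n) \<and> Q n (p n) (p (Suc n))"
  proof (rule dependent_nat_choice)
    show "\<exists>x. P 0 x" using step[OF nhd_UNIV] by blast
    show "\<exists>y. P (Suc n) y \<and> Q n x y" if "P n x" for n x
    proof -
      obtain W a where x: "x = (W, a)" by force
      have W: "nhd W" "a \<in> W" "a \<notin> L" using that by (auto simp: P_def x)
      then have ac: "a \<in> carrier G" using nhd_carrier by blast
      have inv_a: "inv a \<notin> L" using W(3) subgroup.m_inv_closed[OF Ls, of "inv a"] ac by auto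
      have cm: "continuous_map T T (\<lambda>x. inv a \<otimes> x)"
        using ac by (intro continuous_map_mult) auto
      \<comment> \<open>The coset of \<open>a\<close> modulo \<open>L\<close> is closed and misses
        \<open>\<one>\<close>. Cutting it away now excludes it for all later elements, since the
        neighbourhoods decrease.\<close>
      have "nhd {x \<in> carrier G. inv a \<otimes> x \<in> carrier G - L}"
        using Lc inv_a ac by (intro nhd_preimage[OF cm]) (auto simp: closedin_def)
      then have "nhd (W \<inter> {x \<in> carrier G. inv a \<otimes> x \<in> carrier G - L})"
        using W(1) by (intro nhd_Int)
      from step[OF this, of "Suc n"] obtain p where
        "P (Suc n) p" "fst p \<subseteq> W \<inter> {x \<in> carrier G. inv a \<otimes> x \<in> carrier G - L}" by blast
      then have "P (Suc n) p \<and> Q n x p" by (auto simp: Q_def x split: prod.splits)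
      then show ?thesis by blast
    qed
  qed
  then obtain p where p: "\<And>n. P n (p n)" "\<And>n. Q n (p n) (p (Suc n))" by blast
  define W where "W = (\<lambda>n. fst (p n))"
  define a where "a = (\<lambda>n. snd (p n))"
  have W: "nhd (W n)" "a n \<in> W n" "\<And>z::int. \<bar>z\<bar> \<le> int (f n) \<Longrightarrow> a n [^] z \<in> V (Suc n)" for n
    using p(1)[of n] by (auto simp: P_def W_def a_def split: prod.splits)
  have dec: "W (Suc n) \<subseteq> W n" and sep: "x \<in> W (Suc n) \<Longrightarrow> inv (a n) \<otimes> x \<notin> L" for n x
    using p(2)[of n] by (auto simp: Q_def W_def a_def split: prod.splits)
  have ra: "range a \<subseteq> carrier G" using W(1,2) nhd_carrier by blast
  have "summable_mod f L a"
    unfolding summable_mod_def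
  proof (intro conjI allI impI ra)
    fix U assume "nhd U"
    then obtain n where n: "V n \<subseteq> U <#> L" using nhd_chain_base[OF V K] unfolding L by blast
    have "word a z js \<in> V n" if "admissible f n z js" for z js
      using that W(3) unfolding admissible_def
      by (intro word_in_nested[OF ra]) (use nhd_chainD[OF V] in auto)
    then show "\<exists>n. \<forall>z js. admissible f n z js \<longrightarrow> word a z js \<in> U <#> L" using n by blast
  qed
  moreover have "inv (a m) \<otimes> a n \<notin> L" if "m < n" for m n
  proof -
    have "W n \<subseteq> W (Suc m)" using lift_Suc_antimono_le[of W "Suc m" n, OF dec] that by simp
    then show ?thesis using sep[of "a n" m] W(2)[of n] by (simp add: subset_iff)
  qed
  ultimately show ?thesis by blast
qed

section \<open>Completeness and the passage to unconditional productivity\<close>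

lemma Cauchy_converges:
  assumes lc: "locally_compact_space T" and p: "\<And>n. p n \<in> carrier G"
    and Cauchy: "\<And>U. nhd U \<Longrightarrow> \<exists>N. \<forall>m\<ge>N. \<forall>n\<ge>m. inv (p m) \<otimes> p n \<in> U"
  shows "\<exists>l\<in>carrier G. limitin T p l sequentially"
proof -
  obtain W K where WK: "openin T W" "compactin T K" "\<one> \<in> W" "W \<subseteq> K"
    using lc[unfolded locally_compact_space_def, rule_format, of \<one>] by auto
  then obtain N where N: "\<And>n. n \<ge> N \<Longrightarrow> inv (p N) \<otimes> p n \<in> K"
    using Cauchy[of W] unfolding nhd_def by (meson order_refl subsetD)
  \<comment> \<open>From \<open>N\<close> on the sequence stays in a translate of a compact
    neighbourhood, so its tails have a common cluster point \<open>l\<close>.\<close>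
  define K' where "K' = (\<lambda>x. p N \<otimes> x) ` K"
  have K': "compactin T K'" unfolding K'_def
    using WK(2) p by (intro image_compactin[OF _ continuous_map_mult]) auto
  have pK: "p n \<in> K'" if "n \<ge> N" for n
    unfolding K'_def using N[OF that] p by (intro image_eqI[where x = "inv (p N) \<otimes> p n"]) auto
  define C where "C = (\<lambda>k. Abstract_Topology.closure_of T (p ` {N + k..}))"
  have CK: "C k \<subseteq> K'" for k
    unfolding C_def using pK K' Hausdorff compactin_imp_closedin
    by (intro closure_of_minimal) auto
  have sub: "p ` {N + k..} \<subseteq> C k" for k
    unfolding C_def using p by (intro closure_of_subset) auto
  let ?X = "subtopology T K'"
  have "(\<Inter>n. C n) \<noteq> {}"
  proof (rule compact_space_imp_nest)
    show "compact_space ?X" using K' compact_space_subtopology by blast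
    show "closedin ?X (C n)" for n
      using CK by (intro closedin_subset_topspace) (simp_all add: C_def)
    show "decseq C" unfolding C_def decseq_Suc_iff by (intro allI closure_of_mono) auto
    show "C n \<noteq> {}" for n using sub[of n] by auto
  qed
  then obtain l where l: "\<And>k. l \<in> C k" by blast
  have lc: "l \<in> carrier G" using l[of 0] CK compactin_carrier[OF K'] by blast
  have "limitin T p l sequentially"
    unfolding limitin_sequentially
  proof (intro conjI allI impI)
    show "l \<in> topspace T" using lc by simp
    fix U assume U: "openin T U \<and> l \<in> U"
    have cm: "continuous_map T T (\<lambda>x. l \<otimes> x)" using lc by (intro continuous_map_mult) auto
    have nU: "nhd {x \<in> carrier G. l \<otimes> x \<in> U}" using U lc by (intro nhd_preimage[OF cm]) auto
    obtain V where V: "nhd V" "\<And>x. x \<in> V \<Longrightarrow> inv x \<in> V"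
      "\<And>x y z. x \<in> V \<Longrightarrow> y \<in> V \<Longrightarrow> z \<in> V \<Longrightarrow> x \<otimes> y \<otimes> z \<in> {x \<in> carrier G. l \<otimes> x \<in> U}"
      using nhd_cube[OF nU] by blast
    obtain M where M: "\<And>m n. m \<ge> M \<Longrightarrow> n \<ge> m \<Longrightarrow> inv (p m) \<otimes> p n \<in> V"
      using Cauchy[OF V(1)] by blast
    let ?lV = "{y \<in> carrier G. inv l \<otimes> y \<in> V}"
    have "openin T ?lV" "l \<in> ?lV" using V(1) lc openin_ltranslate[of V "inv l"] by (auto simp: nhd_def)
    then obtain m where m: "m \<ge> N + M" "inv l \<otimes> p m \<in> V"
      using conjunct2[OF l[of M, unfolded C_def in_closure_of], rule_format, of ?lV] by auto
    have "p n \<in> U" if "n \<ge> m" for n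
    proof -
      \<comment> \<open>The late index \<open>m\<close> is close to \<open>l\<close>, and all
        further terms are close to \<open>p m\<close>; the factor \<open>\<one>\<close> only
        completes the triple product.\<close>
      have "l \<otimes> ((inv l \<otimes> p m) \<otimes> (inv (p m) \<otimes> p n) \<otimes> \<one>) \<in> U"
        using V(1,3) m M[of m n] that by (auto simp: nhd_def)
      then show ?thesis using lc p by (simp add: m_assoc)
    qed
    then show "\<exists>N. \<forall>n\<ge>N. p n \<in> U" by blast
  qed
  then show ?thesis using lc by blast
qed

lemma ordered_prod_closed:
  "range b \<subseteq> carrier G \<Longrightarrow> ordered_prod G b m \<in> carrier G"
  by (induction m) auto

text \<open>A tail of a rearranged product is a word in \<open>a\<close>, and only finitely many
  positions carry an index below a given cutoff. So the partial products are Cauchy for every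
  rearrangement.\<close>

lemma summable_imp_unconditionally_f_productive:
  assumes lc: "locally_compact_space T" and a: "summable_mod f {\<one>} a" and "inj a"
  shows "unconditionally_f_productive G T f a"
proof -
  have ra: "range a \<subseteq> carrier G" using a by (simp add: summable_mod_def)
  then have ac: "a i \<in> carrier G" for i by blast
  have "productive G T (\<lambda>n. a (\<phi> n) [^] z n)"
    if \<phi>: "bij \<phi>" and z: "\<And>n. \<bar>z n\<bar> \<le> int ((f \<circ> \<phi>) n)" for \<phi> and z :: "nat \<Rightarrow> int"
  proof -
    define b where "b = (\<lambda>n. a (\<phi> n) [^] z n)"
    \<comment> \<open>In \<open>z\<close> exponents belong to positions, in \<open>word\<close> they
      belong to indices; \<open>z'\<close> transports them along \<open>\<phi>\<close>.\<close>
    define z' where "z' = z \<circ> inv_into UNIV \<phi>"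
    have z': "z' (\<phi> n) = z n" for n
      using \<phi> by (simp add: z'_def bij_def)
    have rb: "range b \<subseteq> carrier G" using ac by (auto simp: b_def)
    have pc: "ordered_prod G b m \<in> carrier G" for m using rb by (rule ordered_prod_closed)
    have split: "ordered_prod G b (m + k) = ordered_prod G b m \<otimes> word a z' (map \<phi> [Suc m..<Suc (m + k)])" for m k
    proof (induction k)
      case (Suc k)
      have "b (Suc (m + k)) = word a z' [\<phi> (Suc (m + k))]"
        using ac by (simp add: b_def z')
      moreover have "[Suc m..<Suc (m + Suc k)] = [Suc m..<Suc (m + k)] @ [Suc (m + k)]" by simp
      ultimately show ?case using Suc pc ra word_closed[OF ra]
        by (simp add: word_append m_assoc del: upt_Suc word_Cons)
    qed (use pc in simp)
    have "\<exists>N. \<forall>m\<ge>N. \<forall>n\<ge>m. inv (ordered_prod G b m) \<otimes> ordered_prod G b n \<in> U" if "nhd U" for U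
    proof -
      obtain n0 where n0: "\<And>z js. admissible f n0 z js \<Longrightarrow> word a z js \<in> U <#> {\<one>}"
        using a \<open>nhd U\<close> unfolding summable_mod_def by blast
      have "finite (\<phi> -` {..<n0})" using \<phi> by (intro finite_vimageI) (auto simp: bij_def)
      then obtain N where N: "\<And>m. \<phi> m < n0 \<Longrightarrow> m \<le> N"
        by (meson finite_nat_set_iff_bounded_le lessThan_iff vimageI)
      have "inv (ordered_prod G b m) \<otimes> ordered_prod G b n \<in> U" if "m \<ge> N" "n \<ge> m" for m n
      proof -
        obtain k where k: "n = m + k" using \<open>n \<ge> m\<close> le_Suc_ex by blast
        let ?w = "word a z' (map \<phi> [Suc m..<Suc (m + k)])"
        have "inj_on \<phi> A" for A using \<phi> by (meson bij_is_inj inj_on_subset subset_UNIV)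
        moreover have "n0 \<le> \<phi> i" if "Suc m \<le> i" for i using N[of i] that \<open>m \<ge> N\<close> by (force simp: not_less)
        ultimately have "admissible f n0 z' (map \<phi> [Suc m..<Suc (m + k)])"
          using z z' by (auto simp: admissible_def distinct_map simp del: upt_Suc)
        from n0[OF this] have "?w \<in> U"
          using nhd_carrier[OF \<open>nhd U\<close>] by (auto simp: set_mult_def)
        then show ?thesis using split[of m k] k pc ra by simp
      qed
      then show ?thesis by blast
    qed
    then have "\<exists>l\<in>carrier G. limitin T (ordered_prod G b) l sequentially"
      by (intro Cauchy_converges[OF lc] pc)
    then show ?thesis using rb by (simp add: productive_def b_def)
  qed
  moreover have "inj (\<lambda>n. a (\<phi> n))" if "bij \<phi>" for \<phi>
    using \<open>inj a\<close> that by (simp add: bij_def inj_compose[unfolded o_def])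
  ultimately show ?thesis
    using ra \<open>inj a\<close> by (auto simp: unconditionally_f_productive_def f_productive_def)
qed

section \<open>Topological subgroups\<close>

lemma subgroup_topological_group:
  assumes "subgroup H G"
  shows "hausdorff_topological_group (G\<lparr>carrier := H\<rparr>) (subtopology T H)"
proof -
  let ?G = "G\<lparr>carrier := H\<rparr>" and ?T = "subtopology T H"
  have Hc: "H \<subseteq> carrier G" using assms by (rule subgroup.subset)
  interpret H: group ?G using assms subgroup_imp_group by blast
  have inv: "inv\<^bsub>?G\<^esub> x = inv x" if "x \<in> H" for x
    using that by (simp add: m_inv_consistent[OF assms])
  show ?thesis
  proof
    show "topspace ?T = carrier ?G" using Hc by auto
    have "continuous_map (prod_topology ?T ?T) T (\<lambda>p. fst p \<otimes> snd p)"
      using continuous_map_from_subtopology[of T T id H]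
      by (intro continuous_map_mult continuous_map_compose[OF continuous_map_fst, of ?T T id, unfolded o_def id_def]
          continuous_map_compose[OF continuous_map_snd, of ?T T id, unfolded o_def id_def]) (simp_all add: id_def)
    then show "continuous_map (prod_topology ?T ?T) ?T (\<lambda>(x, y). x \<otimes>\<^bsub>?G\<^esub> y)"
      using Hc subgroup.m_closed[OF assms] by (auto simp: continuous_map_in_subtopology case_prod_unfold)
    have "continuous_map ?T ?T (\<lambda>x. inv x)"
      using continuous_map_from_subtopology[OF continuous_inv] subgroup.m_inv_closed[OF assms]
      by (auto simp: continuous_map_in_subtopology)
    then show "continuous_map ?T ?T (\<lambda>x. inv\<^bsub>?G\<^esub> x)"
      by (rule continuous_map_eq) (use inv in auto)
    show "Hausdorff_space ?T" using Hausdorff by (rule Hausdorff_space_subtopology)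
  qed
qed

lemma unconditionally_f_productive_subgroup:
  assumes "subgroup H G" and a: "unconditionally_f_productive (G\<lparr>carrier := H\<rparr>) (subtopology T H) f a"
  shows "unconditionally_f_productive G T f a"
proof -
  let ?G = "G\<lparr>carrier := H\<rparr>" and ?T = "subtopology T H"
  have Hc: "H \<subseteq> carrier G" using assms by (simp add: subgroup.subset)
  have prod: "ordered_prod ?G b m = ordered_prod G b m" for b m
    by (induction m) auto
  have "productive G T b" if "productive ?G ?T b" for b
    using that Hc by (auto simp: productive_def prod[abs_def] limitin_subtopology)
  moreover have "(\<lambda>n. a (\<phi> n) [^]\<^bsub>?G\<^esub> z n) = (\<lambda>n. a (\<phi> n) [^] z n)" for \<phi> and z :: "nat \<Rightarrow> int"
    using a by (intro ext) (simp add: unconditionally_f_productive_def int_pow_consistent[OF assms(1)] image_subset_iff)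
  moreover have "a n \<in> carrier G" for n
    using a Hc by (auto simp: unconditionally_f_productive_def)
  ultimately show ?thesis
    using a unfolding unconditionally_f_productive_def f_productive_def by auto
qed

end

section \<open>The Haar mean of a compact group\<close>

locale compact_topological_group = hausdorff_topological_group +
  assumes compact: "compact_space T"

text \<open>Von Neumann's approach to the Haar mean by repeated finite averages of translates.
  Averages are recorded as operators and not as averaged functions, so that one average can be
  applied to several functions and composed with others.\<close>

inductive_set (in group) left_avgs :: "(('a \<Rightarrow> real) \<Rightarrow> 'a \<Rightarrow> real) set" where
  id: "(\<lambda>f. f) \<in> left_avgs"
| step: "P \<in> left_avgs \<Longrightarrow> finite A \<Longrightarrow> A \<noteq> {} \<Longrightarrow> A \<subseteq> carrier G \<Longrightarrow>
    (\<lambda>f y. (\<Sum>x\<in>A. P f (x \<otimes> y)) / real (card A)) \<in> left_avgs"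

inductive_set (in group) right_avgs :: "(('a \<Rightarrow> real) \<Rightarrow> 'a \<Rightarrow> real) set" where
  id: "(\<lambda>f. f) \<in> right_avgs"
| step: "Q \<in> right_avgs \<Longrightarrow> finite A \<Longrightarrow> A \<noteq> {} \<Longrightarrow> A \<subseteq> carrier G \<Longrightarrow>
    (\<lambda>f y. (\<Sum>x\<in>A. Q f (y \<otimes> x)) / real (card A)) \<in> right_avgs"

section \<open>Algebra of the averaging operators\<close>

context group
begin

lemma left_avgs_linear:
  assumes "P \<in> left_avgs"
  shows "P (\<lambda>y. c * f y + d * g y) z = c * P f z + d * P g z"
  using assms
  by (induction arbitrary: z)
    (simp_all add: sum.distrib sum_distrib_left [symmetric] add_divide_distrib)

lemma left_avgs_const:
  assumes "P \<in> left_avgs"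
  shows "P (\<lambda>_. c) z = c"
  using assms by (induction arbitrary: z) simp_all

lemma left_avgs_sum:
  assumes "P \<in> left_avgs"
  shows "P (\<lambda>y. (\<Sum>i\<in>A. g i y) / c) z = (\<Sum>i\<in>A. P (g i) z) / c"
  using assms
proof (induction arbitrary: z)
  case (step P B)
  have "(\<Sum>x\<in>B. \<Sum>i\<in>A. P (g i) (x \<otimes> z)) = (\<Sum>i\<in>A. \<Sum>x\<in>B. P (g i) (x \<otimes> z))"
    by (rule sum.swap)
  then show ?case
    by (simp add: step.IH sum_divide_distrib [symmetric] divide_divide_eq_left mult.commute)
qed simp

lemma left_avgs_mono:
  assumes "P \<in> left_avgs" "\<And>y. y \<in> carrier G \<Longrightarrow> f y \<le> g y" "z \<in> carrier G"
  shows "P f z \<le> P g z"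
  using assms(1,3)
proof (induction arbitrary: z)
  case (step P B)
  have "(\<Sum>x\<in>B. P f (x \<otimes> z)) \<le> (\<Sum>x\<in>B. P g (x \<otimes> z))"
    using step by (intro sum_mono step.IH) auto
  then show ?case by (simp add: divide_right_mono)
qed (use assms in simp)

lemma left_avgs_cong:
  assumes "P \<in> left_avgs" "\<And>y. y \<in> carrier G \<Longrightarrow> f y = g y" "z \<in> carrier G"
  shows "P f z = P g z"
  using left_avgs_mono[OF assms(1) _ assms(3), of f g] left_avgs_mono[OF assms(1) _ assms(3), of g f] assms(2)
  by force

lemma left_avgs_close:
  assumes "P \<in> left_avgs" "\<And>y. y \<in> carrier G \<Longrightarrow> \<bar>f y - c\<bar> \<le> e" "z \<in> carrier G"
  shows "\<bar>P f z - c\<bar> \<le> e"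
proof -
  have "f y \<le> c + e" "c - e \<le> f y" if "y \<in> carrier G" for y using assms(2)[OF that] by (simp_all add: abs_le_iff)
  then have "P f z \<le> c + e" "c - e \<le> P f z"
    using left_avgs_mono[OF assms(1) _ assms(3), of f "\<lambda>_. c + e"]
      left_avgs_mono[OF assms(1) _ assms(3), of "\<lambda>_. c - e" f] left_avgs_const[OF assms(1)] by simp_all
  then show ?thesis by (simp add: abs_le_iff)
qed

lemma left_avgs_translate:
  assumes "P \<in> left_avgs" "x \<in> carrier G" "z \<in> carrier G"
  shows "P (\<lambda>y. f (y \<otimes> x)) z = P f (z \<otimes> x)"
  using assms(1,3)
proof (induction arbitrary: z)
  case (step P B)
  have "P (\<lambda>y. f (y \<otimes> x)) (b \<otimes> z) = P f (b \<otimes> (z \<otimes> x))" if "b \<in> B" for b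
  proof -
    have "b \<in> carrier G" using that step by blast
    then show ?thesis using step.IH[of "b \<otimes> z"] step.prems assms(2) by (simp add: m_assoc)
  qed
  then show ?case by simp
qed simp

text \<open>Left averages commute with right translations, so every average of \<open>f\<close>
  inherits the right modulus of continuity of \<open>f\<close>: one neighbourhood serves the whole
  family.\<close>

lemma left_avgs_modulus:
  assumes "P \<in> left_avgs" "\<And>u. u \<in> carrier G \<Longrightarrow> \<bar>f (u \<otimes> h) - f u\<bar> \<le> e" "h \<in> carrier G" "z \<in> carrier G"
  shows "\<bar>P f (z \<otimes> h) - P f z\<bar> \<le> e"
proof -
  have "P (\<lambda>u. 1 * f (u \<otimes> h) + (-1) * f u) z = P f (z \<otimes> h) - P f z"
    using left_avgs_linear[OF assms(1), of 1 "\<lambda>u. f (u \<otimes> h)" "-1" f z] left_avgs_translate[OF assms(1,3,4)]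
    by simp
  then show ?thesis
    using left_avgs_close[OF assms(1), of "\<lambda>u. 1 * f (u \<otimes> h) + (-1) * f u" 0 e z] assms by simp
qed

lemma left_avgs_comp:
  assumes "P \<in> left_avgs" "Q \<in> left_avgs"
  shows "(\<lambda>f. P (Q f)) \<in> left_avgs"
  using assms by (induction) (auto intro: left_avgs.intros)

lemma left_translation_avg:
  "x \<in> carrier G \<Longrightarrow> (\<lambda>f y. f (x \<otimes> y)) \<in> left_avgs"
  using left_avgs.step[OF left_avgs.id, of "{x}"] by simp

lemma left_right_avgs_commute:
  assumes "P \<in> left_avgs" "Q \<in> right_avgs" "z \<in> carrier G"
  shows "P (Q f) z = Q (P f) z"
  using assms(2,3)
proof (induction arbitrary: z)
  case (step Q A)
  have "P (\<lambda>y. Q f (y \<otimes> x)) z = Q (P f) (z \<otimes> x)" if "x \<in> A" for x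
  proof -
    have x: "x \<in> carrier G" using that step by blast
    then show ?thesis
      using step.IH[of "z \<otimes> x"] step.prems left_avgs_translate[OF assms(1) x step.prems] by simp
  qed
  then show ?case by (simp add: left_avgs_sum[OF assms(1)])
qed simp

text \<open>Inversion exchanges left and right translations; this transfers near-constancy from left
  averages to right averages.\<close>

lemma left_avg_inverse:
  assumes "P \<in> left_avgs"
  shows "\<exists>Q\<in>right_avgs. \<forall>f. \<forall>y\<in>carrier G. Q f y = P (\<lambda>u. f (inv u)) (inv y)"
  using assms
proof induction
  case id
  then show ?case by (intro bexI[OF _ right_avgs.id]) simp
next
  case (step P A)
  then obtain Q where Q: "Q \<in> right_avgs" "\<And>f y. y \<in> carrier G \<Longrightarrow> Q f y = P (\<lambda>u. f (inv u)) (inv y)" by blast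
  let ?B = "(\<lambda>x. inv x) ` A"
  have inj: "inj_on (\<lambda>x. inv x) A" using step(4) by (meson inj_on_subset inv_inj)
  have eq: "(\<Sum>x\<in>?B. Q f (y \<otimes> x)) / real (card ?B) = (\<Sum>x\<in>A. P (\<lambda>u. f (inv u)) (x \<otimes> inv y)) / real (card A)"
    if y: "y \<in> carrier G" for f y
  proof -
    have "Q f (y \<otimes> inv x) = P (\<lambda>u. f (inv u)) (x \<otimes> inv y)" if "x \<in> A" for x
    proof -
      have "x \<in> carrier G" using that step by blast
      then show ?thesis using Q(2)[of "y \<otimes> inv x" f] y by (simp add: inv_mult_group)
    qed
    then show ?thesis using inj by (simp add: sum.reindex card_image)
  qed
  have mem: "(\<lambda>f y. (\<Sum>x\<in>?B. Q f (y \<otimes> x)) / real (card ?B)) \<in> right_avgs"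
    using step Q(1) by (intro right_avgs.step) auto
  show ?case by (rule bexI[OF _ mem]) (intro allI ballI eq)
qed

end

section \<open>Convergence of averages and the invariant mean\<close>

context compact_topological_group
begin

abbreviation cont :: "('a \<Rightarrow> real) \<Rightarrow> bool" where "cont f \<equiv> continuous_map T euclideanreal f"

abbreviation cont2 :: "('a \<times> 'a \<Rightarrow> real) \<Rightarrow> bool" where
  "cont2 F \<equiv> continuous_map (prod_topology T T) euclideanreal F"

lemma cont_bounded:
  assumes "cont f"
  obtains B where "\<And>x. x \<in> carrier G \<Longrightarrow> \<bar>f x\<bar> \<le> B"
proof -
  have "compactin euclideanreal (f ` carrier G)"
    using assms compact by (metis compact_space_def image_compactin topspace)
  then have "bounded (f ` carrier G)" by (simp add: compact_imp_bounded)
  then show ?thesis using that by (auto simp: bounded_iff)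
qed

lemma contI:
  assumes "\<And>x e. x \<in> carrier G \<Longrightarrow> e > 0 \<Longrightarrow> \<exists>N. openin T N \<and> x \<in> N \<and> (\<forall>y\<in>N. \<bar>f y - f x\<bar> < e)"
  shows "cont f"
  unfolding continuous_map_def
proof (intro conjI allI impI)
  fix S :: "real set" assume "openin euclidean S"
  then have S: "open S" by simp
  show "openin T {x \<in> topspace T. f x \<in> S}"
  proof (subst openin_subopen, intro ballI)
    fix x assume "x \<in> {x \<in> topspace T. f x \<in> S}"
    then have x: "x \<in> carrier G" "f x \<in> S" by auto
    then obtain e where e: "e > 0" "\<And>r. dist r (f x) < e \<Longrightarrow> r \<in> S"
      using S unfolding open_dist by blast
    obtain N where "openin T N" "x \<in> N" "\<And>y. y \<in> N \<Longrightarrow> \<bar>f y - f x\<bar> < e"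
      using assms[OF x(1) e(1)] by blast
    then show "\<exists>N. openin T N \<and> x \<in> N \<and> N \<subseteq> {x \<in> topspace T. f x \<in> S}"
      using e(2) openin_carrier[of N] by (intro exI[of _ N]) (auto simp: dist_real_def)
  qed
qed simp

lemma finite_translates_cover:
  assumes "nhd U"
  shows "\<exists>F. finite F \<and> F \<noteq> {} \<and> F \<subseteq> carrier G \<and> (\<forall>y\<in>carrier G. \<exists>g\<in>F. inv g \<otimes> y \<in> U)"
proof -
  define N where "N = (\<lambda>g. {y \<in> carrier G. inv g \<otimes> y \<in> U})"
  have op: "\<And>C. C \<in> N ` carrier G \<Longrightarrow> openin T C"
    using openin_ltranslate assms by (auto simp: N_def nhd_def)
  have "topspace T \<subseteq> \<Union>(N ` carrier G)" using assms by (force simp: N_def nhd_def)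
  then obtain \<F> where "finite \<F>" "\<F> \<subseteq> N ` carrier G" "topspace T \<subseteq> \<Union>\<F>"
    using compact op unfolding compact_space_alt by meson
  then obtain F where F: "finite F" "F \<subseteq> carrier G" "carrier G \<subseteq> \<Union>(N ` F)"
    by (metis finite_subset_image topspace)
  then have "F \<noteq> {}" using one_closed by blast
  moreover have "\<forall>y\<in>carrier G. \<exists>g\<in>F. inv g \<otimes> y \<in> U" using F(3) by (auto simp: N_def)
  ultimately show ?thesis using F by blast
qed

text \<open>The points where the increment in the first variable is below \<open>e\<close> form an
  open set around the compact slice \<open>{x} \<times> carrier G\<close>, to which the tube lemma
  applies.\<close>

lemma parametric_uniform_continuity:
  fixes F :: "'a \<Rightarrow> 'a \<Rightarrow> real"
  assumes F: "cont2 (\<lambda>(x, y). F x y)"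
    and "e > 0" "x \<in> carrier G"
  shows "\<exists>N. openin T N \<and> x \<in> N \<and> (\<forall>x'\<in>N. \<forall>y\<in>carrier G. \<bar>F x' y - F x y\<bar> < e)"
proof -
  let ?X = "prod_topology T T"
  have "continuous_map ?X ?X (\<lambda>p. (x, snd p))"
    using assms(3) by (intro continuous_map_pairedI continuous_map_snd) auto
  from continuous_map_compose[OF this F]
  have "continuous_map ?X euclideanreal (\<lambda>p. \<bar>F (fst p) (snd p) - F x (snd p)\<bar>)"
    using F by (intro continuous_map_real_abs continuous_map_diff) (simp_all add: o_def case_prod_unfold)
  then have S: "openin ?X {p \<in> topspace ?X. \<bar>F (fst p) (snd p) - F x (snd p)\<bar> \<in> {..<e}}"
    by (rule openin_continuous_map_preimage) simp
  define S where "S = {p \<in> topspace ?X. \<bar>F (fst p) (snd p) - F x (snd p)\<bar> \<in> {..<e}}"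
  have S': "openin ?X S" using S by (simp only: S_def)
  have "compactin T (carrier G)" using compact by (simp add: compact_space_def)
  moreover have "{x} \<times> carrier G \<subseteq> S" using assms(2,3) by (auto simp: S_def)
  ultimately obtain N V where "openin T N" "x \<in> N" "carrier G \<subseteq> V" "N \<times> V \<subseteq> S"
    using tube_lemma_right[OF S'] assms(3) by (metis topspace)
  moreover have "\<bar>F x' y - F x y\<bar> < e" if "(x', y) \<in> S" for x' y using that by (simp add: S_def)
  ultimately show ?thesis by (metis SigmaI subsetD)
qed

lemma joint_cont_swap:
  assumes "cont2 (\<lambda>(x, y). F x y)"
  shows "cont2 (\<lambda>(y, x). F x y)"
proof -
  have "continuous_map (prod_topology T T) (prod_topology T T) (\<lambda>p. (snd p, fst p))"
    by (intro continuous_map_pairedI continuous_map_snd continuous_map_fst)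
  from continuous_map_compose[OF this assms] show ?thesis by (simp add: o_def case_prod_unfold)
qed

lemma cont_ltranslate: "cont f \<Longrightarrow> x \<in> carrier G \<Longrightarrow> cont (\<lambda>y. f (x \<otimes> y))"
  using continuous_map_compose[of T T "\<lambda>y. x \<otimes> y" euclideanreal f]
  by (simp add: o_def continuous_map_mult)

lemma cont_inv: "cont f \<Longrightarrow> cont (\<lambda>y. f (inv y))"
  using continuous_map_compose[of T T "\<lambda>y. inv y" euclideanreal f]
  by (simp add: o_def continuous_map_inv)

lemma cont_mult2: "cont f \<Longrightarrow> cont2 (\<lambda>(x, y). f (x \<otimes> y))"
  using continuous_map_compose[OF continuous_mult, of euclideanreal f]
  by (simp add: o_def case_prod_unfold)

lemma uniformly_continuous:
  assumes "cont f" "e > 0"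
  shows "\<exists>U. nhd U \<and> (\<forall>u\<in>carrier G. \<forall>h\<in>U. \<bar>f (u \<otimes> h) - f u\<bar> < e)"
proof -
  \<comment> \<open>With the variables exchanged the parameter is the right factor \<open>h\<close>,
    and it is varied near \<open>\<one>\<close>.\<close>
  from parametric_uniform_continuity[OF joint_cont_swap[OF cont_mult2[OF assms(1)]] assms(2) one_closed]
  show ?thesis by (auto simp: nhd_def)
qed

lemma left_avgs_cont:
  assumes "P \<in> left_avgs" "cont f"
  shows "cont (P f)"
  using assms(1)
proof induction
  case (step P A)
  have "cont (\<lambda>y. \<Sum>x\<in>A. P f (x \<otimes> y))"
    using step by (intro continuous_map_sum cont_ltranslate) auto
  then show ?case by (intro continuous_map_real_divide) (auto simp: card_gt_0_iff step)
qed (use assms in simp)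

text \<open>At a minimum point \<open>y0\<close> of \<open>P f\<close>, with value \<open>m\<close>,
  equicontinuity keeps \<open>P f\<close> below \<open>m + e\<close> on the translate of
  \<open>U\<close> by \<open>y0\<close>. Among the translates by \<open>y0 \<otimes> inv g\<close>
  with \<open>g\<close> in \<open>F\<close>, at least one moves a given \<open>y\<close> into that
  set, so one of the \<open>card F\<close> terms is at most \<open>m + e\<close> and the others are
  at most \<open>b\<close>. The contraction factor does not depend on \<open>P\<close>, which makes
  the iteration geometric.\<close>

lemma left_avg_oscillation_step:
  assumes f: "cont f" and P: "P \<in> left_avgs"
    and U: "\<And>u h. u \<in> carrier G \<Longrightarrow> h \<in> U \<Longrightarrow> \<bar>f (u \<otimes> h) - f u\<bar> < e" "U \<subseteq> carrier G"
    and F: "finite F" "F \<noteq> {}" "F \<subseteq> carrier G" "\<And>y. y \<in> carrier G \<Longrightarrow> \<exists>g\<in>F. inv g \<otimes> y \<in> U"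
    and ab: "\<And>y. y \<in> carrier G \<Longrightarrow> a \<le> P f y \<and> P f y \<le> b"
  shows "\<exists>Q\<in>left_avgs. \<exists>a' b'. (\<forall>y\<in>carrier G. a' \<le> Q f y \<and> Q f y \<le> b') \<and>
    b' - a' - e \<le> (1 - 1 / card F) * (b - a - e)"
proof -
  have "compactin euclideanreal (P f ` carrier G)"
    using left_avgs_cont[OF P f] compact by (metis compact_space_def image_compactin topspace)
  then have "compact (P f ` carrier G)" by simp
  moreover have "P f ` carrier G \<noteq> {}" by blast
  ultimately obtain y0 where y0: "y0 \<in> carrier G" "\<And>y. y \<in> carrier G \<Longrightarrow> P f y0 \<le> P f y"
    using compact_attains_inf[of "P f ` carrier G"] by auto
  define m where "m = P f y0"
  have near: "P f (y0 \<otimes> h) \<le> m + e" if "h \<in> U" for h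
  proof -
    have "\<bar>P f (y0 \<otimes> h) - P f y0\<bar> \<le> e"
      using U that y0 by (intro left_avgs_modulus[OF P]) (auto intro: less_imp_le)
    then show ?thesis by (simp add: m_def abs_le_iff)
  qed
  define A where "A = (\<lambda>g. y0 \<otimes> inv g) ` F"
  define n where "n = real (card F)"
  have n: "n > 0" using F by (simp add: n_def card_gt_0_iff)
  have "inj_on (\<lambda>g. y0 \<otimes> inv g) F"
  proof (rule inj_onI)
    fix g h assume "g \<in> F" "h \<in> F" "y0 \<otimes> inv g = y0 \<otimes> inv h"
    moreover from this have "g \<in> carrier G" "h \<in> carrier G" using F by blast+
    ultimately show "g = h" using y0 by (metis inv_closed inv_inv inv_mult_cancel(1))
  qed
  then have cA: "card A = card F" by (simp add: A_def card_image)
  have A: "finite A" "A \<noteq> {}" "A \<subseteq> carrier G" using F y0 by (auto simp: A_def)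
  let ?Q = "\<lambda>f y. (\<Sum>x\<in>A. P f (x \<otimes> y)) / real (card A)"
  have Q: "?Q \<in> left_avgs" using P A by (rule left_avgs.step)
  have upper: "?Q f y \<le> b - (b - m - e) / n" if y: "y \<in> carrier G" for y
  proof -
    obtain g where g: "g \<in> F" "inv g \<otimes> y \<in> U" using F(4)[OF y] by blast
    have gc: "g \<in> carrier G" using g F by blast
    define x0 where "x0 = y0 \<otimes> inv g"
    have x0: "x0 \<in> A" "x0 \<otimes> y = y0 \<otimes> (inv g \<otimes> y)"
      using g gc y y0 by (auto simp: x0_def A_def m_assoc)
    have "(\<Sum>x\<in>A. P f (x \<otimes> y)) = P f (x0 \<otimes> y) + (\<Sum>x\<in>A - {x0}. P f (x \<otimes> y))"
      using A(1) x0(1) by (simp add: sum.remove)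
    also have "\<dots> \<le> (m + e) + (\<Sum>x\<in>A - {x0}. b)"
    proof (intro add_mono sum_mono)
      show "P f (x0 \<otimes> y) \<le> m + e" using near[OF g(2)] x0 by simp
      show "P f (x \<otimes> y) \<le> b" if "x \<in> A - {x0}" for x using that A(3) ab[of "x \<otimes> y"] y by blast
    qed
    also have "(\<Sum>x\<in>A - {x0}. b) = (n - 1) * b"
      using x0 A(1) n by (simp add: cA n_def of_nat_diff)
    finally have "(\<Sum>x\<in>A. P f (x \<otimes> y)) \<le> n * b - (b - m - e)" by (simp add: algebra_simps)
    also have "\<dots> = n * (b - (b - m - e) / n)" using n by (simp add: field_simps)
    finally have "(\<Sum>x\<in>A. P f (x \<otimes> y)) \<le> n * (b - (b - m - e) / n)" .
    then show ?thesis using n by (simp add: cA n_def [symmetric] pos_divide_le_eq mult.commute)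
  qed
  have lower: "m \<le> ?Q f y" if y: "y \<in> carrier G" for y
  proof -
    have "(\<Sum>x\<in>A. m) \<le> (\<Sum>x\<in>A. P f (x \<otimes> y))"
      using A y y0 by (intro sum_mono) (auto simp: m_def)
    then show ?thesis using n by (simp add: cA n_def [symmetric] pos_le_divide_eq mult.commute)
  qed
  have am: "a \<le> m" using ab y0 by (simp add: m_def)
  have "b - (b - m - e) / n - m - e = (b - m - e) - (b - m - e) / n" by linarith
  also have "\<dots> = (1 - 1 / n) * (b - m - e)" by (simp add: left_diff_distrib)
  also have "\<dots> \<le> (1 - 1 / n) * (b - a - e)"
    using am n F by (intro mult_left_mono) (auto simp: n_def Suc_le_eq card_gt_0_iff)
  finally have osc: "b - (b - m - e) / n - m - e \<le> (1 - 1 / card F) * (b - a - e)" by (simp only: n_def)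
  show ?thesis
  proof (rule bexI[OF _ Q], rule exI[of _ m], rule exI[of _ "b - (b - m - e) / n"], intro conjI ballI)
    fix y assume y: "y \<in> carrier G"
    show "m \<le> ?Q f y" by (rule lower[OF y])
    show "?Q f y \<le> b - (b - m - e) / n" by (rule upper[OF y])
  qed (rule osc)
qed

lemma left_avg_nearly_constant:
  assumes f: "cont f" and "e > 0"
  shows "\<exists>P\<in>left_avgs. \<exists>c. \<forall>y\<in>carrier G. \<bar>P f y - c\<bar> \<le> e"
proof -
  \<comment> \<open>One half of \<open>e\<close> is the oscillation that the iteration cannot
    remove, the other half absorbs the geometric remainder.\<close>
  define d where "d = e / 2"
  have d: "d > 0" using assms by (simp add: d_def)
  obtain U where U: "nhd U" "\<And>u h. u \<in> carrier G \<Longrightarrow> h \<in> U \<Longrightarrow> \<bar>f (u \<otimes> h) - f u\<bar> < d"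
    using uniformly_continuous[OF f d] by blast
  obtain F where F: "finite F" "F \<noteq> {}" "F \<subseteq> carrier G" "\<And>y. y \<in> carrier G \<Longrightarrow> \<exists>g\<in>F. inv g \<otimes> y \<in> U"
    using finite_translates_cover[OF U(1)] by blast
  define q where "q = 1 - 1 / real (card F)"
  have q: "0 \<le> q" "q < 1" using F by (auto simp: q_def card_gt_0_iff Suc_le_eq)
  obtain B where B: "\<And>y. y \<in> carrier G \<Longrightarrow> \<bar>f y\<bar> \<le> B" using cont_bounded[OF f] by blast
  have iter: "\<exists>P\<in>left_avgs. \<exists>a b. (\<forall>y\<in>carrier G. a \<le> P f y \<and> P f y \<le> b) \<and> b - a - d \<le> q ^ k * (2 * B - d)" for k
  proof (induction k)
    case 0
    have "\<forall>y\<in>carrier G. - B \<le> f y \<and> f y \<le> B" using B by (auto simp: abs_le_iff minus_le_iff)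
    then show ?case by (intro bexI[OF _ left_avgs.id] exI[of _ "- B"] exI[of _ B]) auto
  next
    case (Suc k)
    then obtain P a b where P: "P \<in> left_avgs" "\<And>y. y \<in> carrier G \<Longrightarrow> a \<le> P f y \<and> P f y \<le> b"
      "b - a - d \<le> q ^ k * (2 * B - d)" by blast
    obtain Q a' b' where Q: "Q \<in> left_avgs" "\<forall>y\<in>carrier G. a' \<le> Q f y \<and> Q f y \<le> b'"
      "b' - a' - d \<le> q * (b - a - d)"
      using left_avg_oscillation_step[OF f P(1) U(2) nhd_carrier[OF U(1)] F P(2)] unfolding q_def by blast
    have "q * (b - a - d) \<le> q * (q ^ k * (2 * B - d))" using P(3) q by (intro mult_left_mono) auto
    then show ?case using Q by (intro bexI[OF _ Q(1)] exI[of _ a'] exI[of _ b']) auto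
  qed
  have "(\<lambda>k. q ^ k * (2 * B - d)) \<longlonglongrightarrow> 0 * (2 * B - d)"
    using q by (intro tendsto_mult LIMSEQ_realpow_zero) auto
  then have "eventually (\<lambda>k. q ^ k * (2 * B - d) < d) sequentially"
    using d by (intro order_tendstoD(2)) auto
  then obtain k where k: "q ^ k * (2 * B - d) < d" by (auto simp: eventually_sequentially)
  obtain P a b where P: "P \<in> left_avgs" "\<And>y. y \<in> carrier G \<Longrightarrow> a \<le> P f y \<and> P f y \<le> b"
      "b - a - d \<le> q ^ k * (2 * B - d)" using iter[of k] by blast
  have "\<bar>P f y - a\<bar> \<le> e" if "y \<in> carrier G" for y
    using P(2)[OF that] P(3) k by (auto simp: d_def)
  then show ?thesis using P(1) by blast
qed

lemma right_avg_nearly_constant: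
  assumes f: "cont f" and "e > 0"
  shows "\<exists>Q\<in>right_avgs. \<exists>c. \<forall>y\<in>carrier G. \<bar>Q f y - c\<bar> \<le> e"
proof -
  obtain P c where P: "P \<in> left_avgs" "\<And>y. y \<in> carrier G \<Longrightarrow> \<bar>P (\<lambda>u. f (inv u)) y - c\<bar> \<le> e"
    using left_avg_nearly_constant[OF cont_inv[OF f] assms(2)] by blast
  obtain Q where "Q \<in> right_avgs" "\<And>f y. y \<in> carrier G \<Longrightarrow> Q f y = P (\<lambda>u. f (inv u)) (inv y)"
    using left_avg_inverse[OF P(1)] by blast
  then show ?thesis using P(2) by (metis inv_closed)
qed

lemma right_avgs_close:
  assumes "Q \<in> right_avgs" "\<And>y. y \<in> carrier G \<Longrightarrow> a \<le> f y \<and> f y \<le> b" "z \<in> carrier G"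
  shows "a \<le> Q f z \<and> Q f z \<le> b"
  using assms(1,3)
proof (induction arbitrary: z)
  case (step Q A)
  have "a \<le> Q f (z \<otimes> x) \<and> Q f (z \<otimes> x) \<le> b" if "x \<in> A" for x
    using that step by blast
  then have "(\<Sum>x\<in>A. a) \<le> (\<Sum>x\<in>A. Q f (z \<otimes> x))" "(\<Sum>x\<in>A. Q f (z \<otimes> x)) \<le> (\<Sum>x\<in>A. b)"
    by (intro sum_mono; blast)+
  moreover have "real (card A) > 0" using step by (simp add: card_gt_0_iff)
  ultimately show ?case by (simp add: pos_le_divide_eq pos_divide_le_eq mult.commute)
qed (use assms in simp)

text \<open>A total function on all real functions. For continuous ones \<open>mean_eqI_le\<close>
  shows that this supremum of lower bounds is the limit of the nearly constant left
  averages.\<close>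

definition mean :: "('a \<Rightarrow> real) \<Rightarrow> real" where
  "mean f = Sup {a. \<exists>P\<in>left_avgs. \<forall>y\<in>carrier G. a \<le> P f y}"

text \<open>Right averages commute with left averages and can be made nearly constant as well; this is
  what forces all nearly constant left averages of a function to agree.\<close>

lemma left_avg_bounds:
  assumes f: "cont f" and P: "P \<in> left_avgs" "\<And>y. y \<in> carrier G \<Longrightarrow> a \<le> P f y"
    and P': "P' \<in> left_avgs" "\<And>y. y \<in> carrier G \<Longrightarrow> P' f y \<le> b"
  shows "a \<le> b"
proof (rule field_le_epsilon)
  fix e :: real assume "e > 0"
  then have "e / 2 > 0" by simp
  from right_avg_nearly_constant[OF f this] obtain Q c
    where Q: "Q \<in> right_avgs" "\<And>y. y \<in> carrier G \<Longrightarrow> \<bar>Q f y - c\<bar> \<le> e / 2" by blast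
  obtain M where M: "\<And>y. y \<in> carrier G \<Longrightarrow> \<bar>f y\<bar> \<le> M" using cont_bounded[OF f] by blast
  have bd: "R f y \<le> M" "- M \<le> R f y" if "R \<in> left_avgs" "y \<in> carrier G" for R y
    using left_avgs_close[OF that(1), of f 0 M y] M that by (auto simp: abs_le_iff)
  have 1: "\<bar>P (Q f) \<one> - c\<bar> \<le> e / 2" by (rule left_avgs_close[OF P(1) Q(2) one_closed])
  have 2: "\<bar>P' (Q f) \<one> - c\<bar> \<le> e / 2" by (rule left_avgs_close[OF P'(1) Q(2) one_closed])
  have "a \<le> Q (P f) \<one>"
    using right_avgs_close[OF Q(1), of a "P f" M \<one>] P bd by auto
  also have "\<dots> = P (Q f) \<one>" using left_right_avgs_commute[OF P(1) Q(1)] by simp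
  also have "\<dots> \<le> c + e / 2" using 1 by linarith
  also have "c \<le> P' (Q f) \<one> + e / 2" using 2 by linarith
  also have "P' (Q f) \<one> = Q (P' f) \<one>" using left_right_avgs_commute[OF P'(1) Q(1)] by simp
  also have "\<dots> \<le> b" using right_avgs_close[OF Q(1), of "- M" "P' f" b \<one>] P' bd by auto
  finally show "a \<le> b + e" by simp
qed

lemma mean_eqI_le:
  assumes f: "cont f" and P: "P \<in> left_avgs" "\<And>y. y \<in> carrier G \<Longrightarrow> \<bar>P f y - c\<bar> \<le> e"
  shows "\<bar>mean f - c\<bar> \<le> e"
proof -
  let ?S = "{a. \<exists>P\<in>left_avgs. \<forall>y\<in>carrier G. a \<le> P f y}"
  have 1: "c - e \<in> ?S" and ub: "\<And>y. y \<in> carrier G \<Longrightarrow> P f y \<le> c + e"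
    using P by (auto simp: abs_le_iff algebra_simps)
  have le: "a \<le> c + e" if "a \<in> ?S" for a
    using that left_avg_bounds[OF f _ _ P(1) ub] by blast
  then have "bdd_above ?S" by (auto simp: bdd_above_def)
  then have "c - e \<le> mean f" unfolding mean_def using 1 by (intro cSup_upper)
  moreover have "mean f \<le> c + e" unfolding mean_def using 1 le by (intro cSup_least) auto
  ultimately show ?thesis by (simp add: abs_le_iff)
qed

lemma mean_approx:
  assumes f: "cont f" and "e > 0"
  shows "\<exists>P\<in>left_avgs. \<forall>y\<in>carrier G. \<bar>P f y - mean f\<bar> \<le> e"
proof -
  have "e / 2 > 0" using assms by simp
  from left_avg_nearly_constant[OF f this] obtain P c
    where P: "P \<in> left_avgs" "\<And>y. y \<in> carrier G \<Longrightarrow> \<bar>P f y - c\<bar> \<le> e / 2" by blast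
  then have "\<bar>mean f - c\<bar> \<le> e / 2" by (intro mean_eqI_le[OF f])
  then have "\<bar>P f y - mean f\<bar> \<le> e" if "y \<in> carrier G" for y using P(2)[OF that] by linarith
  then show ?thesis using P(1) by blast
qed

lemma mean_eqI:
  assumes f: "cont f" and "\<And>e. e > 0 \<Longrightarrow> \<exists>P\<in>left_avgs. \<forall>y\<in>carrier G. \<bar>P f y - c\<bar> \<le> e"
  shows "mean f = c"
proof -
  have "\<bar>mean f - c\<bar> \<le> e" if "e > 0" for e
    using assms(2)[OF that] mean_eqI_le[OF f] by blast
  then show ?thesis by (metis abs_le_zero_iff dense_ge eq_iff_diff_eq_0)
qed

lemma mean_const [simp]: "mean (\<lambda>_. c) = c"
  using left_avgs_const by (intro mean_eqI bexI[OF _ left_avgs.id]) auto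

lemma mean_cong:
  assumes "\<And>y. y \<in> carrier G \<Longrightarrow> f y = g y"
  shows "mean f = mean g"
proof -
  have eq: "P f y = P g y" if "P \<in> left_avgs" "y \<in> carrier G" for P y
    using left_avgs_cong[OF that(1) _ that(2)] assms by blast
  then have "(\<exists>P\<in>left_avgs. \<forall>y\<in>carrier G. a \<le> P f y) \<longleftrightarrow> (\<exists>P\<in>left_avgs. \<forall>y\<in>carrier G. a \<le> P g y)" for a
    by (metis eq)
  then show ?thesis by (simp add: mean_def)
qed

lemma mean_left_avg:
  assumes f: "cont f" and P: "P \<in> left_avgs"
  shows "mean (P f) = mean f"
proof -
  have "mean f = mean (P f)"
  proof (rule mean_eqI[OF f])
    fix e :: real assume "e > 0"
    from mean_approx[OF left_avgs_cont[OF P f] this] obtain Q where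
      "Q \<in> left_avgs" "\<forall>y\<in>carrier G. \<bar>Q (P f) y - mean (P f)\<bar> \<le> e" by blast
    then show "\<exists>P'\<in>left_avgs. \<forall>y\<in>carrier G. \<bar>P' f y - mean (P f)\<bar> \<le> e"
      using left_avgs_comp[OF _ P, of Q] by (intro bexI[of _ "\<lambda>f. Q (P f)"]) auto
  qed
  then show ?thesis by simp
qed

lemma mean_ltranslate:
  "cont f \<Longrightarrow> x \<in> carrier G \<Longrightarrow> mean (\<lambda>y. f (x \<otimes> y)) = mean f"
  using mean_left_avg[OF _ left_translation_avg] by blast

text \<open>First \<open>P\<close> makes \<open>f\<close> nearly constant, then \<open>Q\<close>
  does so for \<open>P g\<close>. The additional average \<open>Q\<close> does not spoil what
  \<open>P\<close> achieved for \<open>f\<close>, by \<open>left_avgs_close\<close>.\<close>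

lemma mean_add:
  assumes f: "cont f" and g: "cont g"
  shows "mean (\<lambda>y. f y + g y) = mean f + mean g"
proof (rule mean_eqI)
  show "cont (\<lambda>y. f y + g y)" using assms by (intro continuous_map_add)
  fix e :: real assume "e > 0"
  then have e: "e / 2 > 0" by simp
  from mean_approx[OF f e] obtain P where
    P: "P \<in> left_avgs" "\<And>y. y \<in> carrier G \<Longrightarrow> \<bar>P f y - mean f\<bar> \<le> e / 2" by blast
  from mean_approx[OF left_avgs_cont[OF P(1) g] e] obtain Q where
    Q: "Q \<in> left_avgs" "\<And>y. y \<in> carrier G \<Longrightarrow> \<bar>Q (P g) y - mean (P g)\<bar> \<le> e / 2" by blast
  have "\<bar>Q (P (\<lambda>y. f y + g y)) y - (mean f + mean g)\<bar> \<le> e" if y: "y \<in> carrier G" for y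
  proof -
    have "P (\<lambda>y. f y + g y) = (\<lambda>y. P f y + P g y)"
      using left_avgs_linear[OF P(1), of 1 f 1 g] by auto
    then have "Q (P (\<lambda>y. f y + g y)) y = Q (P f) y + Q (P g) y"
      using left_avgs_linear[OF Q(1), of 1 "P f" 1 "P g" y] by simp
    moreover have "\<bar>Q (P f) y - mean f\<bar> \<le> e / 2" by (rule left_avgs_close[OF Q(1) P(2) y])
    moreover have "\<bar>Q (P g) y - mean g\<bar> \<le> e / 2" using Q(2)[OF y] mean_left_avg[OF g P(1)] by simp
    ultimately show ?thesis by linarith
  qed
  then show "\<exists>R\<in>left_avgs. \<forall>y\<in>carrier G. \<bar>R (\<lambda>y. f y + g y) y - (mean f + mean g)\<bar> \<le> e"
    using left_avgs_comp[OF Q(1) P(1)] by (intro bexI[of _ "\<lambda>f. Q (P f)"]) auto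
qed

lemma mean_scale:
  assumes f: "cont f"
  shows "mean (\<lambda>y. c * f y) = c * mean f"
proof (rule mean_eqI)
  show "cont (\<lambda>y. c * f y)" using f by (intro continuous_map_real_mult) auto
  fix e :: real assume "e > 0"
  \<comment> \<open>The summand 1 covers the case \<open>c = 0\<close>.\<close>
  then have "e / (\<bar>c\<bar> + 1) > 0" by simp
  from mean_approx[OF f this] obtain P where
    P: "P \<in> left_avgs" "\<And>y. y \<in> carrier G \<Longrightarrow> \<bar>P f y - mean f\<bar> \<le> e / (\<bar>c\<bar> + 1)" by blast
  have "\<bar>P (\<lambda>y. c * f y) y - c * mean f\<bar> \<le> e" if y: "y \<in> carrier G" for y
  proof -
    have "P (\<lambda>y. c * f y) y - c * mean f = c * (P f y - mean f)"
      using left_avgs_linear[OF P(1), of c f 0 f y] by (simp add: algebra_simps)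
    also have "\<bar>\<dots>\<bar> \<le> \<bar>c\<bar> * (e / (\<bar>c\<bar> + 1))"
      unfolding abs_mult using P(2)[OF y] by (intro mult_left_mono) auto
    also have "\<dots> \<le> e" using \<open>e > 0\<close> by (simp add: field_simps)
    finally show ?thesis .
  qed
  then show "\<exists>R\<in>left_avgs. \<forall>y\<in>carrier G. \<bar>R (\<lambda>y. c * f y) y - c * mean f\<bar> \<le> e"
    using P(1) by blast
qed

lemma mean_diff:
  assumes f: "cont f" and g: "cont g"
  shows "mean (\<lambda>y. f y - g y) = mean f - mean g"
  using mean_add[OF f, of "\<lambda>y. (-1) * g y"] mean_scale[OF g, of "-1"] g
  by (simp add: continuous_map_minus)

lemma mean_sum:
  assumes "finite I" "\<And>i. i \<in> I \<Longrightarrow> cont (f i)"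
  shows "mean (\<lambda>y. \<Sum>i\<in>I. f i y) = (\<Sum>i\<in>I. mean (f i))"
  using assms
proof (induction I)
  case (insert i I)
  then have "cont (\<lambda>y. \<Sum>i\<in>I. f i y)" by (intro continuous_map_sum) auto
  then show ?case using insert by (simp add: mean_add)
qed simp

lemma mean_mono:
  assumes f: "cont f" and g: "cont g" and le: "\<And>y. y \<in> carrier G \<Longrightarrow> f y \<le> g y"
  shows "mean f \<le> mean g"
proof (rule field_le_epsilon)
  fix e :: real assume "e > 0"
  then have e: "e / 2 > 0" by simp
  from mean_approx[OF f e] obtain P where
    P: "P \<in> left_avgs" "\<And>y. y \<in> carrier G \<Longrightarrow> \<bar>P f y - mean f\<bar> \<le> e / 2" by blast
  from mean_approx[OF left_avgs_cont[OF P(1) g] e] obtain Q where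
    Q: "Q \<in> left_avgs" "\<And>y. y \<in> carrier G \<Longrightarrow> \<bar>Q (P g) y - mean (P g)\<bar> \<le> e / 2" by blast
  have "Q (P f) \<one> \<le> Q (P g) \<one>"
    using left_avgs_mono[OF left_avgs_comp[OF Q(1) P(1)] le one_closed] by simp
  moreover have "\<bar>Q (P f) \<one> - mean f\<bar> \<le> e / 2" by (rule left_avgs_close[OF Q(1) P(2)]) auto
  ultimately show "mean f \<le> mean g + e"
    using Q(2)[OF one_closed] mean_left_avg[OF g P(1)] by linarith
qed

lemma mean_nonneg:
  assumes "cont f" "\<And>y. y \<in> carrier G \<Longrightarrow> 0 \<le> f y"
  shows "0 \<le> mean f"
  using mean_mono[of "\<lambda>_. 0" f] assms by simp

lemma mean_abs_le:
  assumes "cont f" "\<And>y. y \<in> carrier G \<Longrightarrow> \<bar>f y\<bar> \<le> c"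
  shows "\<bar>mean f\<bar> \<le> c"
  using mean_eqI_le[OF assms(1) left_avgs.id, of 0 c] assms(2) by simp

text \<open>Finitely many translates of the open set where \<open>f\<close> exceeds
  \<open>f x / 2\<close> cover the group, so some average of \<open>f\<close> is bounded below by a
  positive constant.\<close>

lemma mean_pos:
  assumes f: "cont f" and nn: "\<And>y. y \<in> carrier G \<Longrightarrow> 0 \<le> f y" and x: "x \<in> carrier G" "f x > 0"
  shows "0 < mean f"
proof -
  let ?U = "{h \<in> carrier G. x \<otimes> h \<in> {y \<in> topspace T. f y \<in> {f x / 2<..}}}"
  have "openin T {y \<in> topspace T. f y \<in> {f x / 2<..}}"
    by (rule openin_continuous_map_preimage[OF f]) simp
  from openin_ltranslate[OF this x(1)] have U: "nhd ?U" using x by (simp add: nhd_def)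
  obtain F where F: "finite F" "F \<noteq> {}" "F \<subseteq> carrier G" "\<And>y. y \<in> carrier G \<Longrightarrow> \<exists>g\<in>F. inv g \<otimes> y \<in> ?U"
    using finite_translates_cover[OF U] by blast
  define A where "A = (\<lambda>g. x \<otimes> inv g) ` F"
  have A: "finite A" "A \<noteq> {}" "A \<subseteq> carrier G" using F x by (auto simp: A_def)
  let ?P = "\<lambda>f y. (\<Sum>x\<in>A. f (x \<otimes> y)) / real (card A)"
  have P: "?P \<in> left_avgs" by (rule left_avgs.step[OF left_avgs.id A])
  have cA: "real (card A) > 0" using A by (simp add: card_gt_0_iff)
  have "f x / 2 / real (card A) \<le> ?P f y" if y: "y \<in> carrier G" for y
  proof -
    obtain g where g: "g \<in> F" "inv g \<otimes> y \<in> ?U" using F(4)[OF y] by blast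
    have gc: "g \<in> carrier G" using g F by blast
    have "f x / 2 \<le> f ((x \<otimes> inv g) \<otimes> y)" using g(2) gc x y by (simp add: m_assoc)
    also have "\<dots> \<le> (\<Sum>x\<in>A. f (x \<otimes> y))"
      using g A y nn by (intro member_le_sum) (auto simp: A_def)
    finally show ?thesis by (rule divide_right_mono) (use cA in simp)
  qed
  then have "mean (\<lambda>_. f x / 2 / real (card A)) \<le> mean (?P f)"
    by (intro mean_mono left_avgs_cont[OF P f]) auto
  then have "f x / 2 / real (card A) \<le> mean f" using mean_left_avg[OF f P] by simp
  moreover have "f x / 2 / real (card A) > 0" using x cA by simp
  ultimately show ?thesis by linarith
qed

section \<open>Means with a parameter and their interchange\<close>

lemma joint_cont:
  assumes "cont2 (\<lambda>(x, y). F x y)"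
  shows "x \<in> carrier G \<Longrightarrow> cont (\<lambda>y. F x y)" "y \<in> carrier G \<Longrightarrow> cont (\<lambda>x. F x y)"
proof -
  have "continuous_map T (prod_topology T T) (\<lambda>y. (x, y))" if "x \<in> carrier G"
    using that by (intro continuous_map_pairedI) auto
  from continuous_map_compose[OF this assms] show "x \<in> carrier G \<Longrightarrow> cont (\<lambda>y. F x y)"
    by (simp add: o_def)
  have "continuous_map T (prod_topology T T) (\<lambda>x. (x, y))" if "y \<in> carrier G"
    using that by (intro continuous_map_pairedI) auto
  from continuous_map_compose[OF this assms] show "y \<in> carrier G \<Longrightarrow> cont (\<lambda>x. F x y)"
    by (simp add: o_def)
qed

lemma mean_cont:
  assumes F: "cont2 (\<lambda>(x, y). F x y)"
  shows "cont (\<lambda>x. mean (F x))"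
proof (rule contI)
  fix x and e :: real assume x: "x \<in> carrier G" and "e > 0"
  then have "e / 2 > 0" by simp
  from parametric_uniform_continuity[OF F this x] obtain N where
    N: "openin T N" "x \<in> N" "\<And>x' y. x' \<in> N \<Longrightarrow> y \<in> carrier G \<Longrightarrow> \<bar>F x' y - F x y\<bar> < e / 2" by blast
  have "\<bar>mean (F x') - mean (F x)\<bar> < e" if "x' \<in> N" for x'
  proof -
    have x': "x' \<in> carrier G" using that openin_carrier[OF N(1)] by blast
    have "\<bar>mean (\<lambda>y. F x' y - F x y)\<bar> \<le> e / 2"
      using N(3)[OF that] joint_cont(1)[OF F] x x'
      by (intro mean_abs_le continuous_map_diff) (auto intro: less_imp_le)
    then show ?thesis
      using mean_diff[of "F x'" "F x"] joint_cont(1)[OF F] x x' \<open>e > 0\<close> by simp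
  qed
  then show "\<exists>N. openin T N \<and> x \<in> N \<and> (\<forall>y\<in>N. \<bar>mean (F y) - mean (F x)\<bar> < e)" using N by blast
qed

lemma mean_left_avg_swap:
  assumes "P \<in> left_avgs" and F: "cont2 (\<lambda>(x, y). F x y)"
  shows "cont2 (\<lambda>(x, y). P (\<lambda>x. F x y) x)"
    and "x \<in> carrier G \<Longrightarrow> P (\<lambda>x. mean (F x)) x = mean (\<lambda>y. P (\<lambda>x. F x y) x)"
proof -
  have "cont2 (\<lambda>(x, y). P (\<lambda>x. F x y) x) \<and>
    (\<forall>x\<in>carrier G. P (\<lambda>x. mean (F x)) x = mean (\<lambda>y. P (\<lambda>x. F x y) x))"
    using assms(1)
  proof induction
    case id
    then show ?case using F by simp
  next
    case (step P A)
    let ?H = "\<lambda>x y. P (\<lambda>x. F x y) x"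
    have H: "cont2 (\<lambda>p. ?H (fst p) (snd p))"
      using step.IH by (simp add: case_prod_unfold)
    have Ha: "cont2 (\<lambda>p. ?H (a \<otimes> fst p) (snd p))" if "a \<in> carrier G" for a
    proof -
      have "continuous_map (prod_topology T T) (prod_topology T T) (\<lambda>p. (a \<otimes> fst p, snd p))"
        using that by (intro continuous_map_pairedI continuous_map_mult continuous_map_snd continuous_map_fst) auto
      from continuous_map_compose[OF this H] show ?thesis by (simp add: o_def)
    qed
    have c: "continuous_map (prod_topology T T) euclideanreal
        (\<lambda>(x, y). (\<Sum>a\<in>A. P (\<lambda>x. F x y) (a \<otimes> x)) / real (card A))"
      unfolding case_prod_unfold
      using step Ha by (intro continuous_map_real_divide continuous_map_sum) auto
    have "(\<Sum>a\<in>A. P (\<lambda>x. mean (F x)) (a \<otimes> x)) / real (card A) =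
        mean (\<lambda>y. (\<Sum>a\<in>A. P (\<lambda>x. F x y) (a \<otimes> x)) / real (card A))" if x: "x \<in> carrier G" for x
    proof -
      have "cont (?H (a \<otimes> x))" if "a \<in> A" for a
        using joint_cont(1)[of ?H "a \<otimes> x"] step.IH that step x by blast
      then have "mean (\<lambda>y. (1 / real (card A)) * (\<Sum>a\<in>A. ?H (a \<otimes> x) y)) = (1 / real (card A)) * (\<Sum>a\<in>A. mean (?H (a \<otimes> x)))"
        using step by (subst mean_scale) (auto intro!: continuous_map_sum simp: mean_sum)
      moreover have "P (\<lambda>x. mean (F x)) (a \<otimes> x) = mean (?H (a \<otimes> x))" if "a \<in> A" for a
        using step.IH that step x by blast
      ultimately show ?thesis by simp
    qed
    then show ?case using c by blast
  qed
  then show "cont2 (\<lambda>(x, y). P (\<lambda>x. F x y) x)"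
    and "x \<in> carrier G \<Longrightarrow> P (\<lambda>x. mean (F x)) x = mean (\<lambda>y. P (\<lambda>x. F x y) x)" by blast+
qed

text \<open>On a finite net of values \<open>y\<close> the average is refined one point at a time,
  each further average preserving what has been reached. Uniform continuity in \<open>y\<close>
  extends the estimate to all \<open>y\<close>, at the cost of two more thirds of
  \<open>e\<close>.\<close>

lemma simultaneous_mean_approx:
  assumes F: "cont2 (\<lambda>(x, y). F x y)" and "e > 0"
  shows "\<exists>P\<in>left_avgs. \<forall>x\<in>carrier G. \<forall>y\<in>carrier G. \<bar>P (\<lambda>x. F x y) x - mean (\<lambda>x. F x y)\<bar> \<le> e"
proof -
  define d where "d = e / 3"
  have d: "d > 0" using assms by (simp add: d_def)
  note F' = joint_cont_swap[OF F]
  define N where "N = (\<lambda>y. SOME N. openin T N \<and> y \<in> N \<and> (\<forall>y'\<in>N. \<forall>x\<in>carrier G. \<bar>F x y' - F x y\<bar> < d))"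
  have N: "openin T (N y) \<and> y \<in> N y \<and> (\<forall>y'\<in>N y. \<forall>x\<in>carrier G. \<bar>F x y' - F x y\<bar> < d)"
    if "y \<in> carrier G" for y
    unfolding N_def by (rule someI_ex[OF parametric_uniform_continuity[OF F' d that]])
  have "\<And>C. C \<in> N ` carrier G \<Longrightarrow> openin T C" "topspace T \<subseteq> \<Union>(N ` carrier G)" using N by auto
  then obtain \<F> where "finite \<F>" "\<F> \<subseteq> N ` carrier G" "topspace T \<subseteq> \<Union>\<F>"
    using compact unfolding compact_space_alt by meson
  then obtain Y where Y: "finite Y" "Y \<subseteq> carrier G" "carrier G \<subseteq> \<Union>(N ` Y)"
    by (metis finite_subset_image topspace)
  have "\<exists>P\<in>left_avgs. \<forall>x\<in>carrier G. \<forall>y\<in>Y. \<bar>P (\<lambda>x. F x y) x - mean (\<lambda>x. F x y)\<bar> \<le> d"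
    using Y(1,2)
  proof (induction Y)
    case empty
    then show ?case using left_avgs.id by blast
  next
    case (insert y Y)
    then obtain P where P: "P \<in> left_avgs"
      "\<And>x y. x \<in> carrier G \<Longrightarrow> y \<in> Y \<Longrightarrow> \<bar>P (\<lambda>x. F x y) x - mean (\<lambda>x. F x y)\<bar> \<le> d" by auto
    have y: "y \<in> carrier G" using insert by simp
    have cy: "cont (\<lambda>x. F x y)" using joint_cont(2)[OF F y] .
    from mean_approx[OF left_avgs_cont[OF P(1) cy] d] obtain Q where
      Q: "Q \<in> left_avgs" "\<And>x. x \<in> carrier G \<Longrightarrow> \<bar>Q (P (\<lambda>x. F x y)) x - mean (P (\<lambda>x. F x y))\<bar> \<le> d" by blast
    have "\<bar>Q (P (\<lambda>x. F x y')) x - mean (\<lambda>x. F x y')\<bar> \<le> d" if "x \<in> carrier G" "y' \<in> insert y Y" for x y'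
    proof (cases "y' = y")
      case True
      then show ?thesis using Q(2)[OF that(1)] mean_left_avg[OF cy P(1)] by simp
    next
      case False
      then have "y' \<in> Y" using that(2) by simp
      then show ?thesis by (intro left_avgs_close[OF Q(1) _ that(1)] P(2))
    qed
    then show ?case using left_avgs_comp[OF Q(1) P(1)] by (intro bexI[of _ "\<lambda>f. Q (P f)"]) auto
  qed
  then obtain P where P: "P \<in> left_avgs"
    "\<And>x y. x \<in> carrier G \<Longrightarrow> y \<in> Y \<Longrightarrow> \<bar>P (\<lambda>x. F x y) x - mean (\<lambda>x. F x y)\<bar> \<le> d" by blast
  have "\<bar>P (\<lambda>x. F x y) x - mean (\<lambda>x. F x y)\<bar> \<le> e" if x: "x \<in> carrier G" and y: "y \<in> carrier G" for x y
  proof -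
    obtain y0 where y0: "y0 \<in> Y" "y \<in> N y0" using Y(3) y by blast
    then have y0c: "y0 \<in> carrier G" using Y by blast
    have close: "\<bar>(1 * F x y + (-1) * F x y0) - 0\<bar> \<le> d" if "x \<in> carrier G" for x
      using N[OF y0c] y0(2) that by (auto intro: less_imp_le)
    have c: "cont (\<lambda>x. F x y)" "cont (\<lambda>x. F x y0)" using joint_cont(2)[OF F] y y0c by auto
    have "\<bar>P (\<lambda>x. F x y) x - P (\<lambda>x. F x y0) x\<bar> \<le> d"
      using left_avgs_close[OF P(1), of "\<lambda>x. 1 * F x y + (-1) * F x y0" 0 d x] close x left_avgs_linear[OF P(1), of 1 "\<lambda>x. F x y" "-1" "\<lambda>x. F x y0" x] by simp
    moreover have "\<bar>mean (\<lambda>x. F x y) - mean (\<lambda>x. F x y0)\<bar> \<le> d"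
      using mean_abs_le[of "\<lambda>x. F x y - F x y0" d] close c by (simp add: mean_diff continuous_map_diff)
    ultimately show ?thesis using P(2)[OF x y0(1)] unfolding d_def by linarith
  qed
  then show ?thesis using P(1) by blast
qed

text \<open>The mean in \<open>x\<close> is replaced by a finite average \<open>P\<close> that
  approximates it uniformly in \<open>y\<close>; such an average does commute with the mean in
  \<open>y\<close>.\<close>

lemma mean_swap:
  assumes F: "cont2 (\<lambda>(x, y). F x y)"
  shows "mean (\<lambda>x. mean (F x)) = mean (\<lambda>y. mean (\<lambda>x. F x y))"
proof (rule mean_eqI[OF mean_cont[OF F]])
  note F' = joint_cont_swap[OF F]
  fix e :: real assume "e > 0"
  from simultaneous_mean_approx[OF F this] obtain P where P: "P \<in> left_avgs"
    "\<And>x y. x \<in> carrier G \<Longrightarrow> y \<in> carrier G \<Longrightarrow> \<bar>P (\<lambda>x. F x y) x - mean (\<lambda>x. F x y)\<bar> \<le> e" by blast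
  have "\<bar>P (\<lambda>x. mean (F x)) x - mean (\<lambda>y. mean (\<lambda>x. F x y))\<bar> \<le> e" if x: "x \<in> carrier G" for x
  proof -
    have c: "cont (\<lambda>y. P (\<lambda>x. F x y) x)" "cont (\<lambda>y. mean (\<lambda>x. F x y))"
      using joint_cont(1)[OF mean_left_avg_swap(1)[OF P(1) F] x] mean_cont[OF F'] by auto
    have "\<bar>mean (\<lambda>y. P (\<lambda>x. F x y) x - mean (\<lambda>x. F x y))\<bar> \<le> e"
      using P(2)[OF x] c by (intro mean_abs_le continuous_map_diff) auto
    then show ?thesis using mean_left_avg_swap(2)[OF P(1) F x] mean_diff[OF c] by simp
  qed
  then show "\<exists>P\<in>left_avgs. \<forall>x\<in>carrier G. \<bar>P (\<lambda>x. mean (F x)) x - mean (\<lambda>y. mean (\<lambda>x. F x y))\<bar> \<le> e"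
    using P(1) by blast
qed

end

section \<open>Eigenvectors of complex matrices\<close>

lemma trace_mult_commute:
  fixes A B :: "'a :: comm_ring_1 mat"
  assumes A: "A \<in> carrier_mat n n" and B: "B \<in> carrier_mat n n"
  shows "(\<Sum>i<n. (A * B) $$ (i, i)) = (\<Sum>i<n. (B * A) $$ (i, i))"
proof -
  have *: "(C * D) $$ (i, i) = (\<Sum>j<n. C $$ (i, j) * D $$ (j, i))"
    if "C \<in> carrier_mat n n" "D \<in> carrier_mat n n" "i < n" for C D :: "'a mat" and i
    using that by (auto simp: scalar_prod_def lessThan_atLeast0)
  have "(\<Sum>i<n. (A * B) $$ (i, i)) = (\<Sum>i<n. \<Sum>j<n. A $$ (i, j) * B $$ (j, i))"
    by (intro sum.cong refl *[OF A B]) auto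
  also have "\<dots> = (\<Sum>j<n. \<Sum>i<n. B $$ (j, i) * A $$ (i, j))"
    by (subst sum.swap) (simp add: mult.commute)
  also have "\<dots> = (\<Sum>i<n. (B * A) $$ (i, i))"
    by (intro sum.cong refl *[OF B A, symmetric]) auto
  finally show ?thesis .
qed

lemma complex_schur:
  fixes A :: "complex mat"
  assumes A: "A \<in> carrier_mat n n"
  obtains B P Q es where "B \<in> carrier_mat n n" "P \<in> carrier_mat n n" "Q \<in> carrier_mat n n"
    "P * Q = 1\<^sub>m n" "Q * P = 1\<^sub>m n" "A = P * B * Q" "upper_triangular B"
    "length es = n" "\<And>i. i < n \<Longrightarrow> B $$ (i, i) = es ! i" "\<And>e. e \<in> set es \<Longrightarrow> eigenvalue A e"
proof -
  obtain es where es: "char_poly A = (\<Prod>a\<leftarrow>es. [:- a, 1:])" "length es = n"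
    using char_poly_factorized[OF A] by blast
  obtain B P Q where BPQ: "schur_decomposition A es = (B, P, Q)" by (metis prod_cases3)
  have B: "similar_mat_wit A B P Q" "upper_triangular B" "diag_mat B = es"
    using schur_decomposition[OF A es(1) BPQ] by auto
  note sim = similar_mat_witD2[OF A B(1)]
  have "B $$ (i, i) = es ! i" if "i < n" for i
    using that sim(5) unfolding B(3)[symmetric] diag_mat_def by simp
  moreover have "eigenvalue A e" if "e \<in> set es" for e
  proof -
    have "poly (char_poly A) e = 0"
      unfolding es(1) poly_prod_list using that by (auto simp: prod_list_zero_iff)
    then show ?thesis using eigenvalue_root_char_poly[OF A] by simp
  qed
  ultimately show ?thesis using that sim B(2) es(2) by blast
qed

lemma mat_mult_vec_index:
  fixes A :: "'a :: comm_ring_1 mat"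
  assumes "A \<in> carrier_mat n n" "v \<in> carrier_vec n" "i < n"
  shows "vec_index (A *\<^sub>v v) i = (\<Sum>j<n. A $$ (i, j) * vec_index v j)"
  using assms by (auto simp: scalar_prod_def lessThan_atLeast0)

text \<open>Similarity to the triangular Schur form leaves the trace unchanged, and there it is the
  sum of the diagonal entries, which are eigenvalues. Matrices and vectors appear as plain functions
  of indices, the form in which the coefficients of translations arise later.\<close>

lemma trace_eq_sum_eigenvalues:
  fixes A :: "nat \<Rightarrow> nat \<Rightarrow> complex"
  shows "\<exists>es. (\<Sum>i<n. A i i) = sum_list es \<and>
    (\<forall>e\<in>set es. \<exists>v. (\<exists>i<n. v i \<noteq> 0) \<and> (\<forall>i<n. (\<Sum>j<n. A i j * v j) = e * v i))"
proof -
  define M where "M = mat n n (\<lambda>(i, j). A i j)"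
  have M: "M \<in> carrier_mat n n" by (simp add: M_def)
  obtain B P Q es where *: "B \<in> carrier_mat n n" "P \<in> carrier_mat n n" "Q \<in> carrier_mat n n"
    "P * Q = 1\<^sub>m n" "Q * P = 1\<^sub>m n" "M = P * B * Q"
    "length es = n" "\<And>i. i < n \<Longrightarrow> B $$ (i, i) = es ! i" "\<And>e. e \<in> set es \<Longrightarrow> eigenvalue M e"
    using complex_schur[OF M] by metis
  have "(\<Sum>i<n. A i i) = (\<Sum>i<n. (P * B * Q) $$ (i, i))"
    unfolding *(6)[symmetric] by (simp add: M_def)
  also have "\<dots> = (\<Sum>i<n. (P * (B * Q)) $$ (i, i))" using * by (simp add: assoc_mult_mat[of _ n n _ n _ n])
  also have "\<dots> = (\<Sum>i<n. (B * Q * P) $$ (i, i))" using * by (intro trace_mult_commute) auto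
  also have "B * Q * P = B" using * by (simp add: assoc_mult_mat[of _ n n _ n _ n])
  also have "(\<Sum>i<n. B $$ (i, i)) = sum_list es" using *(7,8) by (simp add: sum_list_sum_nth lessThan_atLeast0)
  finally have "(\<Sum>i<n. A i i) = sum_list es" .
  moreover have "\<exists>v. (\<exists>i<n. v i \<noteq> 0) \<and> (\<forall>i<n. (\<Sum>j<n. A i j * v j) = e * v i)" if e: "e \<in> set es" for e
  proof -
    obtain v where v: "v \<in> carrier_vec n" "v \<noteq> 0\<^sub>v n" "M *\<^sub>v v = e \<cdot>\<^sub>v v"
      using *(9)[OF e] M unfolding eigenvalue_def eigenvector_def by auto
    have "\<exists>i<n. vec_index v i \<noteq> 0"
    proof (rule ccontr)
      assume "\<not> (\<exists>i<n. vec_index v i \<noteq> 0)"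
      then have "v = 0\<^sub>v n" using v(1) by (intro eq_vecI) auto
      then show False using v(2) by simp
    qed
    moreover have "(\<Sum>j<n. A i j * vec_index v j) = e * vec_index v i" if "i < n" for i
    proof -
      have "(\<Sum>j<n. A i j * vec_index v j) = vec_index (M *\<^sub>v v) i"
        using that unfolding mat_mult_vec_index[OF M v(1) that] by (simp add: M_def)
      also have "\<dots> = e * vec_index v i" using that v by simp
      finally show ?thesis .
    qed
    ultimately show ?thesis by (intro exI[of _ "vec_index v"]) auto
  qed
  ultimately show ?thesis by blast
qed

text \<open>For an upper triangular matrix with diagonal \<open>es\<close>, applying \<open>B - es ! k\<close> to a vector
  supported on the coordinates up to \<open>k\<close> kills coordinate \<open>k\<close>. Starting from an eigenvector of
  the commuting matrix \<open>A\<close>, the last nonzero vector obtained in this way is a common eigenvector.\<close>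

lemma common_eigenvector_mat:
  fixes A B :: "complex mat"
  assumes A: "A \<in> carrier_mat n n" and B: "B \<in> carrier_mat n n" and AB: "A * B = B * A"
    and v: "v \<in> carrier_vec n" "v \<noteq> 0\<^sub>v n" "A *\<^sub>v v = e \<cdot>\<^sub>v v"
  shows "\<exists>w d. w \<in> carrier_vec n \<and> w \<noteq> 0\<^sub>v n \<and> A *\<^sub>v w = e \<cdot>\<^sub>v w \<and> B *\<^sub>v w = d \<cdot>\<^sub>v w"
proof -
  obtain U P Q es where *: "U \<in> carrier_mat n n" "P \<in> carrier_mat n n" "Q \<in> carrier_mat n n"
    "P * Q = 1\<^sub>m n" "Q * P = 1\<^sub>m n" "B = P * U * Q" and ut: "upper_triangular U"
    using complex_schur[OF B] by metis
  have QB: "Q * B = U * Q"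
  proof -
    have "Q * B = Q * (P * (U * Q))" unfolding *(6) using * by (simp add: assoc_mult_mat[of _ n n _ n _ n])
    also have "\<dots> = (Q * P) * (U * Q)" using * by (intro assoc_mult_mat[symmetric]) auto
    finally show ?thesis using * by simp
  qed
  have "\<exists>w d. w \<in> carrier_vec n \<and> w \<noteq> 0\<^sub>v n \<and> A *\<^sub>v w = e \<cdot>\<^sub>v w \<and> B *\<^sub>v w = d \<cdot>\<^sub>v w"
    if "k \<le> n" "v \<in> carrier_vec n" "v \<noteq> 0\<^sub>v n" "A *\<^sub>v v = e \<cdot>\<^sub>v v"
      "\<And>i. k \<le> i \<Longrightarrow> i < n \<Longrightarrow> vec_index (Q *\<^sub>v v) i = 0" for k v
    using that
  proof (induction k arbitrary: v)
    case 0
    have "Q *\<^sub>v v = 0\<^sub>v n" using 0 * by (intro eq_vecI) auto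
    moreover have "P *\<^sub>v 0\<^sub>v n = 0\<^sub>v n" using *(2) by (intro eq_vecI) (auto simp: scalar_prod_def)
    ultimately have "P *\<^sub>v (Q *\<^sub>v v) = 0\<^sub>v n" by simp
    moreover have "P *\<^sub>v (Q *\<^sub>v v) = (P * Q) *\<^sub>v v" using * 0 by (intro assoc_mult_mat_vec[symmetric]) auto
    ultimately show ?case using 0 * by simp
  next
    case (Suc k)
    define d where "d = U $$ (k, k)"
    define u where "u = B *\<^sub>v v + (- d) \<cdot>\<^sub>v v"
    have u: "u \<in> carrier_vec n" using Suc.prems B by (simp add: u_def)
    show ?case
    proof (cases "u = 0\<^sub>v n")
      case True
      have "B *\<^sub>v v = d \<cdot>\<^sub>v v"
      proof (rule eq_vecI)
        fix i assume "i < dim_vec (d \<cdot>\<^sub>v v)"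
        then have i: "i < n" using Suc.prems by simp
        then have "vec_index u i = vec_index (B *\<^sub>v v) i + (- d) * vec_index v i"
          using Suc.prems B unfolding u_def by simp
        then show "vec_index (B *\<^sub>v v) i = vec_index (d \<cdot>\<^sub>v v) i" using True i Suc.prems by simp
      qed (use Suc.prems B in auto)
      then show ?thesis using Suc.prems by blast
    next
      case False
      have "A *\<^sub>v (B *\<^sub>v v) = B *\<^sub>v (A *\<^sub>v v)"
        using A B AB Suc.prems(2) by (metis assoc_mult_mat_vec)
      also have "\<dots> = e \<cdot>\<^sub>v (B *\<^sub>v v)" using Suc.prems B by (simp add: mult_mat_vec)
      finally have "A *\<^sub>v (B *\<^sub>v v) = e \<cdot>\<^sub>v (B *\<^sub>v v)" .
      moreover have "A *\<^sub>v u = A *\<^sub>v (B *\<^sub>v v) + A *\<^sub>v ((- d) \<cdot>\<^sub>v v)"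
        unfolding u_def using A B Suc.prems(2) by (intro mult_add_distrib_mat_vec) auto
      moreover have "A *\<^sub>v ((- d) \<cdot>\<^sub>v v) = e \<cdot>\<^sub>v ((- d) \<cdot>\<^sub>v v)"
        using A Suc.prems by (simp add: mult_mat_vec[of A n n v] smult_smult_assoc mult.commute)
      moreover have "e \<cdot>\<^sub>v u = e \<cdot>\<^sub>v (B *\<^sub>v v) + e \<cdot>\<^sub>v ((- d) \<cdot>\<^sub>v v)"
        unfolding u_def using B Suc.prems(2) by (intro smult_add_distrib_vec[of _ n]) auto
      ultimately have Au: "A *\<^sub>v u = e \<cdot>\<^sub>v u" by simp
      have Qv: "Q *\<^sub>v v \<in> carrier_vec n" using * Suc.prems by simp
      have "Q *\<^sub>v u = Q *\<^sub>v (B *\<^sub>v v) + Q *\<^sub>v ((- d) \<cdot>\<^sub>v v)"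
        unfolding u_def using *(3) B Suc.prems(2) by (intro mult_add_distrib_mat_vec) auto
      also have "Q *\<^sub>v (B *\<^sub>v v) = U *\<^sub>v (Q *\<^sub>v v)"
        using * QB B Suc.prems(2) by (metis assoc_mult_mat_vec)
      also have "Q *\<^sub>v ((- d) \<cdot>\<^sub>v v) = (- d) \<cdot>\<^sub>v (Q *\<^sub>v v)"
        using * Suc.prems(2) by (simp add: mult_mat_vec[of Q n n v])
      finally have Qu: "Q *\<^sub>v u = U *\<^sub>v (Q *\<^sub>v v) + (- d) \<cdot>\<^sub>v (Q *\<^sub>v v)" .
      \<comment> \<open>In a row \<open>i \<ge> k\<close> of the triangular \<open>U\<close>,
        columns beyond \<open>k\<close> meet vanishing coordinates and columns before
        \<open>i\<close> meet zero entries, so only column \<open>k\<close> can contribute; for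
        \<open>i = k\<close> its contribution cancels against \<open>- d\<close>.\<close>
      have "vec_index (Q *\<^sub>v u) i = 0" if i: "k \<le> i" "i < n" for i
      proof -
        let ?w = "Q *\<^sub>v v"
        have "vec_index (U *\<^sub>v ?w) i = (\<Sum>j<n. U $$ (i, j) * vec_index ?w j)"
          by (rule mat_mult_vec_index[OF *(1) Qv i(2)])
        also have "\<dots> = (\<Sum>j<n. if j = k then U $$ (i, j) * vec_index ?w j else 0)"
        proof (rule sum.cong[OF refl])
          fix j assume j: "j \<in> {..<n}"
          show "U $$ (i, j) * vec_index ?w j = (if j = k then U $$ (i, j) * vec_index ?w j else 0)"
          proof (cases "Suc k \<le> j")
            case True
            then show ?thesis using Suc.prems(5)[of j] j by simp
          next
            case False
            then have "j = k \<or> j < i" using i by linarith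
            then have "j = k \<or> U $$ (i, j) = 0" using ut i *(1) by (auto simp: upper_triangular_def)
            then show ?thesis by auto
          qed
        qed
        also have "\<dots> = U $$ (i, k) * vec_index ?w k" using i by simp
        also have "\<dots> = d * vec_index ?w i"
        proof (cases "i = k")
          case False
          then have "U $$ (i, k) = 0" using ut i *(1) by (auto simp: upper_triangular_def)
          moreover have "vec_index ?w i = 0" using Suc.prems(5)[of i] i False by simp
          ultimately show ?thesis by simp
        qed (simp add: d_def)
        finally have "vec_index (U *\<^sub>v ?w) i = d * vec_index ?w i" .
        moreover have "vec_index (Q *\<^sub>v u) i = vec_index (U *\<^sub>v ?w) i + (- d) * vec_index ?w i"
          unfolding Qu using i Qv *(1,3) by simp
        ultimately show ?thesis by simp
      qed
      then show ?thesis using Suc.IH[of u] Suc.prems(1) u False Au by simp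
    qed
  qed
  from this[of n v] v show ?thesis by simp
qed

lemma common_eigenvector:
  fixes A B :: "nat \<Rightarrow> nat \<Rightarrow> complex"
  assumes comm: "\<And>i j. i < n \<Longrightarrow> j < n \<Longrightarrow> (\<Sum>k<n. A i k * B k j) = (\<Sum>k<n. B i k * A k j)"
    and v: "\<exists>i<n. v i \<noteq> 0" "\<And>i. i < n \<Longrightarrow> (\<Sum>j<n. A i j * v j) = e * v i"
  shows "\<exists>w d. (\<exists>i<n. w i \<noteq> 0) \<and> (\<forall>i<n. (\<Sum>j<n. A i j * w j) = e * w i) \<and>
    (\<forall>i<n. (\<Sum>j<n. B i j * w j) = d * w i)"
proof -
  define M N where "M = mat n n (\<lambda>(i, j). A i j)" and "N = mat n n (\<lambda>(i, j). B i j)"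
  have M: "M \<in> carrier_mat n n" and N: "N \<in> carrier_mat n n" by (simp_all add: M_def N_def)
  have MN: "M * N = N * M"
    using comm by (intro eq_matI) (auto simp: M_def N_def scalar_prod_def lessThan_atLeast0)
  have V: "vec n v \<in> carrier_vec n" by simp
  obtain i where i: "i < n" "v i \<noteq> 0" using v(1) by blast
  have "vec n v \<noteq> 0\<^sub>v n"
  proof
    assume "vec n v = 0\<^sub>v n"
    then have "vec_index (vec n v) i = vec_index (0\<^sub>v n) i" by simp
    then show False using i by simp
  qed
  moreover have "M *\<^sub>v vec n v = e \<cdot>\<^sub>v vec n v"
  proof (rule eq_vecI)
    fix i assume "i < dim_vec (e \<cdot>\<^sub>v vec n v)"
    then have i: "i < n" by simp
    have "(\<Sum>j<n. M $$ (i, j) * vec_index (vec n v) j) = e * v i"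
      using v(2)[OF i] i by (simp add: M_def)
    then show "vec_index (M *\<^sub>v vec n v) i = vec_index (e \<cdot>\<^sub>v vec n v) i"
      using mat_mult_vec_index[OF M V i] i by simp
  qed (use M in simp)
  ultimately obtain w d where w: "w \<in> carrier_vec n" "w \<noteq> 0\<^sub>v n" "M *\<^sub>v w = e \<cdot>\<^sub>v w" "N *\<^sub>v w = d \<cdot>\<^sub>v w"
    using common_eigenvector_mat[OF M N MN V] by blast
  have "\<exists>i<n. vec_index w i \<noteq> 0"
  proof (rule ccontr)
    assume "\<not> (\<exists>i<n. vec_index w i \<noteq> 0)"
    then have "w = 0\<^sub>v n" using w(1) by (intro eq_vecI) auto
    then show False using w(2) by simp
  qed
  moreover have "(\<Sum>j<n. A i j * vec_index w j) = e * vec_index w i"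
    "(\<Sum>j<n. B i j * vec_index w j) = d * vec_index w i" if i: "i < n" for i
  proof -
    have "(\<Sum>j<n. M $$ (i, j) * vec_index w j) = e * vec_index w i"
      "(\<Sum>j<n. N $$ (i, j) * vec_index w j) = d * vec_index w i"
      using mat_mult_vec_index[OF M w(1) i] mat_mult_vec_index[OF N w(1) i] w(1,3,4) i by simp_all
    then show "(\<Sum>j<n. A i j * vec_index w j) = e * vec_index w i"
      "(\<Sum>j<n. B i j * vec_index w j) = d * vec_index w i" using i by (simp_all add: M_def N_def)
  qed
  ultimately show ?thesis by blast
qed

section \<open>Convolution operators and their eigenfunctions\<close>

context compact_topological_group
begin

lemma cont_mult: "cont f \<Longrightarrow> cont g \<Longrightarrow> cont (\<lambda>x. f x * g x)"
  by (rule continuous_map_real_mult)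

lemma cont_if_uniformly_continuous:
  assumes "\<And>e. e > 0 \<Longrightarrow> \<exists>U. nhd U \<and> (\<forall>x\<in>carrier G. \<forall>h\<in>U. \<bar>f (x \<otimes> h) - f x\<bar> \<le> e)"
  shows "cont f"
proof (rule contI)
  fix x and e :: real assume x: "x \<in> carrier G" and e: "e > 0"
  obtain U where U: "nhd U" "\<And>x h. x \<in> carrier G \<Longrightarrow> h \<in> U \<Longrightarrow> \<bar>f (x \<otimes> h) - f x\<bar> \<le> e / 2"
    using assms[of "e / 2"] e by auto
  let ?N = "{y \<in> carrier G. inv x \<otimes> y \<in> U}"
  have "openin T ?N" using openin_ltranslate[of U "inv x"] U(1) x by (simp add: nhd_def)
  moreover have "x \<in> ?N" using x U(1) by (simp add: nhd_def)
  moreover have "\<bar>f y - f x\<bar> < e" if "y \<in> ?N" for y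
    using U(2)[OF x, of "inv x \<otimes> y"] that x e by auto
  ultimately show "\<exists>N. openin T N \<and> x \<in> N \<and> (\<forall>y\<in>N. \<bar>f y - f x\<bar> < e)" by blast
qed

lemma mean_tendsto:
  assumes f: "\<And>n. cont (f n)" and g: "cont g"
    and lim: "\<And>e. e > 0 \<Longrightarrow> \<exists>N. \<forall>n\<ge>N. \<forall>x\<in>carrier G. \<bar>f n x - g x\<bar> \<le> e"
  shows "(\<lambda>n. mean (f n)) \<longlonglongrightarrow> mean g"
proof (rule LIMSEQ_I)
  fix e :: real assume "0 < e"
  then have "e / 2 > 0" by simp
  then obtain N where N: "\<And>n x. n \<ge> N \<Longrightarrow> x \<in> carrier G \<Longrightarrow> \<bar>f n x - g x\<bar> \<le> e / 2" using lim by blast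
  have "norm (mean (f n) - mean g) < e" if "n \<ge> N" for n
  proof -
    have "\<bar>mean (\<lambda>x. f n x - g x)\<bar> \<le> e / 2"
      using N[OF that] f g by (intro mean_abs_le continuous_map_diff) auto
    then show ?thesis using mean_diff[OF f g, of n] \<open>0 < e\<close> by simp
  qed
  then show "\<exists>N. \<forall>n\<ge>N. norm (mean (f n) - mean g) < e" by blast
qed

text \<open>Arzela-Ascoli for a group that need not be separable: equicontinuity provides finite
  sets \<open>F m\<close> that determine every \<open>w n\<close> up to \<open>1 / (m + 1)\<close>,
  and a subsequence that converges on their countable union converges uniformly.\<close>

lemma equicontinuous_subsequence:
  fixes w :: "nat \<Rightarrow> 'a \<Rightarrow> real"
  assumes eq: "\<And>e. e > 0 \<Longrightarrow> \<exists>U. nhd U \<and> (\<forall>n. \<forall>x\<in>carrier G. \<forall>h\<in>U. \<bar>w n (x \<otimes> h) - w n x\<bar> \<le> e)"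
    and bd: "\<And>n x. x \<in> carrier G \<Longrightarrow> \<bar>w n x\<bar> \<le> B"
  shows "\<exists>(r :: nat \<Rightarrow> nat) W. strict_mono r \<and> cont W \<and>
    (\<forall>e>0. \<exists>N. \<forall>n\<ge>N. \<forall>x\<in>carrier G. \<bar>w (r n) x - W x\<bar> \<le> e)"
proof -
  have "\<exists>F. finite F \<and> F \<subseteq> carrier G \<and>
      (\<forall>y\<in>carrier G. \<exists>g\<in>F. \<forall>n. \<bar>w n y - w n g\<bar> \<le> 1 / real (Suc m))" for m
  proof -
    obtain U where U: "nhd U" "\<And>n x h. x \<in> carrier G \<Longrightarrow> h \<in> U \<Longrightarrow> \<bar>w n (x \<otimes> h) - w n x\<bar> \<le> 1 / real (Suc m)"
      using eq[of "1 / real (Suc m)"] by auto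
    obtain F where F: "finite F" "F \<subseteq> carrier G" "\<And>y. y \<in> carrier G \<Longrightarrow> \<exists>g\<in>F. inv g \<otimes> y \<in> U"
      using finite_translates_cover[OF U(1)] by blast
    have "\<exists>g\<in>F. \<forall>n. \<bar>w n y - w n g\<bar> \<le> 1 / real (Suc m)" if y: "y \<in> carrier G" for y
    proof -
      obtain g where g: "g \<in> F" "inv g \<otimes> y \<in> U" using F(3)[OF y] by blast
      then have gc: "g \<in> carrier G" using F by blast
      have "\<bar>w n y - w n g\<bar> \<le> 1 / real (Suc m)" for n
        using U(2)[OF gc g(2), of n] gc y by simp
      then show ?thesis using g(1) by blast
    qed
    then show ?thesis using F by blast
  qed
  then obtain F where F: "\<And>m. finite (F m)" "\<And>m. F m \<subseteq> carrier G"
    "\<And>m y. y \<in> carrier G \<Longrightarrow> \<exists>g\<in>F m. \<forall>n. \<bar>w n y - w n g\<bar> \<le> 1 / real (Suc m)"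
    by metis
  have "countable (\<Union>m. F m)" using F(1) by (intro countable_UN) (auto intro: countable_finite)
  moreover have "norm (w n x) \<le> B" if "x \<in> (\<Union>m. F m)" for n x
    using that F(2) bd by auto
  ultimately obtain r where r: "strict_mono r" "\<And>x. x \<in> (\<Union>m. F m) \<Longrightarrow> \<exists>l. (\<lambda>n. w (r n) x) \<longlonglongrightarrow> l"
    using function_convergent_subsequence[of "\<Union>m. F m" w B] by metis
  have Cau: "\<exists>N. \<forall>i\<ge>N. \<forall>j\<ge>N. \<forall>x\<in>carrier G. \<bar>w (r i) x - w (r j) x\<bar> \<le> e" if "e > 0" for e
  proof -
    obtain m where m: "1 / real (Suc m) < e / 3" using \<open>e > 0\<close> nat_approx_posE[of "e / 3"] by auto
    have "\<exists>N. \<forall>i\<ge>N. \<forall>j\<ge>N. \<bar>w (r i) g - w (r j) g\<bar> < e / 3" if g: "g \<in> F m" for g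
    proof -
      have "Cauchy (\<lambda>n. w (r n) g)" using r(2)[of g] g convergent_Cauchy convergent_def by blast
      then show ?thesis using \<open>e > 0\<close> unfolding Cauchy_def dist_real_def by (meson divide_pos_pos zero_less_numeral)
    qed
    then obtain N where N: "\<And>g i j. g \<in> F m \<Longrightarrow> i \<ge> N g \<Longrightarrow> j \<ge> N g \<Longrightarrow> \<bar>w (r i) g - w (r j) g\<bar> < e / 3" by metis
    define M where "M = Max (insert 0 (N ` F m))"
    have M: "N g \<le> M" if "g \<in> F m" for g using that F(1)[of m] by (simp add: M_def)
    have "\<bar>w (r i) x - w (r j) x\<bar> \<le> e" if ij: "i \<ge> M" "j \<ge> M" and x: "x \<in> carrier G" for i j x
    proof -
      obtain g where g: "g \<in> F m" "\<And>n. \<bar>w n x - w n g\<bar> \<le> 1 / real (Suc m)" using F(3)[OF x] by blast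
      have "\<bar>w (r i) g - w (r j) g\<bar> < e / 3" using N[OF g(1), of i j] M[OF g(1)] ij by linarith
      then show ?thesis using g(2)[of "r i"] g(2)[of "r j"] m by linarith
    qed
    then show ?thesis by blast
  qed
  have conv: "\<exists>l. (\<lambda>n. w (r n) x) \<longlonglongrightarrow> l" if x: "x \<in> carrier G" for x
  proof -
    have "Cauchy (\<lambda>n. w (r n) x)"
      unfolding Cauchy_def dist_real_def
    proof (intro allI impI)
      fix e :: real assume "e > 0"
      then obtain N where "\<And>i j. i \<ge> N \<Longrightarrow> j \<ge> N \<Longrightarrow> \<bar>w (r i) x - w (r j) x\<bar> \<le> e / 2"
        using Cau[of "e / 2"] x by auto
      then show "\<exists>M. \<forall>m\<ge>M. \<forall>n\<ge>M. \<bar>w (r m) x - w (r n) x\<bar> < e"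
        using \<open>e > 0\<close> by (intro exI[of _ N]) fastforce
    qed
    then show ?thesis using Cauchy_convergent convergent_def by blast
  qed
  define W where "W = (\<lambda>x. lim (\<lambda>n. w (r n) x))"
  have W: "(\<lambda>n. w (r n) x) \<longlonglongrightarrow> W x" if "x \<in> carrier G" for x
    using conv[OF that] unfolding W_def by (metis limI)
  have unif: "\<exists>N. \<forall>n\<ge>N. \<forall>x\<in>carrier G. \<bar>w (r n) x - W x\<bar> \<le> e" if "e > 0" for e
  proof -
    obtain N where N: "\<And>i j x. i \<ge> N \<Longrightarrow> j \<ge> N \<Longrightarrow> x \<in> carrier G \<Longrightarrow> \<bar>w (r i) x - w (r j) x\<bar> \<le> e"
      using Cau[OF \<open>e > 0\<close>] by blast
    have "\<bar>w (r n) x - W x\<bar> \<le> e" if "n \<ge> N" "x \<in> carrier G" for n x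
    proof (rule LIMSEQ_le_const2)
      show "(\<lambda>j. \<bar>w (r n) x - w (r j) x\<bar>) \<longlonglongrightarrow> \<bar>w (r n) x - W x\<bar>"
        by (intro tendsto_intros W that)
      show "\<exists>M. \<forall>j\<ge>M. \<bar>w (r n) x - w (r j) x\<bar> \<le> e" using N that by blast
    qed
    then show ?thesis by blast
  qed
  have "cont W"
  proof (rule cont_if_uniformly_continuous)
    fix e :: real assume "e > 0"
    from eq[OF this] obtain U where U: "nhd U"
      "\<And>n x h. x \<in> carrier G \<Longrightarrow> h \<in> U \<Longrightarrow> \<bar>w n (x \<otimes> h) - w n x\<bar> \<le> e" by blast
    have "\<bar>W (x \<otimes> h) - W x\<bar> \<le> e" if x: "x \<in> carrier G" and h: "h \<in> U" for x h
    proof (rule LIMSEQ_le_const2)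
      have hc: "h \<in> carrier G" using h nhd_carrier[OF U(1)] by blast
      show "(\<lambda>j. \<bar>w (r j) (x \<otimes> h) - w (r j) x\<bar>) \<longlonglongrightarrow> \<bar>W (x \<otimes> h) - W x\<bar>"
        using x hc by (intro tendsto_intros W) auto
      show "\<exists>M. \<forall>j\<ge>M. \<bar>w (r j) (x \<otimes> h) - w (r j) x\<bar> \<le> e" using U(2)[OF x h] by blast
    qed
    then show "\<exists>U. nhd U \<and> (\<forall>x\<in>carrier G. \<forall>h\<in>U. \<bar>W (x \<otimes> h) - W x\<bar> \<le> e)" using U(1) by blast
  qed
  then show ?thesis using r(1) unif by blast
qed

section \<open>The inner product given by the mean\<close>

definition ip :: "('a \<Rightarrow> real) \<Rightarrow> ('a \<Rightarrow> real) \<Rightarrow> real" where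
  "ip f g = mean (\<lambda>x. f x * g x)"

lemma ip_commute: "ip f g = ip g f"
  by (simp add: ip_def mult.commute)

lemma ip_cong:
  "(\<And>x. x \<in> carrier G \<Longrightarrow> f x = f' x) \<Longrightarrow> (\<And>x. x \<in> carrier G \<Longrightarrow> g x = g' x) \<Longrightarrow> ip f g = ip f' g'"
  unfolding ip_def by (rule mean_cong) simp

lemma ip_scale: "cont f \<Longrightarrow> cont g \<Longrightarrow> ip (\<lambda>x. c * f x) g = c * ip f g"
  using mean_scale[OF cont_mult, of f g c] by (simp add: ip_def mult.assoc)

lemma ip_diff: "cont f \<Longrightarrow> cont g \<Longrightarrow> cont h \<Longrightarrow> ip (\<lambda>x. f x - g x) h = ip f h - ip g h"
  using mean_diff[OF cont_mult cont_mult, of f h g h] by (simp add: ip_def left_diff_distrib)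

lemma ip_sum:
  "finite I \<Longrightarrow> (\<And>i. i \<in> I \<Longrightarrow> cont (f i)) \<Longrightarrow> cont h \<Longrightarrow> ip (\<lambda>x. \<Sum>i\<in>I. f i x) h = (\<Sum>i\<in>I. ip (f i) h)"
  using mean_sum[of I "\<lambda>i x. f i x * h x"] by (simp add: ip_def sum_distrib_right cont_mult)

lemma ip_nonneg: "cont f \<Longrightarrow> 0 \<le> ip f f"
  unfolding ip_def by (intro mean_nonneg cont_mult) auto

lemma ip_eq_0:
  assumes "cont f" "ip f f = 0" "x \<in> carrier G"
  shows "f x = 0"
proof (rule ccontr)
  assume "f x \<noteq> 0"
  then have "0 < f x * f x" using not_real_square_gt_zero[of "f x"] by blast
  then have "0 < mean (\<lambda>x. f x * f x)"
    using assms by (intro mean_pos[where x = x] cont_mult) auto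
  then show False using assms(2) by (simp add: ip_def)
qed

lemma ip_Cauchy_Schwarz:
  assumes f: "cont f" and g: "cont g"
  shows "(ip f g)\<^sup>2 \<le> ip f f * ip g g"
proof (cases "ip g g = 0")
  case True
  have "ip f g = ip f (\<lambda>_. 0)" by (rule ip_cong) (use ip_eq_0[OF g True] in auto)
  then show ?thesis using True by (simp add: ip_def)
next
  case False
  then have pos: "ip g g > 0" using ip_nonneg[OF g] by simp
  \<comment> \<open>This \<open>t\<close> minimizes the norm of \<open>f - t g\<close>.\<close>
  define t where "t = ip f g / ip g g"
  have tg: "cont (\<lambda>x. t * g x)" using g by (intro continuous_map_real_mult) auto
  have h: "cont (\<lambda>x. f x - t * g x)" using f tg by (intro continuous_map_diff)
  have "ip (\<lambda>x. f x - t * g x) (\<lambda>x. f x - t * g x) = ip f (\<lambda>x. f x - t * g x) - t * ip g (\<lambda>x. f x - t * g x)"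
    by (simp add: ip_diff[OF f tg h] ip_scale[OF g h])
  also have "ip f (\<lambda>x. f x - t * g x) = ip f f - t * ip f g"
    using ip_diff[OF f tg f] ip_scale[OF g f]
    by (simp only: ip_commute[of f "\<lambda>x. f x - t * g x"] ip_commute[of f g])
  also have "ip g (\<lambda>x. f x - t * g x) = ip f g - t * ip g g"
    using ip_diff[OF f tg g] ip_scale[OF g g]
    by (simp only: ip_commute[of g "\<lambda>x. f x - t * g x"])
  finally have "0 \<le> ip f f - t * ip f g - t * (ip f g - t * ip g g)" using ip_nonneg[OF h] by simp
  also have "t * ip g g = ip f g" using pos by (simp add: t_def)
  finally have "t * ip f g \<le> ip f f" by simp
  then show ?thesis using pos by (simp add: t_def power2_eq_square pos_divide_le_eq)
qed

lemma ip_ltranslate: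
  assumes "cont f" "cont g" "a \<in> carrier G"
  shows "ip (\<lambda>x. f (a \<otimes> x)) (\<lambda>x. g (a \<otimes> x)) = ip f g"
  unfolding ip_def using mean_ltranslate[OF cont_mult[OF assms(1,2)] assms(3)] .

end

text \<open>Symmetry of the kernel makes the operator \<open>conv\<close> self-adjoint. Its
  dependence on \<open>inv x \<otimes> y\<close> alone makes it commute with left translations, so
  that its eigenspaces are translation invariant.\<close>

locale convolution_kernel = compact_topological_group +
  fixes k :: "'a \<Rightarrow> real"
  assumes k_cont: "cont k" and k_sym: "x \<in> carrier G \<Longrightarrow> k (inv x) = k x"
begin

definition conv :: "('a \<Rightarrow> real) \<Rightarrow> 'a \<Rightarrow> real" where
  "conv f x = ip (\<lambda>y. k (inv x \<otimes> y)) f"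

lemma kernel_cont: "x \<in> carrier G \<Longrightarrow> cont (\<lambda>y. k (inv x \<otimes> y))"
  using cont_ltranslate[OF k_cont] by simp

lemma kernel_joint:
  assumes f: "cont f"
  shows "cont2 (\<lambda>(x, y). k (inv x \<otimes> y) * f y)"
proof -
  have "continuous_map (prod_topology T T) T (\<lambda>p. inv (fst p) \<otimes> snd p)"
    by (intro continuous_map_mult continuous_map_inv continuous_map_fst continuous_map_snd)
  from continuous_map_compose[OF this k_cont] continuous_map_compose[OF continuous_map_snd f, of T]
  show ?thesis by (simp add: o_def case_prod_unfold continuous_map_real_mult)
qed

lemma conv_cont: "cont f \<Longrightarrow> cont (conv f)"
  using mean_cont[OF kernel_joint, of f] by (simp add: conv_def[abs_def] ip_def)

lemma conv_cong: "(\<And>x. x \<in> carrier G \<Longrightarrow> f x = g x) \<Longrightarrow> conv f x = conv g x"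
  unfolding conv_def by (rule ip_cong) auto

lemma conv_diff:
  "cont f \<Longrightarrow> cont g \<Longrightarrow> x \<in> carrier G \<Longrightarrow> conv (\<lambda>y. f y - g y) x = conv f x - conv g x"
  using ip_diff[of f g "\<lambda>y. k (inv x \<otimes> y)"] by (simp add: conv_def kernel_cont ip_commute[of "\<lambda>y. k (inv x \<otimes> y)"])

lemma conv_scale:
  "cont f \<Longrightarrow> x \<in> carrier G \<Longrightarrow> conv (\<lambda>y. c * f y) x = c * conv f x"
  using ip_scale[of f "\<lambda>y. k (inv x \<otimes> y)" c] by (simp add: conv_def kernel_cont ip_commute[of "\<lambda>y. k (inv x \<otimes> y)"])

lemma conv_symmetric:
  assumes f: "cont f" and g: "cont g"
  shows "ip (conv f) g = ip f (conv g)"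
proof -
  let ?F = "\<lambda>x y. (k (inv x \<otimes> y) * f y) * g x"
  have "cont2 (\<lambda>(x, y). ?F x y)"
    using kernel_joint[OF f] continuous_map_compose[OF continuous_map_fst g, of T]
    by (simp add: o_def case_prod_unfold continuous_map_real_mult)
  note swap = mean_swap[OF this]
  have "ip (conv f) g = mean (\<lambda>x. mean (?F x))"
    unfolding ip_def
  proof (rule mean_cong)
    fix x assume x: "x \<in> carrier G"
    show "conv f x * g x = mean (?F x)"
      using mean_scale[of "\<lambda>y. k (inv x \<otimes> y) * f y" "g x"] cont_mult[OF kernel_cont[OF x] f]
      by (simp add: conv_def ip_def mult.commute)
  qed
  also have "\<dots> = mean (\<lambda>y. mean (\<lambda>x. ?F x y))" by (rule swap)
  also have "\<dots> = ip f (conv g)"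
    unfolding ip_def
  proof (rule mean_cong)
    fix y assume y: "y \<in> carrier G"
    have "k (inv x \<otimes> y) = k (inv y \<otimes> x)" if "x \<in> carrier G" for x
      using k_sym[of "inv x \<otimes> y"] that y by (simp add: inv_mult_group)
    then have "mean (\<lambda>x. ?F x y) = mean (\<lambda>x. f y * (k (inv y \<otimes> x) * g x))"
      by (intro mean_cong) simp
    also have "\<dots> = f y * mean (\<lambda>x. k (inv y \<otimes> x) * g x)"
      by (rule mean_scale[OF cont_mult[OF kernel_cont[OF y] g]])
    finally show "mean (\<lambda>x. ?F x y) = f y * conv g y" by (simp add: conv_def ip_def)
  qed
  finally show ?thesis .
qed

lemma conv_ltranslate:
  assumes f: "cont f" and a: "a \<in> carrier G" and x: "x \<in> carrier G"
  shows "conv (\<lambda>y. f (a \<otimes> y)) x = conv f (a \<otimes> x)"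
proof -
  have "conv (\<lambda>y. f (a \<otimes> y)) x = ip (\<lambda>y. k (inv (a \<otimes> x) \<otimes> (a \<otimes> y))) (\<lambda>y. f (a \<otimes> y))"
    unfolding conv_def using a x by (intro ip_cong) (simp_all add: inv_mult_group m_assoc)
  also have "\<dots> = conv f (a \<otimes> x)"
    unfolding conv_def using a x by (intro ip_ltranslate kernel_cont f) auto
  finally show ?thesis .
qed

text \<open>The squared norm of the kernel. By invariance of the mean all rows
  \<open>k (inv x \<otimes> _)\<close> have the same norm, so Cauchy-Schwarz bounds
  \<open>conv f\<close> uniformly by the norm of \<open>f\<close>.\<close>

definition bound :: real where "bound = ip k k"

lemma bound_nonneg: "0 \<le> bound"
  by (simp add: bound_def ip_nonneg k_cont)

lemma ip_kernel: "x \<in> carrier G \<Longrightarrow> ip (\<lambda>y. k (inv x \<otimes> y)) (\<lambda>y. k (inv x \<otimes> y)) = bound"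
  unfolding bound_def by (intro ip_ltranslate k_cont) simp

lemma conv_bound:
  assumes "cont f" "x \<in> carrier G"
  shows "(conv f x)\<^sup>2 \<le> bound * ip f f"
  using ip_Cauchy_Schwarz[OF kernel_cont assms(1), OF assms(2)] ip_kernel[OF assms(2)]
  by (simp add: conv_def)

lemma ip_conv_le:
  assumes f: "cont f"
  shows "ip (conv f) (conv f) \<le> bound * ip f f"
proof -
  have "ip (conv f) (conv f) \<le> mean (\<lambda>_. bound * ip f f)"
    unfolding ip_def[of "conv f"]
    using conv_bound[OF f] conv_cont[OF f] by (intro mean_mono cont_mult) (auto simp: power2_eq_square)
  then show ?thesis by simp
qed

text \<open>Two neighbouring rows of the kernel are uniformly close, and Cauchy-Schwarz tests their
  difference against \<open>f\<close>. This is the compactness of the operator: the unit ball for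
  \<open>ip\<close> becomes an equicontinuous family.\<close>

lemma conv_equicontinuous:
  assumes "e > 0"
  shows "\<exists>U. nhd U \<and> (\<forall>f x h. cont f \<and> ip f f \<le> 1 \<and> x \<in> carrier G \<and> h \<in> U \<longrightarrow>
    \<bar>conv f (x \<otimes> h) - conv f x\<bar> \<le> e)"
proof -
  obtain U where U: "nhd U" "\<And>u h. u \<in> carrier G \<Longrightarrow> h \<in> U \<Longrightarrow> \<bar>k (u \<otimes> h) - k u\<bar> < e"
    using uniformly_continuous[OF k_cont assms] by blast
  have "\<bar>conv f (x \<otimes> h) - conv f x\<bar> \<le> e"
    if f: "cont f" "ip f f \<le> 1" and x: "x \<in> carrier G" and h: "h \<in> U" for f x h
  proof -
    have hc: "h \<in> carrier G" using h nhd_carrier[OF U(1)] by blast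
    define d where "d = (\<lambda>y. k (inv (x \<otimes> h) \<otimes> y) - k (inv x \<otimes> y))"
    have dc: "cont d" unfolding d_def using x hc by (intro continuous_map_diff kernel_cont) auto
    have "\<bar>d y\<bar> \<le> e" if y: "y \<in> carrier G" for y
    proof -
      \<comment> \<open>Symmetry of the kernel moves \<open>h\<close> to the right end of the
        argument, where the uniform continuity of \<open>k\<close> applies.\<close>
      have "k (inv (x \<otimes> h) \<otimes> y) = k ((inv y \<otimes> x) \<otimes> h)"
        using k_sym[of "inv (x \<otimes> h) \<otimes> y"] x hc y by (simp add: inv_mult_group m_assoc)
      moreover have "k (inv x \<otimes> y) = k (inv y \<otimes> x)"
        using k_sym[of "inv x \<otimes> y"] x y by (simp add: inv_mult_group)
      ultimately show ?thesis using U(2)[of "inv y \<otimes> x" h] x y h by (simp add: d_def)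
    qed
    then have "d y * d y \<le> e\<^sup>2" if "y \<in> carrier G" for y
      using that by (metis abs_le_square_iff abs_of_pos assms power2_eq_square)
    then have "ip d d \<le> mean (\<lambda>_. e\<^sup>2)" unfolding ip_def by (intro mean_mono cont_mult dc) auto
    then have "ip d d \<le> e\<^sup>2" by simp
    then have "ip d d * ip f f \<le> e\<^sup>2 * 1" using f by (intro mult_mono) (auto simp: ip_nonneg)
    then have "(ip d f)\<^sup>2 \<le> e\<^sup>2" using ip_Cauchy_Schwarz[OF dc f(1)] by simp
    then have "\<bar>ip d f\<bar> \<le> e" using assms by (simp add: abs_le_square_iff[symmetric])
    moreover have "ip d f = conv f (x \<otimes> h) - conv f x"
      unfolding d_def conv_def using x hc f by (intro ip_diff kernel_cont) auto
    ultimately show ?thesis by simp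
  qed
  then show ?thesis using U(1) by blast
qed

end

section \<open>Uniform limits and orthonormal systems\<close>

context compact_topological_group
begin

definition uniform_limit_on :: "(nat \<Rightarrow> 'a \<Rightarrow> real) \<Rightarrow> ('a \<Rightarrow> real) \<Rightarrow> bool" where
  "uniform_limit_on F f \<longleftrightarrow> (\<forall>e>0. \<exists>N. \<forall>n\<ge>N. \<forall>x\<in>carrier G. \<bar>F n x - f x\<bar> \<le> e)"

lemma uniform_limit_onD:
  assumes "uniform_limit_on F f" "e > 0"
  obtains N where "\<And>n x. n \<ge> N \<Longrightarrow> x \<in> carrier G \<Longrightarrow> \<bar>F n x - f x\<bar> \<le> e"
  using assms unfolding uniform_limit_on_def by blast

lemma uniform_limit_on_pointwise:
  assumes "uniform_limit_on F f" "x \<in> carrier G"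
  shows "(\<lambda>n. F n x) \<longlonglongrightarrow> f x"
proof (rule LIMSEQ_I)
  fix e :: real assume "e > 0"
  then obtain N where N: "\<And>n y. n \<ge> N \<Longrightarrow> y \<in> carrier G \<Longrightarrow> \<bar>F n y - f y\<bar> \<le> e / 2"
    using uniform_limit_onD[OF assms(1), of "e / 2"] by auto
  have "norm (F n x - f x) < e" if "n \<ge> N" for n
    using N[OF that assms(2)] \<open>e > 0\<close> by simp
  then show "\<exists>N. \<forall>n\<ge>N. norm (F n x - f x) < e" by blast
qed

lemma ip_tendsto:
  assumes F: "\<And>n. cont (F n)" "cont f" "uniform_limit_on F f"
    and H: "\<And>n. cont (H n)" "cont h" "uniform_limit_on H h"
  shows "(\<lambda>n. ip (F n) (H n)) \<longlonglongrightarrow> ip f h"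
  unfolding ip_def
proof (rule mean_tendsto)
  obtain B where B: "\<And>x. x \<in> carrier G \<Longrightarrow> \<bar>f x\<bar> \<le> B" using cont_bounded[OF F(2)] by blast
  obtain C where C: "\<And>x. x \<in> carrier G \<Longrightarrow> \<bar>h x\<bar> \<le> C" using cont_bounded[OF H(2)] by blast
  have BC: "0 \<le> B" "0 \<le> C" using B[OF one_closed] C[OF one_closed] by linarith+
  fix e :: real assume e: "e > 0"
  \<comment> \<open>The bound \<open>d \<le> 1\<close> keeps \<open>H n\<close> below
    \<open>C + 1\<close>; the other bound then makes the total error \<open>d * (B + C + 1)\<close>
    at most \<open>e\<close>.\<close>
  define d where "d = min 1 (e / (B + C + 1))"
  have d: "d > 0" "d \<le> 1" using e BC by (auto simp: d_def)
  have "d \<le> e / (B + C + 1)" by (simp add: d_def)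
  then have de: "d * (B + C + 1) \<le> e" using BC by (simp add: pos_le_divide_eq)
  obtain M where M: "\<And>n x. n \<ge> M \<Longrightarrow> x \<in> carrier G \<Longrightarrow> \<bar>F n x - f x\<bar> \<le> d"
    using uniform_limit_onD[OF F(3) d(1)] by blast
  obtain N where N: "\<And>n x. n \<ge> N \<Longrightarrow> x \<in> carrier G \<Longrightarrow> \<bar>H n x - h x\<bar> \<le> d"
    using uniform_limit_onD[OF H(3) d(1)] by blast
  have "\<bar>F n x * H n x - f x * h x\<bar> \<le> e" if n: "n \<ge> max M N" and x: "x \<in> carrier G" for n x
  proof -
    have "F n x * H n x - f x * h x = (F n x - f x) * H n x + f x * (H n x - h x)"
      by (simp add: algebra_simps)
    then have "\<bar>F n x * H n x - f x * h x\<bar> \<le> \<bar>F n x - f x\<bar> * \<bar>H n x\<bar> + \<bar>f x\<bar> * \<bar>H n x - h x\<bar>"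
      by (metis abs_mult abs_triangle_ineq)
    also have "\<dots> \<le> d * (C + 1) + B * d"
    proof (intro add_mono mult_mono)
      show "\<bar>H n x\<bar> \<le> C + 1" using N[of n x] C[OF x] d n x by simp
    qed (use M[of n x] N[of n x] B[OF x] BC d n x in auto)
    also have "\<dots> = d * (B + C + 1)" by (simp add: algebra_simps)
    finally show ?thesis using de by linarith
  qed
  then show "\<exists>N. \<forall>n\<ge>N. \<forall>x\<in>carrier G. \<bar>F n x * H n x - f x * h x\<bar> \<le> e" by blast
qed (use F H in \<open>auto intro!: cont_mult\<close>)

text \<open>The last claim is Pythagoras for the remainder \<open>r\<close>; together with
  \<open>ip_nonneg\<close> it is used as Bessel's inequality.\<close>

lemma orthonormal_projection:
  fixes n :: nat
  assumes e: "\<And>i. i < n \<Longrightarrow> cont (e i)"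
    and on: "\<And>i j. i < n \<Longrightarrow> j < n \<Longrightarrow> ip (e i) (e j) = (if i = j then 1 else 0)"
    and u: "cont u"
  defines "r \<equiv> \<lambda>x. u x - (\<Sum>i<n. ip u (e i) * e i x)"
  shows "cont r" "j < n \<Longrightarrow> ip r (e j) = 0" "ip r r = ip u u - (\<Sum>i<n. (ip u (e i))\<^sup>2)"
proof -
  define p where "p = (\<lambda>x. \<Sum>i<n. ip u (e i) * e i x)"
  have t: "cont (\<lambda>x. ip u (e i) * e i x)" if "i < n" for i
    using e[OF that] by (intro continuous_map_real_mult) auto
  have p: "cont p" unfolding p_def using t by (intro continuous_map_sum) auto
  have r: "r = (\<lambda>x. u x - p x)" by (simp add: r_def p_def)
  show rc: "cont r" unfolding r by (intro continuous_map_diff u p)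
  have ipp: "ip p h = (\<Sum>i<n. ip u (e i) * ip (e i) h)" if "cont h" for h
  proof -
    have "ip p h = (\<Sum>i<n. ip (\<lambda>x. ip u (e i) * e i x) h)"
      unfolding p_def using t that by (intro ip_sum) auto
    also have "\<dots> = (\<Sum>i<n. ip u (e i) * ip (e i) h)"
      using e that by (intro sum.cong refl ip_scale) auto
    finally show ?thesis .
  qed
  have rj: "ip r (e j) = 0" if j: "j < n" for j
  proof -
    have "ip p (e j) = (\<Sum>i<n. if i = j then ip u (e i) else 0)"
      unfolding ipp[OF e[OF j]] using on j by (intro sum.cong) auto
    also have "\<dots> = ip u (e j)" using j by simp
    finally show ?thesis unfolding r using ip_diff[OF u p e[OF j]] by simp
  qed
  then show "j < n \<Longrightarrow> ip r (e j) = 0" .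
  have "ip p r = (\<Sum>i<n. ip u (e i) * 0)"
    unfolding ipp[OF rc] using rj by (intro sum.cong refl) (simp add: ip_commute[of _ r])
  then have pr: "ip p r = 0" by simp
  have "ip r r = ip u r" using ip_diff[OF u p rc] pr by (simp only: r[symmetric])
  also have "\<dots> = ip r u" by (rule ip_commute)
  also have "\<dots> = ip u u - ip p u" unfolding r using ip_diff[OF u p u] .
  also have "ip p u = (\<Sum>i<n. (ip u (e i))\<^sup>2)"
    unfolding ipp[OF u] by (intro sum.cong refl) (simp add: power2_eq_square ip_commute[of _ u])
  finally show "ip r r = ip u u - (\<Sum>i<n. (ip u (e i))\<^sup>2)" .
qed

end

section \<open>Eigenfunctions of a convolution operator\<close>

context convolution_kernel
begin

lemma conv_uniform_limit:
  assumes F: "\<And>n. cont (F n)" "cont f" "uniform_limit_on F f"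
  shows "uniform_limit_on (\<lambda>n. conv (F n)) (conv f)"
  unfolding uniform_limit_on_def
proof (intro allI impI)
  fix e :: real assume e: "e > 0"
  \<comment> \<open>The summand 1 keeps the divisor positive even if \<open>bound\<close> is
    0.\<close>
  define d where "d = e / sqrt (bound + 1)"
  have b: "bound + 1 > 0" using bound_nonneg by simp
  then have d: "d > 0" using e by (simp add: d_def)
  obtain N where N: "\<And>n x. n \<ge> N \<Longrightarrow> x \<in> carrier G \<Longrightarrow> \<bar>F n x - f x\<bar> \<le> d"
    using uniform_limit_onD[OF F(3) d] by blast
  have "\<bar>conv (F n) x - conv f x\<bar> \<le> e" if n: "n \<ge> N" and x: "x \<in> carrier G" for n x
  proof -
    have c: "cont (\<lambda>y. F n y - f y)" using F by (intro continuous_map_diff)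
    have "ip (\<lambda>y. F n y - f y) (\<lambda>y. F n y - f y) \<le> mean (\<lambda>_. d\<^sup>2)"
      unfolding ip_def
    proof (intro mean_mono cont_mult c)
      fix y assume "y \<in> carrier G"
      then show "(F n y - f y) * (F n y - f y) \<le> d\<^sup>2"
        using N[OF n] d by (metis abs_le_square_iff abs_of_pos power2_eq_square)
    qed simp
    then have "bound * ip (\<lambda>y. F n y - f y) (\<lambda>y. F n y - f y) \<le> (bound + 1) * d\<^sup>2"
      using bound_nonneg ip_nonneg[OF c] by (intro mult_mono) auto
    also have "\<dots> = e\<^sup>2" using b by (simp add: d_def power_divide)
    finally have "(conv (\<lambda>y. F n y - f y) x)\<^sup>2 \<le> e\<^sup>2" using conv_bound[OF c x] by linarith
    then have "\<bar>conv (\<lambda>y. F n y - f y) x\<bar> \<le> e" using e by (simp add: abs_le_square_iff[symmetric])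
    then show ?thesis using conv_diff[OF F(1,2) x] by simp
  qed
  then show "\<exists>N. \<forall>n\<ge>N. \<forall>x\<in>carrier G. \<bar>conv (F n) x - conv f x\<bar> \<le> e" by blast
qed

lemma conv_power_cont: "cont f \<Longrightarrow> cont ((conv ^^ j) f)"
  by (induction j) (auto intro: conv_cont)

lemma conv_power_symmetric:
  assumes f: "cont f"
  shows "cont u \<Longrightarrow> ip ((conv ^^ j) f) u = ip f ((conv ^^ j) u)"
proof (induction j arbitrary: u)
  case (Suc j)
  have "ip ((conv ^^ Suc j) f) u = ip ((conv ^^ j) f) (conv u)"
    using conv_symmetric[OF conv_power_cont[OF f] Suc.prems, of j] by simp
  then show ?case using Suc.IH[OF conv_cont[OF Suc.prems]] by (simp add: funpow_swap1)
qed simp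

text \<open>Power iteration: the ratios \<open>\<parallel>conv\<^sup>j\<^sup>+\<^sup>1 g\<parallel> / \<parallel>conv\<^sup>j g\<parallel>\<close> increase to a limit, and any uniform
  cluster point of the normalized iterates is an eigenfunction of the square of \<open>conv\<close>.\<close>

lemma eigenfunction_exists:
  assumes g: "cont g" and ne: "ip (conv g) (conv g) > 0"
  shows "\<exists>w l. l > 0 \<and> cont w \<and> ip w w = l \<and> (\<forall>x\<in>carrier G. conv (conv w) x = l * w x) \<and>
    (\<forall>u. cont u \<and> (\<forall>j. ip ((conv ^^ j) g) u = 0) \<longrightarrow> ip w u = 0)"
proof -
  define h where "h = (\<lambda>j. (conv ^^ j) g)"
  have hc: "cont (h j)" for j using conv_power_cont[OF g] by (simp add: h_def)
  have hS: "h (Suc j) = conv (h j)" for j by (simp add: h_def)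
  define N where "N = (\<lambda>j. ip (h j) (h j))"
  have N_alt: "N (Suc j) = ip (h j) (h (Suc (Suc j)))" for j
    using conv_symmetric[OF hc hc, of j "Suc j"] by (simp add: N_def hS)
  \<comment> \<open>Self-adjointness and Cauchy-Schwarz make the squared norms log-convex; this is
    what makes their ratios increase.\<close>
  have N_log: "(N (Suc j))\<^sup>2 \<le> N j * N (Suc (Suc j))" for j
    using ip_Cauchy_Schwarz[OF hc hc, of j "Suc (Suc j)"] unfolding N_alt[symmetric] by (simp only: N_def)
  have N_bound: "N (Suc j) \<le> bound * N j" for j
    using ip_conv_le[OF hc] by (simp add: N_def hS)
  have N_pos: "N j > 0 \<and> N (Suc j) > 0" for j
  proof (induction j)
    case 0
    have "N 1 > 0" using ne by (simp add: N_def h_def)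
    moreover have "N 0 \<noteq> 0" using N_bound[of 0] \<open>N 1 > 0\<close> by auto
    ultimately show ?case using ip_nonneg[OF hc, of 0] by (simp add: N_def)
  next
    case (Suc j)
    have "0 < N j * N (Suc (Suc j))" using N_log[of j] Suc by (smt (verit) zero_less_power)
    then show ?case using Suc by (simp add: zero_less_mult_iff)
  qed
  \<comment> \<open>\<open>q\<close> is the square of the ratio of consecutive norms, so its limit
    \<open>l\<close> is an eigenvalue of the square of \<open>conv\<close>, not of
    \<open>conv\<close> itself.\<close>
  define q where "q = (\<lambda>j. N (Suc j) / N j)"
  have q_inc: "q j \<le> q (Suc j)" for j
  proof -
    have "N (Suc j) * N (Suc j) \<le> N (Suc (Suc j)) * N j" using N_log[of j] by (simp add: power2_eq_square mult.commute)
    then show ?thesis using N_pos[of j] N_pos[of "Suc j"] by (simp add: q_def frac_le_eq divide_simps)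
  qed
  have q_bound: "q j \<le> bound" for j
    using N_bound[of j] N_pos[of j] by (simp add: q_def pos_divide_le_eq)
  obtain l where l: "q \<longlonglongrightarrow> l" "\<And>j. q j \<le> l"
    using incseq_convergent[of q bound] q_inc q_bound by (auto simp: incseq_Suc_iff)
  have "0 < q 0" using N_pos[of 0] by (simp add: q_def)
  then have l_pos: "l > 0" using l(2)[of 0] by linarith
  define s where "s = (\<lambda>j. 1 / sqrt (N j))"
  have s2: "s j * s j = 1 / N j" for j using N_pos[of j] by (simp add: s_def)
  define v where "v = (\<lambda>j x. s j * h j x)"
  have vc: "cont (v j)" for j unfolding v_def using hc by (intro continuous_map_real_mult) auto
  \<comment> \<open>A bound on the norms of the \<open>v j\<close> yields equicontinuity only after
    one application of \<open>conv\<close>; hence \<open>w\<close> is passed to the compactness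
    argument.\<close>
  define w where "w = (\<lambda>j. conv (v j))"
  have wc: "cont (w j)" for j unfolding w_def by (intro conv_cont vc)
  have w_eq: "w j x = s j * h (Suc j) x" if "x \<in> carrier G" for j x
    unfolding w_def v_def using conv_scale[OF hc that] by (simp add: hS)
  have ww_eq: "conv (w j) x = s j * h (Suc (Suc j)) x" if "x \<in> carrier G" for j x
  proof -
    have "conv (w j) x = conv (\<lambda>x. s j * h (Suc j) x) x" by (rule conv_cong) (rule w_eq)
    also have "\<dots> = s j * conv (h (Suc j)) x" by (rule conv_scale[OF hc that])
    finally show ?thesis by (simp only: hS[of "Suc j"])
  qed
  have ip_s: "ip (\<lambda>x. s j * f x) (\<lambda>x. s j * f' x) = ip f f' / N j" if "cont f" "cont f'" for f f' j
  proof -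
    have "cont (\<lambda>x. s j * f' x)" using that by (intro continuous_map_real_mult) auto
    then have "ip (\<lambda>x. s j * f x) (\<lambda>x. s j * f' x) = s j * ip (\<lambda>x. s j * f' x) f"
      using ip_scale[OF that(1)] ip_commute[of f] by simp
    also have "\<dots> = (s j * s j) * ip f f'" using ip_scale[OF that(2,1)] ip_commute[of f f'] by simp
    finally show ?thesis by (simp add: s2)
  qed
  have ip_v: "ip (v j) (v j) = 1" for j
    unfolding v_def ip_s[OF hc hc] using N_pos[of j] by (simp add: N_def)
  have ip_w: "ip (w j) (w j) = q j" for j
  proof -
    have "ip (w j) (w j) = ip (\<lambda>x. s j * h (Suc j) x) (\<lambda>x. s j * h (Suc j) x)"
      by (intro ip_cong w_eq)
    then show ?thesis using ip_s[OF hc hc] by (simp add: q_def N_def)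
  qed
  have eq: "\<exists>U. nhd U \<and> (\<forall>n. \<forall>x\<in>carrier G. \<forall>h\<in>U. \<bar>w n (x \<otimes> h) - w n x\<bar> \<le> e)" if "e > 0" for e
    using conv_equicontinuous[OF that] vc ip_v unfolding w_def by (metis order_refl)
  have wb: "\<bar>w n x\<bar> \<le> sqrt bound" if "x \<in> carrier G" for n x
    using conv_bound[OF vc that, of n] ip_v by (simp add: w_def real_le_rsqrt)
  obtain r W where r: "strict_mono (r :: nat \<Rightarrow> nat)" and W: "cont W"
    and lim: "\<forall>e>0. \<exists>N. \<forall>n\<ge>N. \<forall>x\<in>carrier G. \<bar>w (r n) x - W x\<bar> \<le> e"
    using equicontinuous_subsequence[of w "sqrt bound", OF eq wb] by blast
  have unif: "uniform_limit_on (\<lambda>n. w (r n)) W" using lim by (simp add: uniform_limit_on_def)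
  have qr: "(\<lambda>n. q (r n)) \<longlonglongrightarrow> l" using LIMSEQ_subseq_LIMSEQ[OF l(1) r] by (simp add: o_def)
  have qr': "(\<lambda>n. q (Suc (r n))) \<longlonglongrightarrow> l"
    using LIMSEQ_subseq_LIMSEQ[OF LIMSEQ_Suc[OF l(1)] r] by (simp add: o_def)
  have "(\<lambda>n. ip (w (r n)) (w (r n))) \<longlonglongrightarrow> ip W W" by (intro ip_tendsto wc W unif)
  then have ipW: "ip W W = l" using qr LIMSEQ_unique unfolding ip_w by blast
  have eigen: "conv (conv W) x = l * W x" if x: "x \<in> carrier G" for x
  proof -
    \<comment> \<open>The defect of \<open>v j\<close> as an eigenfunction. Its norm tends to 0
      because \<open>q j\<close> and \<open>q (Suc j)\<close> have the same limit, and one more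
      \<open>conv\<close> turns this into pointwise convergence.\<close>
    define d where "d = (\<lambda>j y. conv (w j) y - l * v j y)"
    have lv: "cont (\<lambda>y. l * v j y)" for j using vc by (intro continuous_map_real_mult) auto
    have dc: "cont (d j)" for j unfolding d_def by (intro continuous_map_diff conv_cont wc lv)
    have conv_d: "conv (d j) x = conv (conv (w j)) x - l * w j x" for j
      unfolding d_def using conv_diff[OF conv_cont[OF wc] lv x] conv_scale[OF vc x] by (simp add: w_def)
    have ip_d: "ip (d j) (d j) = q j * q (Suc j) - 2 * l * q j + l\<^sup>2" for j
    proof -
      have 1: "ip (conv (w j)) (conv (w j)) = q j * q (Suc j)"
      proof -
        have "ip (conv (w j)) (conv (w j)) =
            ip (\<lambda>x. s j * h (Suc (Suc j)) x) (\<lambda>x. s j * h (Suc (Suc j)) x)"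
          by (intro ip_cong ww_eq)
        also have "\<dots> = N (Suc (Suc j)) / N j" unfolding ip_s[OF hc hc] by (simp only: N_def)
        finally show ?thesis using N_pos[of j] N_pos[of "Suc j"] by (simp add: q_def)
      qed
      have 2: "ip (conv (w j)) (v j) = q j"
        using conv_symmetric[OF wc vc, of j j] ip_w[of j] by (simp add: w_def)
      have "ip (d j) (d j) = ip (conv (w j)) (d j) - ip (\<lambda>y. l * v j y) (d j)"
        using ip_diff[OF conv_cont[OF wc] lv dc, of j j j] by (simp only: d_def)
      also have "ip (\<lambda>y. l * v j y) (d j) = l * ip (d j) (v j)"
        using ip_scale[OF vc dc, of l j j] by (simp only: ip_commute[of "v j"])
      also have "ip (d j) (v j) = q j - l"
        using ip_diff[OF conv_cont[OF wc] lv vc, of j j j] ip_scale[OF vc vc, of l j j] 2 ip_v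
        by (simp add: d_def)
      also have "ip (conv (w j)) (d j) = ip (d j) (conv (w j))" by (rule ip_commute)
      also have "ip (d j) (conv (w j)) = q j * q (Suc j) - l * q j"
        using ip_diff[OF conv_cont[OF wc] lv conv_cont[OF wc], of j j j]
          ip_scale[OF vc conv_cont[OF wc], of l j j] 1 2 ip_commute[of "v j" "conv (w j)"] by (simp add: d_def)
      finally show ?thesis by (simp add: algebra_simps power2_eq_square)
    qed
    have "(\<lambda>n. ip (d (r n)) (d (r n))) \<longlonglongrightarrow> l * l - 2 * l * l + l\<^sup>2"
      unfolding ip_d by (intro tendsto_intros qr qr')
    then have "(\<lambda>n. ip (d (r n)) (d (r n))) \<longlonglongrightarrow> 0" by (simp add: power2_eq_square)
    from tendsto_mult[OF tendsto_const[of bound] this]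
    have lim0: "(\<lambda>n. bound * ip (d (r n)) (d (r n))) \<longlonglongrightarrow> 0" by simp
    have "(\<lambda>n. (conv (d (r n)) x)\<^sup>2) \<longlonglongrightarrow> 0"
      by (rule Lim_null_comparison[OF always_eventually lim0]) (simp add: conv_bound[OF dc x])
    then have 0: "(\<lambda>n. conv (d (r n)) x) \<longlonglongrightarrow> 0" by simp
    have "(\<lambda>n. conv (conv (w (r n))) x - l * w (r n) x) \<longlonglongrightarrow> conv (conv W) x - l * W x"
    proof (intro tendsto_intros)
      have "uniform_limit_on (\<lambda>n. conv (conv (w (r n)))) (conv (conv W))"
        by (intro conv_uniform_limit conv_cont wc W unif)
      then show "(\<lambda>n. conv (conv (w (r n))) x) \<longlonglongrightarrow> conv (conv W) x"
        by (rule uniform_limit_on_pointwise) (rule x)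
      show "(\<lambda>n. w (r n) x) \<longlonglongrightarrow> W x" by (rule uniform_limit_on_pointwise[OF unif x])
    qed
    then show ?thesis using LIMSEQ_unique[OF 0] unfolding conv_d by fastforce
  qed
  \<comment> \<open>On the group every \<open>w j\<close> is a multiple of an iterate of
    \<open>g\<close>, so orthogonality to all iterates passes to the limit \<open>W\<close>.\<close>
  have "ip W u = 0" if u: "cont u" "\<And>j. ip ((conv ^^ j) g) u = 0" for u
  proof -
    have "ip (w j) u = 0" for j
    proof -
      have "ip (w j) u = ip (\<lambda>x. s j * h (Suc j) x) u" by (intro ip_cong w_eq refl)
      also have "\<dots> = s j * ip (h (Suc j)) u" by (rule ip_scale[OF hc u(1)])
      finally show ?thesis using u(2)[of "Suc j"] by (simp add: h_def)
    qed
    moreover have "uniform_limit_on (\<lambda>n. u) u" by (auto simp: uniform_limit_on_def)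
    then have "(\<lambda>n. ip (w (r n)) u) \<longlonglongrightarrow> ip W u" by (intro ip_tendsto wc W unif u)
    ultimately show ?thesis using LIMSEQ_unique[OF tendsto_const] by fastforce
  qed
  then show ?thesis using l_pos W ipW eigen by blast
qed

section \<open>Eigenspaces of the square of a convolution operator\<close>

definition eigenspace :: "real \<Rightarrow> ('a \<Rightarrow> real) set" where
  "eigenspace l = {f. cont f \<and> (\<forall>x\<in>carrier G. conv (conv f) x = l * f x)}"

lemma eigenspace_ltranslate:
  assumes "f \<in> eigenspace l" "a \<in> carrier G"
  shows "(\<lambda>z. f (a \<otimes> z)) \<in> eigenspace l"
proof -
  have f: "cont f" "\<And>x. x \<in> carrier G \<Longrightarrow> conv (conv f) x = l * f x" using assms by (auto simp: eigenspace_def)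
  have "conv (conv (\<lambda>z. f (a \<otimes> z))) x = l * f (a \<otimes> x)" if x: "x \<in> carrier G" for x
  proof -
    have "conv (conv (\<lambda>z. f (a \<otimes> z))) x = conv (\<lambda>z. conv f (a \<otimes> z)) x"
      by (rule conv_cong) (rule conv_ltranslate[OF f(1) assms(2)])
    also have "\<dots> = conv (conv f) (a \<otimes> x)" by (rule conv_ltranslate[OF conv_cont[OF f(1)] assms(2) x])
    finally show ?thesis using f(2) assms(2) x by simp
  qed
  then show ?thesis using cont_ltranslate[OF f(1) assms(2)] by (simp add: eigenspace_def)
qed

lemma eigenspace_diff_scale:
  assumes "f \<in> eigenspace l" "g \<in> eigenspace l"
  shows "(\<lambda>x. f x - g x) \<in> eigenspace l" "(\<lambda>x. c * f x) \<in> eigenspace l"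
proof -
  have f: "cont f" "\<And>x. x \<in> carrier G \<Longrightarrow> conv (conv f) x = l * f x"
    and g: "cont g" "\<And>x. x \<in> carrier G \<Longrightarrow> conv (conv g) x = l * g x" using assms by (auto simp: eigenspace_def)
  have "conv (conv (\<lambda>x. f x - g x)) x = l * (f x - g x)" if x: "x \<in> carrier G" for x
  proof -
    have "conv (conv (\<lambda>x. f x - g x)) x = conv (\<lambda>x. conv f x - conv g x) x"
      by (rule conv_cong) (rule conv_diff[OF f(1) g(1)])
    then show ?thesis
      using conv_diff[OF conv_cont[OF f(1)] conv_cont[OF g(1)] x] f(2) g(2) x by (simp add: right_diff_distrib)
  qed
  then show "(\<lambda>x. f x - g x) \<in> eigenspace l" using f g by (simp add: eigenspace_def continuous_map_diff)
  have "conv (conv (\<lambda>x. c * f x)) x = l * (c * f x)" if x: "x \<in> carrier G" for x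
  proof -
    have "conv (conv (\<lambda>x. c * f x)) x = conv (\<lambda>x. c * conv f x) x"
      by (rule conv_cong) (rule conv_scale[OF f(1)])
    then show ?thesis using conv_scale[OF conv_cont[OF f(1)] x] f(2) x by simp
  qed
  moreover have "cont (\<lambda>x. c * f x)" using f by (intro continuous_map_real_mult) auto
  ultimately show "(\<lambda>x. c * f x) \<in> eigenspace l" by (simp add: eigenspace_def)
qed

lemma eigenspace_zero: "(\<lambda>_. 0) \<in> eigenspace l"
proof -
  have "conv (\<lambda>_. 0) x = 0" for x by (simp add: conv_def ip_def)
  then show ?thesis by (simp add: eigenspace_def cong: conv_cong)
qed

lemma eigenspace_sum:
  assumes "finite I" "\<And>i. i \<in> I \<Longrightarrow> f i \<in> eigenspace l"
  shows "(\<lambda>x. \<Sum>i\<in>I. f i x) \<in> eigenspace l"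
  using assms
proof (induction I)
  case empty
  then show ?case using eigenspace_zero by simp
next
  case (insert i I)
  have "(\<lambda>x. - (\<Sum>i\<in>I. f i x)) \<in> eigenspace l"
    using eigenspace_diff_scale(2)[of "\<lambda>x. \<Sum>i\<in>I. f i x" l _ "-1"] insert by simp
  then show ?case using eigenspace_diff_scale(1)[of "f i" l "\<lambda>x. - (\<Sum>i\<in>I. f i x)"] insert by simp
qed

text \<open>For an orthonormal system in the eigenspace, \<open>l * e i x\<close> is the coefficient
  at \<open>e i\<close> of the image under \<open>conv\<close> of the row
  \<open>k (inv x \<otimes> _)\<close>. Bessel's inequality bounds the sum of the squares by the
  square of \<open>bound\<close>, and taking the mean over \<open>x\<close> bounds the length
  \<open>n\<close> of the system. A longest system spans, since a nonzero remainder could be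
  normalized and added to it.\<close>

lemma eigenspace_basis:
  assumes l: "l > 0"
  shows "\<exists>(n :: nat) e. (\<forall>i<n. e i \<in> eigenspace l) \<and>
    (\<forall>i<n. \<forall>j<n. ip (e i) (e j) = (if i = j then 1 else 0)) \<and>
    (\<forall>f\<in>eigenspace l. \<forall>x\<in>carrier G. f x = (\<Sum>i<n. ip f (e i) * e i x))"
proof -
  define ON where "ON = (\<lambda>n (e :: nat \<Rightarrow> 'a \<Rightarrow> real). (\<forall>i<n. e i \<in> eigenspace l) \<and>
    (\<forall>i<n. \<forall>j<n. ip (e i) (e j) = (if i = j then 1 else 0)))"
  have bounded: "real n * l\<^sup>2 \<le> bound\<^sup>2" if "ON n e" for n e
  proof -
    have e: "\<And>i. i < n \<Longrightarrow> cont (e i)" "\<And>i x. i < n \<Longrightarrow> x \<in> carrier G \<Longrightarrow> conv (conv (e i)) x = l * e i x"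
      and on: "\<And>i j. i < n \<Longrightarrow> j < n \<Longrightarrow> ip (e i) (e j) = (if i = j then 1 else 0)"
      using that by (auto simp: ON_def eigenspace_def)
    have c: "cont (\<lambda>x. l\<^sup>2 * (e i x * e i x))" if "i < n" for i
      using e(1)[OF that] by (intro continuous_map_real_mult) auto
    have "(\<Sum>i<n. l\<^sup>2 * (e i x * e i x)) \<le> bound\<^sup>2" if x: "x \<in> carrier G" for x
    proof -
      define u where "u = conv (\<lambda>y. k (inv x \<otimes> y))"
      have u: "cont u" unfolding u_def by (intro conv_cont kernel_cont x)
      have "l * e i x = ip u (e i)" if "i < n" for i
        using e(2)[OF that x] conv_symmetric[OF kernel_cont[OF x] e(1)[OF that]]
        by (simp add: u_def conv_def)
      then have "(\<Sum>i<n. (l * e i x)\<^sup>2) = (\<Sum>i<n. (ip u (e i))\<^sup>2)" by simp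
      then have "(\<Sum>i<n. l\<^sup>2 * (e i x * e i x)) = (\<Sum>i<n. (ip u (e i))\<^sup>2)"
        by (simp add: power2_eq_square mult_ac)
      also have "\<dots> \<le> ip u u"
        using orthonormal_projection(1,3)[of n e u] e(1) on u ip_nonneg by (smt (verit))
      also have "\<dots> \<le> bound * ip (\<lambda>y. k (inv x \<otimes> y)) (\<lambda>y. k (inv x \<otimes> y))"
        unfolding u_def by (rule ip_conv_le[OF kernel_cont[OF x]])
      finally show ?thesis using ip_kernel[OF x] by (simp add: power2_eq_square)
    qed
    then have "mean (\<lambda>x. \<Sum>i<n. l\<^sup>2 * (e i x * e i x)) \<le> mean (\<lambda>_. bound\<^sup>2)"
      using c by (intro mean_mono continuous_map_sum) auto
    moreover have "mean (\<lambda>x. \<Sum>i<n. l\<^sup>2 * (e i x * e i x)) = (\<Sum>i<n. l\<^sup>2)"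
    proof -
      have "mean (\<lambda>x. l\<^sup>2 * (e i x * e i x)) = l\<^sup>2" if "i < n" for i
        using mean_scale[OF cont_mult[OF e(1)[OF that] e(1)[OF that]]] on[OF that that] by (simp add: ip_def)
      then show ?thesis using c by (subst mean_sum) auto
    qed
    ultimately show ?thesis by simp
  qed
  have le: "n \<le> nat \<lfloor>bound\<^sup>2 / l\<^sup>2\<rfloor>" if "\<exists>e. ON n e" for n
    using bounded that l by (auto simp: le_nat_floor pos_le_divide_eq)
  have "\<exists>e. ON 0 e" by (simp add: ON_def)
  define n where "n = (GREATEST n. \<exists>e. ON n e)"
  have n: "\<exists>e. ON n e" "\<And>m. \<exists>e. ON m e \<Longrightarrow> m \<le> n"
    unfolding n_def
    using GreatestI_nat[where P = "\<lambda>n. \<exists>e. ON n e", OF \<open>\<exists>e. ON 0 e\<close> le]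
      Greatest_le_nat[where P = "\<lambda>n. \<exists>e. ON n e", OF _ le] by blast+
  then obtain e where e: "ON n e" by blast
  have ec: "\<And>i. i < n \<Longrightarrow> cont (e i)" and ev: "\<And>i. i < n \<Longrightarrow> e i \<in> eigenspace l"
    and on: "\<And>i j. i < n \<Longrightarrow> j < n \<Longrightarrow> ip (e i) (e j) = (if i = j then 1 else 0)"
    using e by (auto simp: ON_def eigenspace_def)
  have "f x = (\<Sum>i<n. ip f (e i) * e i x)" if f: "f \<in> eigenspace l" and x: "x \<in> carrier G" for f x
  proof (rule ccontr)
    assume neq: "f x \<noteq> (\<Sum>i<n. ip f (e i) * e i x)"
    define r where "r = (\<lambda>x. f x - (\<Sum>i<n. ip f (e i) * e i x))"
    have fc: "cont f" using f by (simp add: eigenspace_def)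
    note pr = orthonormal_projection[of n e f, folded r_def, OF ec on fc]
    have rc: "cont r" and re: "\<And>j. j < n \<Longrightarrow> ip r (e j) = 0" using pr by blast+
    have rV: "r \<in> eigenspace l"
      unfolding r_def using f ev by (intro eigenspace_diff_scale(1) eigenspace_sum eigenspace_diff_scale(2)) auto
    have "ip r r \<noteq> 0" using ip_eq_0[OF rc _ x] neq by (auto simp: r_def)
    then have rpos: "ip r r > 0" using ip_nonneg[OF rc] by simp
    define t where "t = 1 / sqrt (ip r r)"
    define e' where "e' = e(n := \<lambda>x. t * r x)"
    have tr: "cont (\<lambda>x. t * r x)" using rc by (intro continuous_map_real_mult) auto
    have "ip (\<lambda>x. t * r x) (\<lambda>x. t * r x) = t * (t * ip r r)"
      using ip_scale[OF rc tr] ip_scale[OF rc rc] by (simp add: ip_commute[of r "\<lambda>x. t * r x"])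
    also have "\<dots> = 1" using rpos by (simp add: t_def)
    finally have 1: "ip (\<lambda>x. t * r x) (\<lambda>x. t * r x) = 1" .
    have 2: "ip (\<lambda>x. t * r x) (e j) = 0" "ip (e j) (\<lambda>x. t * r x) = 0" if "j < n" for j
      using ip_scale[OF rc ec[OF that]] re[OF that] by (simp_all add: ip_commute[of "e j"])
    have "ON (Suc n) e'"
      using ev on rV eigenspace_diff_scale(2)[OF rV rV] 1 2 by (auto simp: ON_def e'_def less_Suc_eq)
    then have "Suc n \<le> n" using n(2) by blast
    then show False by simp
  qed
  then show ?thesis using e unfolding ON_def by blast
qed

end

section \<open>Lifting over a totally disconnected kernel\<close>

context normal
begin

lemma mem_one: "\<one> \<in> H"
  and mem_mult: "x \<in> H \<Longrightarrow> y \<in> H \<Longrightarrow> x \<otimes> y \<in> H"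
  and mem_inv: "x \<in> H \<Longrightarrow> inv x \<in> H"
  using subgroup.one_closed[OF subgroup_axioms] subgroup.m_closed[OF subgroup_axioms]
    subgroup.m_inv_closed[OF subgroup_axioms] by auto

text \<open>Congruence modulo \<open>H\<close> is expressed by
  \<open>inv x \<otimes> y \<in> H\<close>, so that lifting takes place among elements of
  \<open>G\<close>. Normality enters because the factor \<open>inv x \<otimes> y\<close> gets
  conjugated by \<open>u\<close>.\<close>

lemma coset_cong_mult:
  assumes "x \<in> carrier G" "y \<in> carrier G" "u \<in> carrier G" "v \<in> carrier G"
    and "inv x \<otimes> y \<in> H" "inv u \<otimes> v \<in> H"
  shows "inv (x \<otimes> u) \<otimes> (y \<otimes> v) \<in> H"
proof -
  have "(inv u \<otimes> (inv x \<otimes> y) \<otimes> u) \<otimes> (inv u \<otimes> v) \<in> H"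
    by (rule mem_mult[OF inv_op_closed1[OF assms(3,5)] assms(6)])
  then show ?thesis using assms(1-4) by (simp add: m_assoc inv_mult_group)
qed

lemma coset_cong_inv:
  assumes "x \<in> carrier G" "y \<in> carrier G" "inv x \<otimes> y \<in> H"
  shows "inv (inv x) \<otimes> inv y \<in> H"
proof -
  have "x \<otimes> inv (inv x \<otimes> y) \<otimes> inv x \<in> H"
    using inv_op_closed2[OF assms(1) mem_inv[OF assms(3)]] .
  then show ?thesis using assms(1,2) by (simp add: m_assoc inv_mult_group)
qed

lemma coset_cong_pow:
  assumes "x \<in> carrier G" "y \<in> carrier G" "inv x \<otimes> y \<in> H"
  shows "inv (x [^] (z::int)) \<otimes> (y [^] z) \<in> H"
proof -
  have *: "inv (x [^] (n::nat)) \<otimes> (y [^] n) \<in> H" for n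
  proof (induction n)
    case (Suc n)
    have "inv (x [^] n \<otimes> x) \<otimes> (y [^] n \<otimes> y) \<in> H"
      using assms by (intro coset_cong_mult Suc) auto
    then show ?case by simp
  qed (simp add: mem_one)
  show ?thesis
  proof (cases "z < 0")
    case True
    have "inv (inv (x [^] nat (- z))) \<otimes> inv (y [^] nat (- z)) \<in> H"
      using assms(1,2) by (intro coset_cong_inv *) auto
    moreover have "x [^] z = inv (x [^] nat (- z))" "y [^] z = inv (y [^] nat (- z))"
      unfolding int_pow_def2[of G _ z] using True by simp_all
    ultimately show ?thesis by (simp only:)
  next
    case False
    then have "x [^] z = x [^] nat z" "y [^] z = y [^] nat z"
      unfolding int_pow_def2[of G _ z] by simp_all
    then show ?thesis using *[of "nat z"] by (simp only:)
  qed
qed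

lemma coset_cong_word:
  assumes "range a \<subseteq> carrier G" "range b \<subseteq> carrier G" "\<And>n. inv (a n) \<otimes> b n \<in> H"
  shows "inv (word a z js) \<otimes> word b z js \<in> H"
proof -
  have "a n \<in> carrier G" "b n \<in> carrier G" for n using assms by auto
  then show ?thesis
    using assms by (induction js) (auto intro!: coset_cong_mult coset_cong_pow mem_one)
qed

lemma coset_cong_trans:
  assumes "x \<in> carrier G" "y \<in> carrier G" "u \<in> carrier G" "inv x \<otimes> y \<in> H" "inv y \<otimes> u \<in> H"
  shows "inv x \<otimes> u \<in> H"
proof -
  have "(inv x \<otimes> y) \<otimes> (inv y \<otimes> u) \<in> H" by (rule mem_mult[OF assms(4,5)])
  then show ?thesis using assms(1-3) by (simp add: m_assoc)
qed

lemma coset_cong_sym: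
  assumes "x \<in> carrier G" "y \<in> carrier G" "inv x \<otimes> y \<in> H"
  shows "inv y \<otimes> x \<in> H"
proof -
  have "inv (inv x \<otimes> y) \<in> H" using assms(3) by (rule mem_inv)
  then show ?thesis using assms(1,2) by (simp add: inv_mult_group)
qed

lemma set_mult_coset_cong:
  assumes "x \<in> V <#> H" "V \<subseteq> carrier G" "y \<in> carrier G" "inv x \<otimes> y \<in> H"
  shows "y \<in> V <#> H"
proof -
  obtain v l where vl: "v \<in> V" "l \<in> H" "x = v \<otimes> l" using assms(1) by (auto simp: set_mult_def)
  then have "v \<in> carrier G" "l \<in> carrier G" using assms(2) by auto
  then have "y = v \<otimes> (l \<otimes> (inv x \<otimes> y))" using vl assms(3) by (simp add: m_assoc inv_mult_group)
  moreover have "l \<otimes> (inv x \<otimes> y) \<in> H" using vl(2) assms(4) by (rule mem_mult)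
  ultimately show ?thesis using vl unfolding set_mult_def by blast
qed

end

section \<open>Lifting through a relatively open subgroup\<close>

context hausdorff_topological_group
begin

lemma summable_mod_cong:
  assumes "L \<lhd> G" "summable_mod f L a" "range b \<subseteq> carrier G" "\<And>n. inv (a n) \<otimes> b n \<in> L"
  shows "summable_mod f L b"
  unfolding summable_mod_def
proof (intro conjI allI impI assms(3))
  interpret L: normal L G by (rule assms(1))
  fix U assume U: "nhd U"
  have ra: "range a \<subseteq> carrier G" using assms(2) by (simp add: summable_mod_def)
  obtain n where n: "\<And>z js. admissible f n z js \<Longrightarrow> word a z js \<in> U <#> L"
    using assms(2) U unfolding summable_mod_def by blast
  have "word b z js \<in> U <#> L" if "admissible f n z js" for z js
    using L.set_mult_coset_cong[OF n[OF that] nhd_carrier[OF U] word_closed[OF assms(3)]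
      L.coset_cong_word[OF ra assms(3,4)]] .
  then show "\<exists>n. \<forall>z js. admissible f n z js \<longrightarrow> word b z js \<in> U <#> L" by blast
qed

text \<open>A product of elements of \<open>V <#> L'\<close> that lies in the larger set \<open>V <#> L\<close> is already in
  \<open>V <#> L'\<close>; so lifts that are small stay small as long as their products modulo \<open>L\<close> are small.\<close>

lemma summable_mod_lift_step:
  assumes f: "\<And>n. f n \<noteq> 0" and L: "L \<lhd> G" and L': "L' \<lhd> G" and sub: "L' \<subseteq> L"
    and V0: "nhd V0" "V0 \<inter> L \<subseteq> L'" and a: "summable_mod f L a"
  shows "\<exists>a'. summable_mod f L' a' \<and> (\<forall>n. inv (a n) \<otimes> a' n \<in> L)"
proof -
  interpret L: normal L G by (rule L)
  interpret L': normal L' G by (rule L')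
  obtain V where V: "nhd V" "\<And>x. x \<in> V \<Longrightarrow> inv x \<in> V"
    "\<And>x y z. x \<in> V \<Longrightarrow> y \<in> V \<Longrightarrow> z \<in> V \<Longrightarrow> x \<otimes> y \<otimes> z \<in> V0"
    using nhd_cube[OF V0(1)] by metis
  have Vc: "v \<in> carrier G" if "v \<in> V" for v using nhd_carrier[OF V(1)] that by blast
  have V1: "\<one> \<in> V" using V(1) by (simp add: nhd_def)
  have memI: "v \<otimes> l \<in> W <#> M" if "v \<in> W" "l \<in> M" for v l W and M :: "'a set"
    using that unfolding set_mult_def by blast
  have VL': "v \<in> V <#> L'" if "v \<in> V" for v
    using memI[OF that L'.mem_one] Vc[OF that] by simp
  \<comment> \<open>The product is written as \<open>w \<otimes> l\<close> and, moving
    \<open>l1\<close> past \<open>v1\<close> by normality, as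
    \<open>(u1 \<otimes> v1) \<otimes> l'\<close>. Then
    \<open>h = inv w \<otimes> u1 \<otimes> v1\<close> is in \<open>V0\<close> by the choice of
    \<open>V\<close> and in \<open>L\<close> by comparing the two forms, hence in
    \<open>L'\<close>.\<close>
  have closing: "u \<otimes> v \<in> V <#> L'"
    if u0: "u \<in> V <#> L'" and v0: "v \<in> V <#> L'" and w0: "u \<otimes> v \<in> V <#> L" for u v
  proof -
    obtain u1 l1 where u: "u1 \<in> V" "l1 \<in> L'" "u = u1 \<otimes> l1" using u0 by (auto simp: set_mult_def)
    obtain v1 l2 where v: "v1 \<in> V" "l2 \<in> L'" "v = v1 \<otimes> l2" using v0 by (auto simp: set_mult_def)
    obtain w l where w: "w \<in> V" "l \<in> L" "u \<otimes> v = w \<otimes> l" using w0 by (auto simp: set_mult_def)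
    note c = Vc[OF u(1)] Vc[OF v(1)] Vc[OF w(1)] L'.mem_carrier[OF u(2)] L'.mem_carrier[OF v(2)] L.mem_carrier[OF w(2)]
    define l' where "l' = (inv v1 \<otimes> l1 \<otimes> v1) \<otimes> l2"
    have l': "l' \<in> L'" unfolding l'_def using L'.mem_mult[OF L'.inv_op_closed1[OF c(2) u(2)] v(2)] .
    have l'c: "l' \<in> carrier G" using l' by (rule L'.mem_carrier)
    have uv: "u \<otimes> v = (u1 \<otimes> v1) \<otimes> l'" using c u(3) v(3) by (simp add: l'_def m_assoc)
    define h where "h = inv w \<otimes> u1 \<otimes> v1"
    have h0: "h \<in> V0" unfolding h_def using V(3)[OF V(2)[OF w(1)] u(1) v(1)] .
    have "(u1 \<otimes> v1) \<otimes> l' = w \<otimes> l" using uv w(3) by simp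
    then have "inv w \<otimes> ((u1 \<otimes> v1) \<otimes> l') \<otimes> inv l' = inv w \<otimes> (w \<otimes> l) \<otimes> inv l'" by simp
    then have "h = l \<otimes> inv l'" using c l'c by (simp add: h_def m_assoc)
    then have "h \<in> L" using L.mem_mult[OF w(2) L.mem_inv] l' sub by blast
    then have h: "h \<in> L'" using h0 V0(2) by blast
    have "u \<otimes> v = w \<otimes> (h \<otimes> l')" using uv c l'c by (simp add: h_def m_assoc)
    then show ?thesis using memI[OF w(1) L'.mem_mult[OF h l']] by simp
  qed
  have inverse: "inv u \<in> V <#> L'" if u0: "u \<in> V <#> L'" for u
  proof -
    obtain v l where u: "v \<in> V" "l \<in> L'" "u = v \<otimes> l" using u0 by (auto simp: set_mult_def)
    note c = Vc[OF u(1)] L'.mem_carrier[OF u(2)]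
    have "inv u = inv v \<otimes> (v \<otimes> inv l \<otimes> inv v)" using c u(3) by (simp add: m_assoc inv_mult_group)
    moreover have "v \<otimes> inv l \<otimes> inv v \<in> L'" using L'.inv_op_closed2[OF c(1) L'.mem_inv[OF u(2)]] .
    ultimately show ?thesis using memI[OF V(2)[OF u(1)]] by simp
  qed
  have ra: "range a \<subseteq> carrier G" using a by (simp add: summable_mod_def)
  then have ac: "a n \<in> carrier G" for n by blast
  obtain n0 where n0: "\<And>z js. admissible f n0 z js \<Longrightarrow> word a z js \<in> V <#> L"
    using a V(1) unfolding summable_mod_def by blast
  have f1: "1 \<le> int (f n)" for n using f[of n] by simp
  \<comment> \<open>From \<open>n0\<close> on the coset has a representative in \<open>V\<close>,
    because \<open>f n \<ge> 1\<close> makes the one-letter word \<open>a n\<close> admissible;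
    below \<open>n0\<close> the element \<open>a n\<close> itself is kept.\<close>
  have "\<exists>x. x \<in> carrier G \<and> inv (a n) \<otimes> x \<in> L \<and> (n0 \<le> n \<longrightarrow> x \<in> V)" for n
  proof (cases "n0 \<le> n")
    case True
    have "admissible f n0 (\<lambda>_. 1) [n]" using True f1 by (simp add: admissible_def)
    from n0[OF this] have "a n \<in> V <#> L" using ac by simp
    then obtain v l where v: "v \<in> V" "l \<in> L" "a n = v \<otimes> l" by (auto simp: set_mult_def)
    note c = Vc[OF v(1)] L.mem_carrier[OF v(2)]
    have "inv (a n) \<otimes> v = inv l" using c v(3) by (simp add: m_assoc inv_mult_group)
    then show ?thesis using c v L.mem_inv[OF v(2)] by auto
  next
    case False
    then show ?thesis using ac[of n] L.mem_one by (intro exI[of _ "a n"]) auto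
  qed
  then obtain a' where a': "\<And>n. a' n \<in> carrier G" "\<And>n. inv (a n) \<otimes> a' n \<in> L" "\<And>n. n0 \<le> n \<Longrightarrow> a' n \<in> V"
    by metis
  have ra': "range a' \<subseteq> carrier G" using a'(1) by blast
  have wL: "word a' z js \<in> W <#> L" if "word a z js \<in> W <#> L" "W \<subseteq> carrier G" for z js W
    using L.set_mult_coset_cong[OF that word_closed[OF ra'] L.coset_cong_word[OF ra ra' a'(2)]] .
  have small: "word a' z js \<in> V <#> L" if "admissible f n0 z js" for z js
    using wL[OF n0[OF that] nhd_carrier[OF V(1)]] .
  \<comment> \<open>Powers are built one factor at a time: each intermediate power is itself an
    admissible word and so lies in \<open>V <#> L\<close>, which is what \<open>closing\<close> asks
    for.\<close>
  have npow: "a' n [^] j \<in> V <#> L'" if "n0 \<le> n" "j \<le> f n" for n and j :: nat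
    using that(2)
  proof (induction j)
    case 0
    then show ?case using VL'[OF V1] by simp
  next
    case (Suc j)
    have "admissible f n0 (\<lambda>_. int (Suc j)) [n]" using Suc that(1) by (simp add: admissible_def)
    from small[OF this] have "a' n [^] Suc j \<in> V <#> L"
      using a'(1)[of n] by (simp add: int_pow_int del: of_nat_Suc nat_pow_Suc)
    then show ?case using closing[of "a' n [^] j" "a' n"] Suc VL'[OF a'(3)[OF that(1)]] by simp
  qed
  have pow: "a' n [^] z \<in> V <#> L'" if "n0 \<le> n" "\<bar>z\<bar> \<le> int (f n)" for n and z :: int
  proof (cases "z < 0")
    case True
    then have "a' n [^] z = inv (a' n [^] nat (- z))" unfolding int_pow_def2[of G _ z] by simp
    then show ?thesis using inverse[OF npow[OF that(1), of "nat (- z)"]] that(2) True by simp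
  next
    case False
    then have "a' n [^] z = a' n [^] nat z" unfolding int_pow_def2[of G _ z] by simp
    then show ?thesis using npow[OF that(1), of "nat z"] that(2) False by simp
  qed
  \<comment> \<open>The same induction for words, one letter at a time, using that every suffix of
    an admissible word is admissible.\<close>
  have small': "word a' z js \<in> V <#> L'" if "admissible f n0 z js" for z js
    using that
  proof (induction js)
    case Nil
    then show ?case using VL'[OF V1] by simp
  next
    case (Cons i js)
    then show ?case using closing[OF pow Cons.IH] small[OF Cons.prems] admissible_Cons[OF Cons.prems] by simp
  qed
  have "summable_mod f L' a'"
    unfolding summable_mod_def
  proof (intro conjI allI impI ra')
    fix U assume U: "nhd U"
    \<comment> \<open>Being in \<open>(U \<inter> V) <#> L\<close> and in \<open>V <#> L'\<close>
      forces membership in \<open>U <#> L'\<close>, by the same comparison as for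
      \<open>closing\<close>.\<close>
    have UV: "nhd (U \<inter> V)" using U V(1) by (rule nhd_Int)
    obtain n1 where n1: "\<And>z js. admissible f n1 z js \<Longrightarrow> word a z js \<in> (U \<inter> V) <#> L"
      using a UV unfolding summable_mod_def by blast
    have "word a' z js \<in> U <#> L'" if "admissible f (max n0 n1) z js" for z js
    proof -
      have "word a' z js \<in> (U \<inter> V) <#> L"
        using that by (intro wL[OF n1] nhd_carrier[OF UV]) (auto intro: admissible_mono)
      then obtain u l where u: "u \<in> U" "u \<in> V" "l \<in> L" "word a' z js = u \<otimes> l" by (auto simp: set_mult_def)
      have "word a' z js \<in> V <#> L'" using that by (intro small') (auto intro: admissible_mono)
      then obtain v l' where v: "v \<in> V" "l' \<in> L'" "word a' z js = v \<otimes> l'" by (auto simp: set_mult_def)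
      note c = Vc[OF u(2)] Vc[OF v(1)] L.mem_carrier[OF u(3)] L'.mem_carrier[OF v(2)]
      define h where "h = inv u \<otimes> v"
      have "inv u \<otimes> v \<otimes> \<one> \<in> V0" using V(3)[OF V(2)[OF u(2)] v(1) V1] .
      then have h0: "h \<in> V0" using c by (simp add: h_def)
      have "u \<otimes> l = v \<otimes> l'" using u v by simp
      then have "inv u \<otimes> (u \<otimes> l) \<otimes> inv l' = inv u \<otimes> (v \<otimes> l') \<otimes> inv l'" by simp
      then have "h = l \<otimes> inv l'" using c by (simp add: h_def m_assoc)
      then have "h \<in> L" using L.mem_mult[OF u(3) L.mem_inv] v(2) sub by blast
      then have h: "h \<in> L'" using h0 V0(2) by blast
      have "word a' z js = u \<otimes> (h \<otimes> l')" using v(3) c by (simp add: h_def m_assoc)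
      then show ?thesis using memI[OF u(1) L'.mem_mult[OF h v(2)]] by simp
    qed
    then show "\<exists>n. \<forall>z js. admissible f n z js \<longrightarrow> word a' z js \<in> U <#> L'" by blast
  qed
  then show ?thesis using a'(2) by blast
qed

end

text \<open>A nonempty finite subfamily of a chain has a least member, so the finite intersection
  property holds.\<close>

lemma compact_space_chain:
  assumes X: "compact_space X" and C: "\<And>A. A \<in> \<C> \<Longrightarrow> closedin X A \<and> A \<noteq> {}"
    and chain: "\<And>A B. A \<in> \<C> \<Longrightarrow> B \<in> \<C> \<Longrightarrow> A \<subseteq> B \<or> B \<subseteq> A" and "\<C> \<noteq> {}"
  shows "\<Inter>\<C> \<noteq> {}"
proof -
  have "\<Inter>\<F> \<noteq> {}" if \<F>: "finite \<F>" "\<F> \<subseteq> \<C>" for \<F>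
  proof (cases "\<F> = {}")
    case False
    from finite_has_minimal[OF \<F>(1) this] obtain M where M: "M \<in> \<F>" "\<And>B. B \<in> \<F> \<Longrightarrow> B \<subseteq> M \<Longrightarrow> M = B"
      by metis
    have "M \<subseteq> B" if "B \<in> \<F>" for B using chain[of M B] M that \<F>(2) by blast
    then have "M \<subseteq> \<Inter>\<F>" by blast
    moreover have "M \<noteq> {}" using C M(1) \<F>(2) by blast
    ultimately show ?thesis by blast
  qed simp
  moreover have "\<forall>A\<in>\<C>. closedin X A" using C by blast
  ultimately have "(\<forall>A\<in>\<C>. closedin X A) \<and> (\<forall>\<F>. finite \<F> \<and> \<F> \<subseteq> \<C> \<longrightarrow> \<Inter>\<F> \<noteq> {})"
    by simp
  then show ?thesis by (rule X[unfolded compact_space_fip, THEN spec, THEN mp])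
qed

section \<open>Lifting in compact groups by Zorn's lemma\<close>

context compact_topological_group
begin

lemma closedin_coset:
  assumes "closedin T L" "b \<in> carrier G"
  shows "closedin T {x \<in> carrier G. inv b \<otimes> x \<in> L}"
proof -
  have "continuous_map T T (\<lambda>x. inv b \<otimes> x)" using assms(2) by (intro continuous_map_mult) auto
  from closedin_preimage[OF this assms(1)] show ?thesis by simp
qed

text \<open>Zorn's lemma is applied to closed normal subgroups \<open>L\<close> of \<open>N\<close> together with a sequence of
  cosets of \<open>L\<close> refining the cosets \<open>a n <# N\<close> and summable modulo \<open>L\<close>.\<close>

lemma summable_lift:
  assumes f: "\<And>n. f n \<noteq> 0" and N: "N \<lhd> G" "closedin T N" and a: "summable_mod f N a"
    and reduce: "\<And>L. L \<lhd> G \<Longrightarrow> closedin T L \<Longrightarrow> L \<subseteq> N \<Longrightarrow> L \<noteq> {\<one>} \<Longrightarrow>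
      \<exists>L' V. L' \<lhd> G \<and> closedin T L' \<and> L' \<subset> L \<and> nhd V \<and> V \<inter> L \<subseteq> L'"
  shows "\<exists>a'. summable_mod f {\<one>} a' \<and> (\<forall>n. inv (a n) \<otimes> a' n \<in> N)"
proof -
  interpret N: normal N G by (rule N(1))
  have ra: "range a \<subseteq> carrier G" using a by (simp add: summable_mod_def)
  then have ac: "a n \<in> carrier G" for n by blast
  define good where "good = (\<lambda>L b. L \<lhd> G \<and> closedin T L \<and> L \<subseteq> N \<and> summable_mod f L b \<and> (\<forall>n. inv (a n) \<otimes> b n \<in> N))"
  define cos where "cos = (\<lambda>L (b :: nat \<Rightarrow> 'a) n. {x \<in> carrier G. inv (b n) \<otimes> x \<in> L})"
  \<comment> \<open>Recording the cosets \<open>cos L b\<close> instead of the representatives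
    \<open>b\<close> makes the order antisymmetric and lets the cosets along a chain be
    intersected.\<close>
  define \<A> where "\<A> = {(L, C). \<exists>b. good L b \<and> C = cos L b}"
  define P where "P = (\<lambda>(L :: 'a set, C :: nat \<Rightarrow> 'a set) (M, D). M \<subseteq> L \<and> (\<forall>n. D n \<subseteq> C n))"
  have goodD: "L \<lhd> G" "closedin T L" "L \<subseteq> N" "summable_mod f L b" "inv (a n) \<otimes> b n \<in> N" "b n \<in> carrier G"
    if "good L b" for L b n
    using that by (auto simp: good_def summable_mod_def)
  have start: "(N, cos N a) \<in> \<A>"
    using N a ac by (auto simp: \<A>_def good_def intro!: exI[of _ a])
  have po: "partial_order_on \<A> (relation_of P \<A>)"
    by (rule partial_order_on_relation_ofI) (fastforce simp: P_def)+
  have "\<exists>m\<in>\<A>. \<forall>x\<in>\<A>. P m x \<longrightarrow> x = m"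
  proof (rule predicate_Zorn[OF po])
    fix \<C> assume "\<C> \<in> Chains (relation_of P \<A>)"
    then have chain: "x \<in> \<A> \<and> (P x y \<or> P y x)" if "x \<in> \<C>" "y \<in> \<C>" for x y
      using that unfolding Chains_def relation_of_def by blast
    show "\<exists>u\<in>\<A>. \<forall>x\<in>\<C>. P x u"
    proof (cases "\<C> = {}")
      case True
      then show ?thesis using start by blast
    next
      case False
      have "\<forall>x\<in>\<C>. \<exists>b. good (fst x) b \<and> snd x = cos (fst x) b"
        using chain unfolding \<A>_def by fastforce
      then obtain b where b: "\<And>x. x \<in> \<C> \<Longrightarrow> good (fst x) (b x)" "\<And>x. x \<in> \<C> \<Longrightarrow> snd x = cos (fst x) (b x)"
        by metis
      have comp: "(fst x \<subseteq> fst y \<and> (\<forall>n. snd x n \<subseteq> snd y n)) \<or> (fst y \<subseteq> fst x \<and> (\<forall>n. snd y n \<subseteq> snd x n))"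
        if "x \<in> \<C>" "y \<in> \<C>" for x y
        using chain[OF that] by (auto simp: P_def split: prod.splits)
      define M where "M = (\<Inter>x\<in>\<C>. fst x)"
      have M: "M \<lhd> G" "closedin T M" "M \<subseteq> N"
      proof -
        have "subgroup M G" unfolding M_def
          using False goodD(1)[OF b(1)] normal_imp_subgroup by (intro subgroups_Inter) auto
        then show "M \<lhd> G"
          unfolding normal_inv_iff M_def using normal_invE(2)[OF goodD(1)[OF b(1)]] by auto
        show "closedin T M"
          unfolding M_def using False goodD(2)[OF b(1)] by (intro closedin_Inter) auto
        obtain x where x: "x \<in> \<C>" using False by blast
        show "M \<subseteq> N" unfolding M_def using goodD(3)[OF b(1)[OF x]] by (rule order_trans[OF INT_lower[OF x]])
      qed
      \<comment> \<open>Compactness gives an element common to all the \<open>n\<close>-th cosets of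
        the chain; it represents a coset of the intersection \<open>M\<close>.\<close>
      have "(\<Inter>x\<in>\<C>. snd x n) \<noteq> {}" for n
      proof (rule compact_space_chain[OF compact])
        fix A assume "A \<in> (\<lambda>x. snd x n) ` \<C>"
        then obtain x where x: "x \<in> \<C>" "A = snd x n" by blast
        have "b x n \<in> A" using b(2)[OF x(1)] x(2) goodD(6)[OF b(1)[OF x(1)]] goodD(1)[OF b(1)[OF x(1)]]
          by (simp add: cos_def normal_imp_subgroup subgroup.one_closed)
        moreover have "closedin T A"
          using closedin_coset[OF goodD(2,6)[OF b(1)[OF x(1)]]] b(2)[OF x(1)] x(2) by (simp add: cos_def)
        ultimately show "closedin T A \<and> A \<noteq> {}" by blast
      next
        fix A B assume "A \<in> (\<lambda>x. snd x n) ` \<C>" "B \<in> (\<lambda>x. snd x n) ` \<C>"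
        then show "A \<subseteq> B \<or> B \<subseteq> A" using comp by fast
      qed (use False in simp)
      then have "\<forall>n. \<exists>c. c \<in> (\<Inter>x\<in>\<C>. snd x n)" by blast
      then obtain c where c: "\<And>n x. x \<in> \<C> \<Longrightarrow> c n \<in> snd x n" by (metis INT_E)
      have cb': "c n \<in> carrier G \<and> inv (b x n) \<otimes> c n \<in> fst x" if "x \<in> \<C>" for n x
        using c[OF that, of n] b(2)[OF that] by (simp add: cos_def)
      then have cc: "c n \<in> carrier G" for n using False by blast
      have cb: "inv (b x n) \<otimes> c n \<in> fst x" if "x \<in> \<C>" for n x using cb'[OF that] by blast
      have rc: "range c \<subseteq> carrier G" using cc by blast
      have sum_x: "summable_mod f (fst x) c" if "x \<in> \<C>" for x
        using summable_mod_cong[OF goodD(1,4)[OF b(1)[OF that]] rc] cb[OF that] by blast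
      have "summable_mod f M c"
        unfolding summable_mod_def
      proof (intro conjI allI impI rc)
        fix U assume U: "nhd U"
        obtain V where V: "nhd V" "\<And>x y z. x \<in> V \<Longrightarrow> y \<in> V \<Longrightarrow> z \<in> V \<Longrightarrow> x \<otimes> y \<otimes> z \<in> U"
          using nhd_cube[OF U] by metis
        have Vc: "v \<in> carrier G" if "v \<in> V" for v using nhd_carrier[OF V(1)] that by blast
        have Mc: "l \<in> carrier G" if "l \<in> M" for l
          using subgroup.mem_carrier[OF normal_imp_subgroup[OF M(1)] that] .
        have VM: "openin T (V <#> M)" using V(1) Mc by (intro openin_set_mult) (auto simp: nhd_def)
        \<comment> \<open>By compactness some group of the chain already lies in the open set
          \<open>V <#> M\<close>. Words that are in \<open>V\<close> modulo this group are then in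
          \<open>U\<close> modulo \<open>M\<close>.\<close>
        have "\<exists>x\<in>\<C>. fst x - (V <#> M) = {}"
        proof (rule ccontr)
          assume none: "\<not> (\<exists>x\<in>\<C>. fst x - (V <#> M) = {})"
          have "\<Inter>((\<lambda>x. fst x - (V <#> M)) ` \<C>) \<noteq> {}"
          proof (rule compact_space_chain[OF compact])
            fix A assume "A \<in> (\<lambda>x. fst x - (V <#> M)) ` \<C>"
            then show "closedin T A \<and> A \<noteq> {}"
              using none goodD(2)[OF b(1)] VM by (auto intro!: closedin_diff)
          next
            fix A B assume "A \<in> (\<lambda>x. fst x - (V <#> M)) ` \<C>" "B \<in> (\<lambda>x. fst x - (V <#> M)) ` \<C>"
            then show "A \<subseteq> B \<or> B \<subseteq> A" using comp by fast
          qed (use False in simp)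
          then obtain y where y: "\<And>x. x \<in> \<C> \<Longrightarrow> y \<in> fst x" "y \<notin> V <#> M" using False by blast
          then have "y \<in> M" by (simp add: M_def)
          then have "\<one> \<otimes> y \<in> V <#> M" using V(1) unfolding set_mult_def nhd_def by blast
          then show False using y(2) Mc[OF \<open>y \<in> M\<close>] by simp
        qed
        then obtain x where x: "x \<in> \<C>" "fst x \<subseteq> V <#> M" by blast
        obtain n where n: "\<And>z js. admissible f n z js \<Longrightarrow> word c z js \<in> V <#> fst x"
          using sum_x[OF x(1)] V(1) unfolding summable_mod_def by blast
        have "word c z js \<in> U <#> M" if adm: "admissible f n z js" for z js
        proof -
          obtain v l where v: "v \<in> V" "l \<in> fst x" "word c z js = v \<otimes> l" using n[OF adm] by (auto simp: set_mult_def)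
          then have "l \<in> V <#> M" using x(2) by blast
          then obtain w m where w: "w \<in> V" "m \<in> M" "l = w \<otimes> m" by (auto simp: set_mult_def)
          have "v \<otimes> w \<otimes> \<one> \<in> U" using V v(1) w(1) by (auto simp: nhd_def)
          then have "v \<otimes> w \<in> U" using Vc v w by simp
          moreover have "word c z js = (v \<otimes> w) \<otimes> m" using v w Vc Mc by (simp add: m_assoc)
          ultimately show ?thesis using w(2) unfolding set_mult_def by blast
        qed
        then show "\<exists>n. \<forall>z js. admissible f n z js \<longrightarrow> word c z js \<in> U <#> M" by blast
      qed
      moreover have "inv (a n) \<otimes> c n \<in> N" for n
      proof -
        obtain x where x: "x \<in> \<C>" using False by blast
        note g = goodD[OF b(1)[OF x]]
        show ?thesis
          using N.coset_cong_trans[OF ac g(6) cc g(5)] cb[OF x] g(3) by blast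
      qed
      ultimately have "good M c" using M by (simp add: good_def)
      then have "(M, cos M c) \<in> \<A>" by (auto simp: \<A>_def)
      moreover have "P x (M, cos M c)" if x: "x \<in> \<C>" for x
      proof -
        note g = goodD[OF b(1)[OF x]]
        interpret X: normal "fst x" G by (rule g(1))
        have "M \<subseteq> fst x" using x by (auto simp: M_def)
        moreover have "cos M c n \<subseteq> snd x n" for n
        proof
          fix y assume "y \<in> cos M c n"
          then have y: "y \<in> carrier G" "inv (c n) \<otimes> y \<in> fst x" using \<open>M \<subseteq> fst x\<close> by (auto simp: cos_def)
          then show "y \<in> snd x n"
            using X.coset_cong_trans[OF g(6) cc y(1) cb[OF x] y(2)] by (simp add: b(2)[OF x] cos_def)
        qed
        ultimately show ?thesis by (simp add: P_def case_prod_unfold)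
      qed
      ultimately show ?thesis by blast
    qed
  qed
  then obtain L b where Lb: "good L b" and max: "\<And>x. x \<in> \<A> \<Longrightarrow> P (L, cos L b) x \<Longrightarrow> x = (L, cos L b)"
    unfolding \<A>_def by blast
  note g = goodD[OF Lb]
  have "L = {\<one>}"
  proof (rule ccontr)
    assume "L \<noteq> {\<one>}"
    from reduce[OF g(1-3) this] obtain L' V where L': "L' \<lhd> G" "closedin T L'" "L' \<subset> L" "nhd V" "V \<inter> L \<subseteq> L'" by blast
    obtain b' where b': "summable_mod f L' b'" "\<And>n. inv (b n) \<otimes> b' n \<in> L"
      using summable_mod_lift_step[OF f g(1) L'(1) _ L'(4,5) g(4)] L'(3) by blast
    have b'c: "b' n \<in> carrier G" for n using b'(1) by (auto simp: summable_mod_def)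
    have "inv (a n) \<otimes> b' n \<in> N" for n
      using N.coset_cong_trans[OF ac g(6) b'c g(5)] b'(2) g(3) by blast
    then have "good L' b'" using L' g(3) b'(1) by (auto simp: good_def)
    then have "(L', cos L' b') \<in> \<A>" by (auto simp: \<A>_def)
    moreover have "P (L, cos L b) (L', cos L' b')"
    proof -
      interpret L: normal L G by (rule g(1))
      have "y \<in> cos L b n" if "y \<in> cos L' b' n" for y n
      proof -
        have y: "y \<in> carrier G" "inv (b' n) \<otimes> y \<in> L" using that L'(3) by (auto simp: cos_def)
        then show ?thesis using L.coset_cong_trans[OF g(6) b'c y(1) b'(2) y(2)] by (simp add: cos_def)
      qed
      then show ?thesis using L'(3) by (auto simp: P_def)
    qed
    ultimately show False using max L'(3) by blast
  qed
  then show ?thesis using g by blast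
qed

text \<open>Separate \<open>\<one>\<close> from another point \<open>p\<close> of \<open>L\<close>
  by a relatively clopen set \<open>Q\<close>, and let \<open>L'\<close> consist of those elements
  of \<open>L\<close> whose conjugates, and the inverses of these, map \<open>Q\<close> into itself
  by left multiplication. As \<open>\<one> \<in> Q\<close>, this group lies in \<open>Q\<close> and
  misses \<open>p\<close>. The tube lemma over the compact set of all pairs \<open>(g, q)\<close>
  makes it relatively open.\<close>

lemma relatively_open_normal_subgroup:
  assumes L: "L \<lhd> G" "closedin T L" "L \<noteq> {\<one>}"
    and td: "\<And>K. connectedin T K \<Longrightarrow> K \<subseteq> L \<Longrightarrow> \<one> \<in> K \<Longrightarrow> K \<subseteq> {\<one>}"
  shows "\<exists>L' V. L' \<lhd> G \<and> closedin T L' \<and> L' \<subset> L \<and> nhd V \<and> V \<inter> L \<subseteq> L'"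
proof -
  interpret L: normal L G by (rule L(1))
  obtain p where p: "p \<in> L" "p \<noteq> \<one>" using L(3) L.mem_one by blast
  let ?X = "subtopology T L"
  have tX: "topspace ?X = L" using L.subset by auto
  have cX: "compact_space ?X" using L(2) compact by (simp add: closedin_compact_space compact_space_subtopology)
  have "Hausdorff_space ?X" using Hausdorff by (rule Hausdorff_space_subtopology)
  \<comment> \<open>In a compact Hausdorff space two points that lie in no common connected set are
    separated by a clopen set.\<close>
  have "separated_between ?X {\<one>} {p}"
  proof (rule cut_wire_fence_theorem_gen)
    show "compact_space ?X" by (rule cX)
    show "disjnt K {\<one>} \<or> disjnt K {p}" if "connectedin ?X K" for K
      using td[of K] that p by (auto simp: connectedin_subtopology disjnt_def)
  qed (use \<open>Hausdorff_space ?X\<close> p L.mem_one tX in \<open>auto simp: closedin_Hausdorff_sing_eq\<close>)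
  then obtain Q R where QR: "openin ?X Q" "openin ?X R" "Q \<union> R = L" "disjnt Q R" "\<one> \<in> Q" "p \<in> R"
    unfolding separated_between_def tX by auto
  obtain S where S: "openin T S" "Q = S \<inter> L" using QR(1) by (auto simp: openin_subtopology)
  have "Q = L - R" using QR(3,4) by (auto simp: disjnt_def)
  then have "closedin ?X Q" using QR(2) tX by (metis closedin_topspace closedin_diff)
  then have Qcl: "closedin T Q" using L(2) closedin_trans_full by blast
  then have Qco: "compactin T Q" using compact closedin_compact_space by blast
  have QL: "Q \<subseteq> L" using S by blast
  have pQ: "p \<notin> Q" using QR(4,6) by (auto simp: disjnt_def)
  have Lc: "l \<in> carrier G" if "l \<in> L" for l using that by (rule L.mem_carrier)
  define L' where "L' = {l \<in> L. \<forall>g\<in>carrier G. \<forall>q\<in>Q. g \<otimes> l \<otimes> inv g \<otimes> q \<in> Q \<and> g \<otimes> inv l \<otimes> inv g \<otimes> q \<in> Q}"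
  have L'D: "l \<in> L" "l \<in> carrier G" "g \<otimes> l \<otimes> inv g \<otimes> q \<in> Q" "g \<otimes> inv l \<otimes> inv g \<otimes> q \<in> Q"
    if "l \<in> L'" "g \<in> carrier G" "q \<in> Q" for l g q
    using that Lc by (auto simp: L'_def)
  have Qc: "q \<in> carrier G" if "q \<in> Q" for q using that QL Lc by blast
  have "subgroup L' G"
  proof (rule subgroupI)
    show "L' \<subseteq> carrier G" using Lc by (auto simp: L'_def)
    have "\<one> \<in> L'" using Qc L.mem_one by (simp add: L'_def)
    then show "L' \<noteq> {}" by blast
    show "inv l \<in> L'" if "l \<in> L'" for l
      using that Lc by (auto simp: L'_def)
    show "l \<otimes> m \<in> L'" if l: "l \<in> L'" and m: "m \<in> L'" for l m
    proof -
      have lc: "l \<in> L" "m \<in> L" "l \<in> carrier G" "m \<in> carrier G" using l m Lc by (auto simp: L'_def)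
      have "g \<otimes> (l \<otimes> m) \<otimes> inv g \<otimes> q \<in> Q" "g \<otimes> inv (l \<otimes> m) \<otimes> inv g \<otimes> q \<in> Q"
        if g: "g \<in> carrier G" and q: "q \<in> Q" for g q
      proof -
        have "g \<otimes> l \<otimes> inv g \<otimes> (g \<otimes> m \<otimes> inv g \<otimes> q) \<in> Q"
          using L'D(3)[OF l g L'D(3)[OF m g q]] .
        then show "g \<otimes> (l \<otimes> m) \<otimes> inv g \<otimes> q \<in> Q" using lc g Qc[OF q] by (simp add: m_assoc)
        have "g \<otimes> inv m \<otimes> inv g \<otimes> (g \<otimes> inv l \<otimes> inv g \<otimes> q) \<in> Q"
          using L'D(4)[OF m g L'D(4)[OF l g q]] .
        then show "g \<otimes> inv (l \<otimes> m) \<otimes> inv g \<otimes> q \<in> Q"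
          using lc g Qc[OF q] by (simp add: m_assoc inv_mult_group)
      qed
      then show ?thesis using lc by (simp add: L'_def)
    qed
  qed
  moreover have "x \<otimes> l \<otimes> inv x \<in> L'" if x: "x \<in> carrier G" and l: "l \<in> L'" for x l
  proof -
    have lc: "l \<in> L" "l \<in> carrier G" using l Lc by (auto simp: L'_def)
    have "g \<otimes> (x \<otimes> l \<otimes> inv x) \<otimes> inv g \<otimes> q \<in> Q" "g \<otimes> inv (x \<otimes> l \<otimes> inv x) \<otimes> inv g \<otimes> q \<in> Q"
      if g: "g \<in> carrier G" and q: "q \<in> Q" for g q
      using L'D(3,4)[OF l m_closed[OF g x] q] lc g x Qc[OF q] by (simp_all add: m_assoc inv_mult_group)
    then show ?thesis using L.inv_op_closed2[OF x lc(1)] by (simp add: L'_def)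
  qed
  ultimately have nL': "L' \<lhd> G" by (simp add: normal_inv_iff)
  have "L' = L \<inter> (\<Inter>g\<in>carrier G. \<Inter>q\<in>Q. {l \<in> carrier G. g \<otimes> l \<otimes> inv g \<otimes> q \<in> Q} \<inter> {l \<in> carrier G. g \<otimes> inv l \<otimes> inv g \<otimes> q \<in> Q})"
    using Lc by (auto simp: L'_def)
  moreover have "closedin T {l \<in> carrier G. g \<otimes> l \<otimes> inv g \<otimes> q \<in> Q}" "closedin T {l \<in> carrier G. g \<otimes> inv l \<otimes> inv g \<otimes> q \<in> Q}"
    if "g \<in> carrier G" "q \<in> Q" for g q
  proof -
    have "continuous_map T T (\<lambda>l. g \<otimes> l \<otimes> inv g \<otimes> q)" "continuous_map T T (\<lambda>l. g \<otimes> inv l \<otimes> inv g \<otimes> q)"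
      using that Qc by (auto intro!: continuous_map_mult continuous_map_inv)
    then show "closedin T {l \<in> carrier G. g \<otimes> l \<otimes> inv g \<otimes> q \<in> Q}" "closedin T {l \<in> carrier G. g \<otimes> inv l \<otimes> inv g \<otimes> q \<in> Q}"
      using closedin_preimage[OF _ Qcl] by fastforce+
  qed
  ultimately have clL': "closedin T L'"
    using L(2) QR(5) by (auto intro!: closedin_Int closedin_INT)
  have "p \<notin> L'"
  proof
    assume "p \<in> L'"
    from L'D(3)[OF this one_closed QR(5)] show False using pQ Lc[OF p(1)] by simp
  qed
  then have "L' \<subset> L" using p(1) by (auto simp: L'_def)
  moreover have "\<exists>V. nhd V \<and> V \<inter> L \<subseteq> L'"
  proof -
    let ?Y = "prod_topology T T"
    let ?m = "\<lambda>p. fst (snd p) \<otimes> fst p \<otimes> inv (fst (snd p)) \<otimes> snd (snd p)"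
    have cm: "continuous_map (prod_topology T ?Y) T ?m"
      by (intro continuous_map_mult continuous_map_inv continuous_map_fst
        continuous_map_compose[OF continuous_map_snd continuous_map_fst, unfolded o_def]
        continuous_map_compose[OF continuous_map_snd continuous_map_snd, unfolded o_def])
    define Z where "Z = {p \<in> topspace (prod_topology T ?Y). ?m p \<in> S}"
    have Z: "openin (prod_topology T ?Y) Z" unfolding Z_def by (rule openin_preimage[OF cm S(1)])
    have "compactin ?Y (carrier G \<times> Q)"
      using compact Qco by (simp add: compactin_Times compact_space_def)
    moreover have "{\<one>} \<times> (carrier G \<times> Q) \<subseteq> Z" using S(2) Qc by (auto simp: Z_def)
    ultimately obtain W W' where W: "openin T W" "\<one> \<in> W" "carrier G \<times> Q \<subseteq> W'" "W \<times> W' \<subseteq> Z"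
      using tube_lemma_right[OF Z] by (metis one_closed topspace)
    have inS: "g \<otimes> w \<otimes> inv g \<otimes> q \<in> S" if "w \<in> W" "g \<in> carrier G" "q \<in> Q" for w g q
    proof -
      have "(w, g, q) \<in> Z" using W that by blast
      then show ?thesis by (simp add: Z_def)
    qed
    define V where "V = W \<inter> {x \<in> carrier G. inv x \<in> W}"
    have "nhd V" unfolding V_def
      using W by (intro nhd_Int nhd_preimage_one continuous_inv) (auto simp: nhd_def)
    moreover have "V \<inter> L \<subseteq> L'"
    proof
      fix l assume "l \<in> V \<inter> L"
      then have l: "l \<in> W" "inv l \<in> W" "l \<in> L" by (auto simp: V_def)
      have "g \<otimes> l \<otimes> inv g \<otimes> q \<in> Q" "g \<otimes> inv l \<otimes> inv g \<otimes> q \<in> Q" if g: "g \<in> carrier G" and q: "q \<in> Q" for g q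
      proof -
        have "g \<otimes> l \<otimes> inv g \<otimes> q \<in> L" "g \<otimes> inv l \<otimes> inv g \<otimes> q \<in> L"
          using L.mem_mult[OF L.inv_op_closed2[OF g l(3)]] L.mem_mult[OF L.inv_op_closed2[OF g L.mem_inv[OF l(3)]]]
            q QL by auto
        then show "g \<otimes> l \<otimes> inv g \<otimes> q \<in> Q" "g \<otimes> inv l \<otimes> inv g \<otimes> q \<in> Q"
          using inS[OF l(1) g q] inS[OF l(2) g q] S(2) by auto
      qed
      then show "l \<in> L'" using l(3) by (simp add: L'_def)
    qed
    ultimately show ?thesis by blast
  qed
  ultimately show ?thesis using nL' clL' by blast
qed

theorem totally_disconnected_lift:
  assumes "\<And>n. f n \<noteq> 0" "N \<lhd> G" "closedin T N" "summable_mod f N a"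
    and "\<And>K. connectedin T K \<Longrightarrow> K \<subseteq> N \<Longrightarrow> \<one> \<in> K \<Longrightarrow> K \<subseteq> {\<one>}"
  shows "\<exists>a'. summable_mod f {\<one>} a' \<and> (\<forall>n. inv (a n) \<otimes> a' n \<in> N)"
  using assms by (intro summable_lift relatively_open_normal_subgroup) auto

end

section \<open>Characters onto the circle\<close>

lemma countable_roots_of_unity: "countable {z :: complex. \<exists>m>0. z ^ m = 1}"
proof -
  have "{z :: complex. \<exists>m>0. z ^ m = 1} = (\<Union>m\<in>{0<..}. {z. z ^ m = 1})" by auto
  moreover have "finite {z :: complex. z ^ m = 1}" if "m > 0" for m :: nat
    using finite_roots_unity[of m] that by simp
  ultimately show ?thesis by (auto intro!: countable_UN intro: countable_finite)
qed

section \<open>Eigenfunctions that detect a given element\<close>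

context compact_topological_group
begin

lemma normal_T: "normal_space T"
  using compact_Hausdorff_or_regular_imp_normal_space[OF compact] Hausdorff by blast

lemma closedin_point: "x \<in> carrier G \<Longrightarrow> closedin T {x}"
  using Hausdorff by (simp add: closedin_Hausdorff_sing_eq)

text \<open>The kernel is a symmetrized Urysohn function that vanishes outside a symmetric set on
  which \<open>g\<close> is positive. Its purpose is to make the convolution of \<open>g\<close>
  positive at \<open>\<one>\<close>, so that the operator does not annihilate
  \<open>g\<close>.\<close>

lemma convolution_kernel_at_one:
  assumes g: "cont g" "g \<one> > 0"
  shows "\<exists>k. convolution_kernel G T k \<and> (\<forall>y\<in>carrier G. 0 \<le> k y * g y) \<and> k \<one> > 0"
proof -
  define W where "W = {x \<in> carrier G. g x > 0}"
  have "openin T {x \<in> topspace T. g x \<in> {0<..}}"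
    by (rule openin_continuous_map_preimage[OF g(1)]) simp
  then have W: "nhd W" using g(2) by (simp add: nhd_def W_def)
  define U where "U = W \<inter> {x \<in> carrier G. inv x \<in> W}"
  have U: "nhd U" unfolding U_def using W by (intro nhd_Int nhd_preimage_one continuous_inv) auto
  then have "closedin T (carrier G - U)" by (simp add: nhd_def closedin_def Diff_Diff_Int Int_absorb1 openin_carrier)
  moreover have "disjnt (carrier G - U) {\<one>}" using U by (simp add: disjnt_def nhd_def)
  ultimately obtain k0 where k0: "continuous_map T (top_of_set {0..1::real}) k0"
    "k0 ` (carrier G - U) \<subseteq> {0}" "k0 ` {\<one>} \<subseteq> {1}"
    using Urysohn_lemma[OF normal_T _ closedin_one, of "carrier G - U" 0 1] by auto
  have k0c: "cont k0" using k0(1) continuous_map_in_subtopology by blast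
  have k0n: "0 \<le> k0 x" if "x \<in> carrier G" for x
    using continuous_map_image_subset_topspace[OF k0(1)] that by auto
  define k where "k = (\<lambda>x. k0 x + k0 (inv x))"
  have "convolution_kernel G T k"
  proof
    show "cont k" unfolding k_def by (intro continuous_map_add k0c cont_inv)
    show "k (inv x) = k x" if "x \<in> carrier G" for x using that by (simp add: k_def)
  qed
  moreover have "0 \<le> k y * g y" if y: "y \<in> carrier G" for y
  proof (cases "y \<in> U")
    case True
    then show ?thesis using k0n y by (auto simp: U_def W_def k_def)
  next
    case False
    then have "inv y \<notin> U" using y by (auto simp: U_def)
    then have "k y = 0" using False y k0(2) by (auto simp: k_def image_subset_iff)
    then show ?thesis by simp
  qed
  moreover have "k \<one> > 0" using k0(3) by (simp add: k_def)
  ultimately show ?thesis by blast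
qed

text \<open>A function of the form \<open>f - f (x0 \<otimes> _)\<close> is orthogonal to all translation invariant ones, and
  so are its iterates under convolution and their limit.\<close>

lemma non_invariant_eigenfunction:
  assumes x0: "x0 \<in> carrier G" "x0 \<noteq> \<one>"
  shows "\<exists>k w l. convolution_kernel G T k \<and> l > 0 \<and> w \<in> convolution_kernel.eigenspace G T k l \<and>
    (\<exists>z\<in>carrier G. w (x0 \<otimes> z) \<noteq> w z)"
proof -
  have "disjnt {x0} {\<one>}" using x0 by simp
  then obtain f where f: "cont f" "f x0 = 0" "f \<one> = 1"
    using Urysohn_lemma_alt[OF normal_T closedin_point[OF x0(1)] closedin_one, of 0 1] by auto
  define g where "g = (\<lambda>x. f x - f (x0 \<otimes> x))"
  have gc: "cont g" unfolding g_def by (intro continuous_map_diff f cont_ltranslate x0)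
  have g1: "g \<one> = 1" using f x0 by (simp add: g_def)
  obtain k where k: "convolution_kernel G T k" "\<And>y. y \<in> carrier G \<Longrightarrow> 0 \<le> k y * g y" "k \<one> > 0"
    using convolution_kernel_at_one[OF gc] g1 by auto
  interpret convolution_kernel G T k by (rule k(1))
  have "0 < mean (\<lambda>y. k y * g y)"
    using k g1 by (intro mean_pos[where x = \<one>] cont_mult k_cont gc) auto
  also have "mean (\<lambda>y. k y * g y) = conv g \<one>" unfolding conv_def ip_def by (rule mean_cong) simp
  finally have "0 < conv g \<one>" .
  then have "0 < ip (conv g) (conv g)"
    unfolding ip_def by (intro mean_pos[where x = \<one>] cont_mult conv_cont gc) auto
  from eigenfunction_exists[OF gc this] obtain w l where w: "l > 0" "cont w" "ip w w = l"
    "\<And>x. x \<in> carrier G \<Longrightarrow> conv (conv w) x = l * w x"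
    "\<And>u. cont u \<Longrightarrow> (\<And>j. ip ((conv ^^ j) g) u = 0) \<Longrightarrow> ip w u = 0" by blast
  have "\<exists>z\<in>carrier G. w (x0 \<otimes> z) \<noteq> w z"
  proof (rule ccontr)
    assume "\<not> (\<exists>z\<in>carrier G. w (x0 \<otimes> z) \<noteq> w z)"
    then have inv: "w (x0 \<otimes> z) = w z" if "z \<in> carrier G" for z using that by blast
    have inv_j: "(conv ^^ j) w (x0 \<otimes> z) = (conv ^^ j) w z" if "z \<in> carrier G" for z j
      using that
    proof (induction j arbitrary: z)
      case (Suc j)
      have "conv ((conv ^^ j) w) (x0 \<otimes> z) = conv (\<lambda>y. (conv ^^ j) w (x0 \<otimes> y)) z"
        using conv_ltranslate[OF conv_power_cont[OF w(2)] x0(1) Suc.prems] by simp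
      also have "\<dots> = conv ((conv ^^ j) w) z" by (rule conv_cong) (rule Suc.IH)
      finally show ?case by simp
    qed (use inv in simp)
    \<comment> \<open>Self-adjointness moves the iterates from \<open>g\<close> to \<open>w\<close>,
      where they are invariant under \<open>x0\<close> and so do not distinguish \<open>f\<close>
      from its translate. Then \<open>w\<close> would be orthogonal to itself, although
      \<open>ip w w = l > 0\<close>.\<close>
    have "ip ((conv ^^ j) g) w = 0" for j
    proof -
      let ?u = "(conv ^^ j) w"
      have u: "cont ?u" by (rule conv_power_cont[OF w(2)])
      have "ip ((conv ^^ j) g) w = ip g ?u" by (rule conv_power_symmetric[OF gc w(2)])
      also have "\<dots> = ip f ?u - ip (\<lambda>x. f (x0 \<otimes> x)) ?u"
        unfolding g_def by (intro ip_diff f u cont_ltranslate x0)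
      also have "ip (\<lambda>x. f (x0 \<otimes> x)) ?u = ip (\<lambda>x. f (x0 \<otimes> x)) (\<lambda>x. ?u (x0 \<otimes> x))"
        by (rule ip_cong) (simp_all add: inv_j)
      also have "\<dots> = ip f ?u" by (rule ip_ltranslate[OF f(1) u x0(1)])
      finally show ?thesis by simp
    qed
    then show False using w by force
  qed
  moreover have "w \<in> eigenspace l" using w by (simp add: eigenspace_def)
  ultimately show ?thesis using k(1) w(1) by blast
qed

text \<open>The trace of translation on an eigenspace is a continuous real function that equals
  \<open>n\<close> at \<open>\<one>\<close> but not at \<open>x0\<close>. On the connected set
  \<open>K\<close> it takes uncountably many values, whereas the finite sums of roots of unity are
  countable. Neither \<open>x\<close> nor its eigenvalue \<open>c\<close> depends on
  \<open>y\<close>; only the common eigenfunction does, so that \<open>y\<close> can later be chosen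
  in terms of \<open>c\<close>.\<close>

lemma connected_eigenfunction:
  assumes K: "connectedin T K" "\<one> \<in> K" "x0 \<in> K" "x0 \<noteq> \<one>"
  shows "\<exists>x\<in>K. \<exists>c::complex. (\<forall>m>0. c ^ m \<noteq> 1) \<and>
    (\<forall>y\<in>carrier G. x \<otimes> y = y \<otimes> x \<longrightarrow> (\<exists>(w :: 'a \<Rightarrow> complex) d. continuous_map T euclidean w \<and>
      (\<exists>z\<in>carrier G. w z \<noteq> 0) \<and> (\<forall>z\<in>carrier G. w (x \<otimes> z) = c * w z \<and> w (y \<otimes> z) = d * w z)))"
proof -
  have Kc: "K \<subseteq> carrier G" using connectedin_subset_topspace[OF K(1)] by simp
  have x0: "x0 \<in> carrier G" using K(3) Kc by blast
  obtain k w l where k: "convolution_kernel G T k" and l: "l > 0"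
    and w: "w \<in> convolution_kernel.eigenspace G T k l" "\<exists>z\<in>carrier G. w (x0 \<otimes> z) \<noteq> w z"
    using non_invariant_eigenfunction[OF x0 K(4)] by blast
  interpret convolution_kernel G T k by (rule k)
  from eigenspace_basis[OF l] obtain n :: nat and e where basis: "(\<forall>i<n. e i \<in> eigenspace l) \<and>
    (\<forall>i<n. \<forall>j<n. ip (e i) (e j) = (if i = j then 1 else 0)) \<and>
    (\<forall>f\<in>eigenspace l. \<forall>x\<in>carrier G. f x = (\<Sum>i<n. ip f (e i) * e i x))"
    by (elim exE) (rule that, assumption)
  then have e: "\<And>i. i < n \<Longrightarrow> e i \<in> eigenspace l"
    and on: "\<And>i j. i < n \<Longrightarrow> j < n \<Longrightarrow> ip (e i) (e j) = (if i = j then 1 else 0)"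
    and span: "\<And>f x. f \<in> eigenspace l \<Longrightarrow> x \<in> carrier G \<Longrightarrow> f x = (\<Sum>i<n. ip f (e i) * e i x)"
    by simp_all
  have ec: "cont (e i)" if "i < n" for i using e[OF that] by (simp add: eigenspace_def)
  \<comment> \<open>\<open>A x\<close> is the matrix of left translation by \<open>x\<close> in the
    basis \<open>e\<close>. It reverses products, as \<open>mult\<close> shows, but commuting
    elements still have commuting matrices.\<close>
  define A where "A = (\<lambda>x i j. ip (\<lambda>z. e j (x \<otimes> z)) (e i))"
  have tr_c: "cont (\<lambda>z. e j (x \<otimes> z))" if "x \<in> carrier G" "j < n" for x j
    by (intro cont_ltranslate ec that)
  have expand: "e j (x \<otimes> z) = (\<Sum>i<n. A x i j * e i z)" if "x \<in> carrier G" "j < n" "z \<in> carrier G" for x j z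
    unfolding A_def using span[OF eigenspace_ltranslate[OF e that(1)] that(3)] that(2) by blast
  have coeff: "ip (\<lambda>z. \<Sum>j<n. b j * e j z) (e i) = b i" if "i < n" for i b
  proof -
    have "ip (\<lambda>z. \<Sum>j<n. b j * e j z) (e i) = (\<Sum>j<n. ip (\<lambda>z. b j * e j z) (e i))"
      using ec that by (intro ip_sum) (auto intro!: continuous_map_real_mult)
    also have "\<dots> = (\<Sum>j<n. if j = i then b j else 0)"
      using ec that on by (intro sum.cong refl) (simp add: ip_scale)
    also have "\<dots> = b i" using that by simp
    finally show ?thesis .
  qed
  have mult: "(\<Sum>m<n. A x i m * A y m j) = ip (\<lambda>z. e j (y \<otimes> (x \<otimes> z))) (e i)"
    if xy: "x \<in> carrier G" "y \<in> carrier G" and ij: "i < n" "j < n" for x y i j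
  proof -
    have "ip (\<lambda>z. e j (y \<otimes> (x \<otimes> z))) (e i) = ip (\<lambda>z. \<Sum>m<n. A y m j * e m (x \<otimes> z)) (e i)"
      using xy ij by (intro ip_cong expand) auto
    also have "\<dots> = (\<Sum>m<n. ip (\<lambda>z. A y m j * e m (x \<otimes> z)) (e i))"
      using xy ij tr_c ec by (intro ip_sum) (auto intro!: continuous_map_real_mult)
    also have "\<dots> = (\<Sum>m<n. A x i m * A y m j)"
    proof (intro sum.cong refl)
      fix m assume "m \<in> {..<n}"
      then have "ip (\<lambda>z. A y m j * e m (x \<otimes> z)) (e i) = A y m j * ip (\<lambda>z. e m (x \<otimes> z)) (e i)"
        using xy ij by (intro ip_scale tr_c ec) auto
      then show "ip (\<lambda>z. A y m j * e m (x \<otimes> z)) (e i) = A x i m * A y m j"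
        by (simp only: A_def mult.commute)
    qed
    finally show ?thesis by simp
  qed
  define t where "t = (\<lambda>x. \<Sum>i<n. A x i i)"
  have t_cont: "cont t"
  proof -
    have "cont (\<lambda>x. A x i i)" if "i < n" for i
    proof -
      have "cont2 (\<lambda>(x, z). e i (x \<otimes> z) * e i z)"
        using cont_mult2[OF ec[OF that]] continuous_map_compose[OF continuous_map_snd ec[OF that], of T]
        by (simp add: o_def case_prod_unfold continuous_map_real_mult)
      from mean_cont[OF this] show ?thesis by (simp add: A_def ip_def)
    qed
    then show ?thesis unfolding t_def by (intro continuous_map_sum) auto
  qed
  have t1: "t \<one> = real n"
  proof -
    have "A \<one> i i = 1" if "i < n" for i
      unfolding A_def using ip_cong[of "\<lambda>z. e i (\<one> \<otimes> z)" "e i" "e i" "e i"] on[OF that that] by simp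
    then show ?thesis by (simp add: t_def)
  qed
  \<comment> \<open>Translations preserve norms, so the diagonal entries are at most 1 and trace
    \<open>n\<close> forces all of them to be 1. By equality in Cauchy-Schwarz each
    \<open>e i\<close> would be invariant under \<open>x0\<close>, and with them
    \<open>w\<close>.\<close>
  have tx0: "t x0 \<noteq> real n"
  proof
    assume eq: "t x0 = real n"
    have norm: "ip (\<lambda>z. e i (x0 \<otimes> z)) (\<lambda>z. e i (x0 \<otimes> z)) = 1" if "i < n" for i
      using ip_ltranslate[OF ec ec x0] on that by simp
    have le: "A x0 i i \<le> 1" if "i < n" for i
    proof -
      have "(A x0 i i)\<^sup>2 \<le> 1"
        using ip_Cauchy_Schwarz[OF tr_c ec, OF x0 that that] norm[OF that] on[OF that that] by (simp add: A_def)
      then show ?thesis using abs_square_le_1[of "A x0 i i"] by linarith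
    qed
    have "(\<Sum>i<n. 1 - A x0 i i) = 0" using eq by (simp add: t_def sum_subtractf)
    then have A1: "A x0 i i = 1" if "i < n" for i
      using le that by (subst (asm) sum_nonneg_eq_0_iff) auto
    have fix_e: "e i (x0 \<otimes> z) = e i z" if i: "i < n" and z: "z \<in> carrier G" for i z
    proof -
      define d where "d = (\<lambda>z. e i (x0 \<otimes> z) - e i z)"
      have dc: "cont d" unfolding d_def by (intro continuous_map_diff tr_c x0 i ec)
      have "ip d d = ip (\<lambda>z. e i (x0 \<otimes> z)) d - ip (e i) d"
        using ip_diff[OF tr_c[OF x0 i] ec[OF i] dc] by (simp add: d_def)
      also have "ip (\<lambda>z. e i (x0 \<otimes> z)) d = ip d (\<lambda>z. e i (x0 \<otimes> z))" by (rule ip_commute)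
      also have "\<dots> = 1 - 1"
        using ip_diff[OF tr_c[OF x0 i] ec[OF i] tr_c[OF x0 i]] norm[OF i] A1[OF i]
          ip_commute[of "e i" "\<lambda>z. e i (x0 \<otimes> z)"] by (simp add: d_def A_def)
      also have "ip (e i) d = ip d (e i)" by (rule ip_commute)
      also have "\<dots> = 1 - 1"
        using ip_diff[OF tr_c[OF x0 i] ec[OF i] ec[OF i]] on[OF i i] A1[OF i] by (simp add: d_def A_def)
      finally have "d z = 0" using ip_eq_0[OF dc _ z] by simp
      then show ?thesis by (simp add: d_def)
    qed
    have "w (x0 \<otimes> z) = w z" if z: "z \<in> carrier G" for z
      using span[OF w(1), of "x0 \<otimes> z"] span[OF w(1) z] fix_e z x0 by simp
    then show False using w(2) by blast
  qed
  define R where "R = {z :: complex. \<exists>m>0. z ^ m = 1}"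
  have "connectedin euclideanreal (t ` K)" by (rule connectedin_continuous_map_image[OF t_cont K(1)])
  then have "connected (t ` K)" by simp
  then have unc: "uncountable (t ` K)"
    by (rule connected_uncountable[OF _ imageI[OF K(2)] imageI[OF K(3)]]) (use t1 tx0 in simp)
  have "countable (sum_list ` lists R)"
    using countable_roots_of_unity unfolding R_def by (intro countable_image countable_lists)
  then have cnt: "countable {r \<in> UNIV. complex_of_real r \<in> sum_list ` lists R}"
    by (intro countable_image_inj_gen) (auto simp: inj_on_def)
  have "\<not> t ` K \<subseteq> {r \<in> UNIV. complex_of_real r \<in> sum_list ` lists R}"
    using unc countable_subset[OF _ cnt] by blast
  then obtain x where x: "x \<in> K" "complex_of_real (t x) \<notin> sum_list ` lists R" by blast
  have xc: "x \<in> carrier G" using x Kc by blast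
  define B where "B = (\<lambda>y i j. complex_of_real (A y i j))"
  from trace_eq_sum_eigenvalues[of "B x" n] obtain es where es1: "(\<Sum>i<n. B x i i) = sum_list es"
    and es: "\<forall>c\<in>set es. \<exists>v. (\<exists>i<n. v i \<noteq> 0) \<and> (\<forall>i<n. (\<Sum>j<n. B x i j * v j) = c * v i)"
    by (elim exE conjE) (rule that)
  have "(\<Sum>i<n. B x i i) = complex_of_real (t x)" by (simp add: B_def t_def)
  then have "es \<notin> lists R" using x(2) es1 by (metis imageI)
  then obtain c where c: "c \<in> set es" "c \<notin> R" by auto
  obtain v where v: "\<exists>i<n. v i \<noteq> 0" "\<And>i. i < n \<Longrightarrow> (\<Sum>j<n. B x i j * v j) = c * v i"
    using bspec[OF es c(1)] by blast
  have "\<exists>(w :: 'a \<Rightarrow> complex) d. continuous_map T euclidean w \<and>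
      (\<exists>z\<in>carrier G. w z \<noteq> 0) \<and> (\<forall>z\<in>carrier G. w (x \<otimes> z) = c * w z \<and> w (y \<otimes> z) = d * w z)"
    if y: "y \<in> carrier G" and comm: "x \<otimes> y = y \<otimes> x" for y
  proof -
    have "(\<Sum>m<n. B x i m * B y m j) = (\<Sum>m<n. B y i m * B x m j)" if ij: "i < n" "j < n" for i j
    proof -
      have "(\<Sum>m<n. A x i m * A y m j) = (\<Sum>m<n. A y i m * A x m j)"
        unfolding mult[OF xc y ij] mult[OF y xc ij]
        using comm xc y by (intro ip_cong refl) (simp add: m_assoc[symmetric])
      then show ?thesis unfolding B_def of_real_mult[symmetric] of_real_sum[symmetric] by simp
    qed
    from common_eigenvector[OF this v] obtain b d where b: "\<exists>i<n. b i \<noteq> 0"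
      "\<And>i. i < n \<Longrightarrow> (\<Sum>j<n. B x i j * b j) = c * b i" "\<And>i. i < n \<Longrightarrow> (\<Sum>j<n. B y i j * b j) = d * b i" by blast
    define u where "u = (\<lambda>z. \<Sum>j<n. b j * complex_of_real (e j z))"
    have "continuous_map T euclidean (\<lambda>z. b j * complex_of_real (e j z))" if "j < n" for j
    proof -
      have "continuous_map euclideanreal euclidean (\<lambda>r. b j * complex_of_real r)"
        by (auto intro!: continuous_intros)
      from continuous_map_compose[OF ec[OF that] this] show ?thesis by (simp add: o_def)
    qed
    then have uc: "continuous_map T euclidean u" unfolding u_def by (intro continuous_map_sum) auto
    have act: "u (g \<otimes> z) = a * u z"
      if g: "g \<in> carrier G" and z: "z \<in> carrier G" and a: "\<And>i. i < n \<Longrightarrow> (\<Sum>j<n. B g i j * b j) = a * b i" for g z a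
    proof -
      have "u (g \<otimes> z) = (\<Sum>j<n. b j * (\<Sum>i<n. B g i j * complex_of_real (e i z)))"
        unfolding u_def by (intro sum.cong refl) (simp add: expand[OF g _ z] B_def)
      also have "\<dots> = (\<Sum>i<n. (\<Sum>j<n. B g i j * b j) * complex_of_real (e i z))"
        unfolding sum_distrib_left sum_distrib_right by (subst sum.swap) (simp add: mult_ac)
      also have "\<dots> = a * u z" unfolding u_def sum_distrib_left by (intro sum.cong refl) (simp add: a)
      finally show ?thesis .
    qed
    have "\<exists>z\<in>carrier G. u z \<noteq> 0"
    proof (rule ccontr)
      assume "\<not> (\<exists>z\<in>carrier G. u z \<noteq> 0)"
      then have 0: "u z = 0" if "z \<in> carrier G" for z using that by blast
      \<comment> \<open>The basis is real and the coefficients are complex: real and imaginary parts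
        are recovered separately by \<open>coeff\<close>, so a nonzero coefficient vector gives a
        nonzero function.\<close>
      have "(\<Sum>j<n. Re (b j) * e j z) = 0" "(\<Sum>j<n. Im (b j) * e j z) = 0" if "z \<in> carrier G" for z
        using arg_cong[OF 0[OF that], of Re] arg_cong[OF 0[OF that], of Im] by (simp_all add: u_def)
      then have "ip (\<lambda>z. \<Sum>j<n. Re (b j) * e j z) (e i) = ip (\<lambda>z. 0) (e i)"
        "ip (\<lambda>z. \<Sum>j<n. Im (b j) * e j z) (e i) = ip (\<lambda>z. 0) (e i)" for i
        by (intro ip_cong refl; simp)+
      then have "Re (b i) = 0" "Im (b i) = 0" if "i < n" for i
        using coeff[OF that, of "\<lambda>j. Re (b j)"] coeff[OF that, of "\<lambda>j. Im (b j)"] by (simp_all add: ip_def)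
      then show False using b(1) by (auto simp: complex_eq_iff)
    qed
    then show ?thesis using uc act[OF xc _ b(2)] act[OF y _ b(3)] by blast
  qed
  then show ?thesis using x(1) c(2) unfolding R_def by blast
qed

end

text \<open>The argument of \<open>c\<close> is an irrational multiple of \<open>2 * pi\<close>, so
  density of fractional parts makes the powers of \<open>c\<close> dense in the circle.\<close>

lemma sphere_subset_closed_powers:
  fixes c :: complex
  assumes "closed C" "norm c = 1" "\<And>m. m > 0 \<Longrightarrow> c ^ m \<noteq> 1" "\<And>n. c ^ n \<in> C"
  shows "sphere 0 1 \<subseteq> C"
proof
  have polar: "z = cis (Arg z)" if "norm z = 1" for z
    using rcis_cmod_Arg[of z] that by (simp add: rcis_def)
  fix t :: complex assume "t \<in> sphere 0 1"
  then obtain s where s: "t = cis s" using polar[of t] by auto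
  obtain r where r: "c = cis r" using polar[OF assms(2)] by blast
  define \<theta> where "\<theta> = r / (2 * pi)"
  define \<alpha> where "\<alpha> = s / (2 * pi)"
  have r': "r = 2 * pi * \<theta>" and s': "s = 2 * pi * \<alpha>" by (simp_all add: \<theta>_def \<alpha>_def)
  have "\<theta> \<notin> \<rat>"
  proof
    assume "\<theta> \<in> \<rat>"
    then obtain p q where q: "q > 0" "\<theta> = of_int p / of_int q" by (rule Rats_cases')
    have "real (nat q) * r = 2 * pi * of_int p" using q by (simp add: r' field_simps)
    then have "c ^ nat q = cis (2 * pi * of_int p)" using Complex.DeMoivre[of r "nat q"] by (simp only: r)
    also have "\<dots> = 1" by (simp add: cis_multiple_2pi)
    finally show False using assms(3)[of "nat q"] q by simp
  qed
  note irr = this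
  have "t \<in> closure C"
    unfolding closure_approachable
  proof (intro allI impI)
    fix e :: real assume "e > 0"
    have "isCont cis s" using continuous_on_cis[OF continuous_on_id, of UNIV]
      by (simp add: continuous_on_eq_continuous_at)
    then obtain d where d: "d > 0" "\<And>x. dist x s < d \<Longrightarrow> dist (cis x) (cis s) < e"
      using \<open>e > 0\<close> unfolding continuous_at_eps_delta by blast
    have "d / (2 * pi) > 0" using d by simp
    from sequence_of_fractional_parts_is_dense[OF irr this, of \<alpha>] obtain h k where
      hk: "k > 0" "\<bar>of_int k * \<theta> - of_int h - \<alpha>\<bar> < d / (2 * pi)" by blast
    define x where "x = 2 * pi * (of_int k * \<theta> - of_int h)"
    have "x - s = 2 * pi * (of_int k * \<theta> - of_int h - \<alpha>)" by (simp add: x_def s' algebra_simps)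
    then have "\<bar>x - s\<bar> = 2 * pi * \<bar>of_int k * \<theta> - of_int h - \<alpha>\<bar>" by (simp add: abs_mult)
    also have "\<dots> < 2 * pi * (d / (2 * pi))" using hk(2) by (intro mult_strict_left_mono) auto
    finally have "dist x s < d" by (simp add: dist_real_def)
    from d(2)[OF this] have "dist (cis x) t < e" by (simp add: s)
    moreover have "cis x = c ^ nat k"
    proof -
      have "real (nat k) * r = x + 2 * pi * of_int h" using hk(1) by (simp add: x_def r' algebra_simps)
      then have "c ^ nat k = cis x * cis (2 * pi * of_int h)" using Complex.DeMoivre[of r "nat k"] by (simp only: r cis_mult)
      then show ?thesis by (simp add: cis_multiple_2pi)
    qed
    ultimately show "\<exists>y\<in>C. dist y t < e" using assms(4) by metis
  qed
  then show "t \<in> C" using assms(1) by simp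
qed

lemma subgroup_compact_topological_group:
  assumes "compact_topological_group G T" "subgroup H G" "closedin T H"
  shows "compact_topological_group (G\<lparr>carrier := H\<rparr>) (subtopology T H)"
proof -
  interpret compact_topological_group G T by (rule assms(1))
  interpret H: hausdorff_topological_group "G\<lparr>carrier := H\<rparr>" "subtopology T H"
    by (rule subgroup_topological_group[OF assms(2)])
  show ?thesis
    by unfold_locales (use assms(3) compact in \<open>simp add: closedin_compact_space compact_space_subtopology\<close>)
qed

section \<open>Characters of closed subgroups\<close>

context compact_topological_group
begin

lemma chain_imp_unconditionally_f_productive:
  assumes f: "\<And>n. f n \<noteq> 0" and V: "nhd_chain V" and L: "(\<Inter>n. V n) \<lhd> G"
    and td: "\<And>K. connectedin T K \<Longrightarrow> K \<subseteq> (\<Inter>n. V n) \<Longrightarrow> \<one> \<in> K \<Longrightarrow> K \<subseteq> {\<one>}"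
  shows "\<exists>a. unconditionally_f_productive G T f a"
proof -
  let ?L = "\<Inter>n. V n"
  interpret L: normal ?L G by (rule L)
  have "compactin T (carrier G)" using compact by (simp add: compact_space_def)
  from summable_mod_exists[OF V this nhd_chainD(3)[OF V] refl, of f] obtain a where
    a: "summable_mod f ?L a" "\<And>m n. m < n \<Longrightarrow> inv (a m) \<otimes> a n \<notin> ?L" by blast
  from totally_disconnected_lift[OF f L closedin_Inter_chain[OF V] a(1) td] obtain a' where
    a': "summable_mod f {\<one>} a'" "\<And>n. inv (a n) \<otimes> a' n \<in> ?L" by blast
  have ac: "a n \<in> carrier G" "a' n \<in> carrier G" for n
    using a(1) a'(1) by (auto simp: summable_mod_def)
  \<comment> \<open>Equal lifts would put two of the original elements into the same coset.\<close>
  have "a' m \<noteq> a' n" if "m < n" for m n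
  proof
    assume "a' m = a' n"
    then have "inv (a m) \<otimes> a n \<in> ?L"
      using L.coset_cong_trans[OF ac(1) ac(2) ac(1) a'(2)[of m], of n]
        L.coset_cong_sym[OF ac a'(2)[of n]] by simp
    then show False using a(2)[OF that] by simp
  qed
  then have "inj a'" by (metis injI linorder_neq_iff)
  then show ?thesis
    using summable_imp_unconditionally_f_productive[OF compact_imp_locally_compact_space[OF compact] a'(1)] by blast
qed

text \<open>\<open>D\<close> consists of the elements that preserve the line spanned by
  \<open>w\<close>, and \<open>\<psi>\<close> is the factor by which they act. Evaluation at
  \<open>z0\<close> defines \<open>\<psi>\<close> continuously on the whole group, but it is
  multiplicative only on \<open>D\<close>. Values have modulus 1 because
  \<open>\<psi> b ^ n * w z0\<close> is a value of the bounded function \<open>w\<close>, for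
  \<open>b\<close> as well as for its inverse.\<close>

lemma eigencharacter:
  fixes w :: "'a \<Rightarrow> complex"
  assumes w: "continuous_map T euclidean w" and z0: "z0 \<in> carrier G" "w z0 \<noteq> 0"
  shows "\<exists>\<psi> D. continuous_map T euclidean \<psi> \<and> subgroup D G \<and> closedin T D \<and>
    (\<forall>a\<in>D. \<forall>b\<in>D. \<psi> (a \<otimes> b) = \<psi> a * \<psi> b) \<and> (\<forall>b\<in>D. norm (\<psi> b) = 1) \<and>
    (\<forall>b\<in>carrier G. \<forall>d. (\<forall>z\<in>carrier G. w (b \<otimes> z) = d * w z) \<longrightarrow> b \<in> D \<and> \<psi> b = d)"
proof -
  define \<psi> where "\<psi> = (\<lambda>b. w (b \<otimes> z0) / w z0)"
  define D where "D = {b \<in> carrier G. \<forall>z\<in>carrier G. w (b \<otimes> z) = \<psi> b * w z}"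
  have wc: "continuous_map T euclidean (\<lambda>b. w (b \<otimes> z) * c)" if "z \<in> carrier G" for z c
  proof -
    have "continuous_map T T (\<lambda>b. b \<otimes> z)" using that by (intro continuous_map_mult) auto
    from continuous_map_compose[OF this w] have 1: "continuous_map T euclidean (\<lambda>b. w (b \<otimes> z))" by (simp add: o_def)
    have "continuous_map euclidean euclidean (\<lambda>r :: complex. r * c)" by (auto intro!: continuous_intros)
    from continuous_map_compose[OF 1 this] show ?thesis by (simp add: o_def)
  qed
  have \<psi>c: "continuous_map T euclidean \<psi>"
    using wc[OF z0(1), of "inverse (w z0)"] by (simp add: \<psi>_def[abs_def] divide_inverse)
  have \<psi>_app: "\<psi> b = w (b \<otimes> z0) / w z0" for b by (simp add: \<psi>_def)
  have one: "\<psi> \<one> = 1" using z0 by (simp add: \<psi>_def)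
  have D: "b \<in> carrier G" "z \<in> carrier G \<Longrightarrow> w (b \<otimes> z) = \<psi> b * w z" if "b \<in> D" for b z
    using that by (auto simp: D_def)
  have mult: "a \<otimes> b \<in> D \<and> \<psi> (a \<otimes> b) = \<psi> a * \<psi> b" if a: "a \<in> D" and b: "b \<in> D" for a b
  proof -
    have *: "w ((a \<otimes> b) \<otimes> z) = \<psi> a * \<psi> b * w z" if "z \<in> carrier G" for z
      using D[OF a] D[OF b] that by (simp add: m_assoc)
    then have "\<psi> (a \<otimes> b) = \<psi> a * \<psi> b" using z0 by (simp add: \<psi>_app[of "a \<otimes> b"])
    then show ?thesis using * D(1)[OF a] D(1)[OF b] by (simp add: D_def)
  qed
  have oneD: "\<one> \<in> D" using one by (simp add: D_def)
  have invD: "inv b \<in> D \<and> \<psi> (inv b) * \<psi> b = 1" if b: "b \<in> D" for b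
  proof -
    have w_inv: "w z = \<psi> b * w (inv b \<otimes> z)" if "z \<in> carrier G" for z
      using D(2)[OF b, of "inv b \<otimes> z"] D(1)[OF b] that by simp
    then have ne: "\<psi> b \<noteq> 0" using z0 by force
    then have *: "w (inv b \<otimes> z) = inverse (\<psi> b) * w z" if "z \<in> carrier G" for z
      using w_inv[OF that] by simp
    then have "\<psi> (inv b) = inverse (\<psi> b)" using z0 by (simp add: \<psi>_app[of "inv b"])
    then show ?thesis using * ne D(1)[OF b] by (simp add: D_def)
  qed
  have "subgroup D G"
    by (rule subgroupI) (use D(1) oneD mult invD in auto)
  moreover have "closedin T D"
  proof -
    have "D = (\<Inter>z\<in>carrier G. {b \<in> topspace T. w (b \<otimes> z) * w z0 - w (b \<otimes> z0) * w z \<in> {0}})"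
      using z0 by (auto simp: D_def \<psi>_def field_simps)
    moreover have "closedin T {b \<in> topspace T. w (b \<otimes> z) * w z0 - w (b \<otimes> z0) * w z \<in> {0}}"
      if "z \<in> carrier G" for z
      using that z0(1) by (intro closedin_continuous_map_preimage[of _ euclidean] continuous_map_diff wc) auto
    ultimately show ?thesis by (auto intro!: closedin_INT)
  qed
  moreover have "norm (\<psi> b) = 1" if b: "b \<in> D" for b
  proof -
    have le: "norm (\<psi> b) \<le> 1" if b: "b \<in> D" for b
    proof (rule ccontr)
      assume "\<not> norm (\<psi> b) \<le> 1"
      have "compactin euclidean (w ` carrier G)"
        using w compact by (metis compact_space_def image_compactin topspace)
      then have "bounded (w ` carrier G)" by (simp add: compact_imp_bounded)
      then obtain B where B: "\<And>z. z \<in> carrier G \<Longrightarrow> norm (w z) \<le> B" by (auto simp: bounded_iff)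
      obtain n where n: "B / norm (w z0) < norm (\<psi> b) ^ n"
        using real_arch_pow[of "norm (\<psi> b)"] \<open>\<not> norm (\<psi> b) \<le> 1\<close> by auto
      have "b [^] n \<in> D \<and> \<psi> (b [^] n) = \<psi> b ^ n"
        by (induction n) (use oneD one mult b in \<open>auto simp: mult.commute\<close>)
      then have "w (b [^] n \<otimes> z0) = \<psi> b ^ n * w z0" using D(2) z0 by metis
      then have "norm (\<psi> b) ^ n * norm (w z0) \<le> B"
        using B[of "b [^] n \<otimes> z0"] D(1)[OF b] z0 by (simp add: norm_mult norm_power)
      then show False using n z0 by (simp add: pos_divide_less_eq)
    qed
    have "norm (\<psi> (inv b)) * norm (\<psi> b) = 1" using invD[OF b] by (metis norm_mult norm_one)
    moreover have "norm (\<psi> (inv b)) * norm (\<psi> b) \<le> 1 * norm (\<psi> b)"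
      using le invD[OF b] by (intro mult_right_mono) auto
    ultimately show ?thesis using le[OF b] by linarith
  qed
  moreover have "b \<in> D \<and> \<psi> b = d" if "b \<in> carrier G" "\<forall>z\<in>carrier G. w (b \<otimes> z) = d * w z" for b d
  proof -
    have "\<psi> b = d" using that(2) z0 by (simp add: \<psi>_def)
    then show ?thesis using that by (simp add: D_def)
  qed
  ultimately show ?thesis using \<psi>c mult by (intro exI[of _ \<psi>] exI[of _ D]) blast
qed

lemma character_onto_circle:
  fixes \<psi> :: "'a \<Rightarrow> complex"
  assumes \<psi>: "continuous_map T euclidean \<psi>" and B: "subgroup B G" "closedin T B"
    and hom: "\<And>a b. a \<in> B \<Longrightarrow> b \<in> B \<Longrightarrow> \<psi> (a \<otimes> b) = \<psi> a * \<psi> b" and nrm: "\<And>b. b \<in> B \<Longrightarrow> norm (\<psi> b) = 1"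
    and x: "x \<in> B" "\<And>m. m > 0 \<Longrightarrow> \<psi> x ^ m \<noteq> 1"
  shows "\<psi> ` B = sphere 0 1"
proof
  show "\<psi> ` B \<subseteq> sphere 0 1" using nrm by auto
  have oneB: "\<one> \<in> B" by (rule subgroup.one_closed[OF B(1)])
  have "\<psi> \<one> * \<psi> \<one> = \<psi> \<one>" using hom[OF oneB oneB] by simp
  moreover have "\<psi> \<one> \<noteq> 0" using nrm[OF oneB] by auto
  ultimately have one: "\<psi> \<one> = 1" by simp
  have "x [^] n \<in> B \<and> \<psi> (x [^] n) = \<psi> x ^ n" for n :: nat
    by (induction n) (use oneB one hom x(1) subgroup.m_closed[OF B(1)] in \<open>auto simp: mult.commute\<close>)
  then have "\<psi> x ^ n \<in> \<psi> ` B" for n by (metis imageI)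
  moreover have "compactin T B" using B(2) compact closedin_compact_space by blast
  then have "compactin euclidean (\<psi> ` B)" using \<psi> by (rule image_compactin)
  then have "closed (\<psi> ` B)" by (simp add: compact_imp_closed)
  ultimately show "sphere 0 1 \<subseteq> \<psi> ` B"
    using sphere_subset_closed_powers nrm[OF x(1)] x(2) by blast
qed

lemma subgroup_character_kernel:
  fixes \<psi> :: "'a \<Rightarrow> complex"
  assumes "continuous_map T euclidean \<psi>" "\<forall>a\<in>carrier G. \<forall>b\<in>carrier G. \<psi> (a \<otimes> b) = \<psi> a * \<psi> b"
    and "\<psi> \<one> \<noteq> 0"
  shows "subgroup {b \<in> carrier G. \<psi> b = 1} G" "closedin T {b \<in> carrier G. \<psi> b = 1}"
    "b \<in> carrier G \<Longrightarrow> \<psi> (inv b) * \<psi> b = 1"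
proof -
  have one: "\<psi> \<one> = 1" using assms(2)[rule_format, of \<one> \<one>] assms(3) by simp
  show inv: "\<psi> (inv b) * \<psi> b = 1" if "b \<in> carrier G" for b
    using assms(2)[rule_format, of "inv b" b] that one by simp
  show "subgroup {b \<in> carrier G. \<psi> b = 1} G"
  proof (rule subgroupI)
    show "inv a \<in> {b \<in> carrier G. \<psi> b = 1}" if "a \<in> {b \<in> carrier G. \<psi> b = 1}" for a
      using inv[of a] that by auto
  qed (use one assms(2) in auto)
  have "closedin T {b \<in> topspace T. \<psi> b \<in> {1}}"
    by (rule closedin_continuous_map_preimage[OF assms(1)]) simp
  then show "closedin T {b \<in> carrier G. \<psi> b = 1}" by simp
qed

text \<open>Suppose a connected set in the kernel \<open>Z\<close> joins \<open>\<one>\<close> to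
  another point and yields \<open>x\<close> with eigenvalue \<open>c\<close>. The resulting
  character \<open>\<eta>\<close> lives on a closed subgroup \<open>D\<close>; with a
  \<open>y\<close> in \<open>D\<close> such that \<open>\<psi> y = c\<close>, the image of
  \<open>D\<close> under \<open>\<psi>\<close> is the circle, and \<open>D\<close> is everything by
  minimality. As \<open>\<eta>\<close> maps \<open>Z\<close> onto the circle, each element can be
  moved by \<open>Z\<close> into the kernel \<open>E\<close> of \<open>\<eta>\<close> without
  changing its value under \<open>\<psi>\<close>. So \<open>E\<close> is everything too, against
  \<open>\<eta> x = c \<noteq> 1\<close>. With such sets excluded, arcs around 1 pull back to a
  chain with intersection \<open>Z\<close>.\<close>

lemma minimal_circle_cover:
  fixes \<psi> :: "'a \<Rightarrow> complex"
  assumes f: "\<And>n. f n \<noteq> 0" and comm: "\<And>x y. x \<in> carrier G \<Longrightarrow> y \<in> carrier G \<Longrightarrow> x \<otimes> y = y \<otimes> x"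
    and \<psi>: "continuous_map T euclidean \<psi>" and hom: "\<And>a b. a \<in> carrier G \<Longrightarrow> b \<in> carrier G \<Longrightarrow> \<psi> (a \<otimes> b) = \<psi> a * \<psi> b"
    and onto: "\<psi> ` carrier G = sphere 0 1"
    and minimal: "\<And>B. subgroup B G \<Longrightarrow> closedin T B \<Longrightarrow> \<psi> ` B = sphere 0 1 \<Longrightarrow> B = carrier G"
  shows "\<exists>a. unconditionally_f_productive G T f a"
proof -
  define Z where "Z = {b \<in> carrier G. \<psi> b = 1}"
  have nrm: "norm (\<psi> b) = 1" if "b \<in> carrier G" for b using onto that by (metis imageI mem_sphere_0)
  then have ne: "\<psi> \<one> \<noteq> 0" by force
  have "\<forall>a\<in>carrier G. \<forall>b\<in>carrier G. \<psi> (a \<otimes> b) = \<psi> a * \<psi> b" using hom by blast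
  note Z = subgroup_character_kernel[OF \<psi> this ne, folded Z_def]
  have nZ: "Z \<lhd> G"
    unfolding normal_inv_iff using Z(1) comm by (auto simp: Z_def m_assoc[symmetric])
  have td: "K \<subseteq> {\<one>}" if K: "connectedin T K" "K \<subseteq> Z" "\<one> \<in> K" for K
  proof (rule ccontr)
    assume "\<not> K \<subseteq> {\<one>}"
    then obtain x0 where x0: "x0 \<in> K" "x0 \<noteq> \<one>" by blast
    from connected_eigenfunction[OF K(1,3) x0] obtain x and c :: complex where x: "x \<in> K"
      and "\<forall>m>0. c ^ m \<noteq> 1"
      and eig': "\<forall>y\<in>carrier G. x \<otimes> y = y \<otimes> x \<longrightarrow> (\<exists>(w :: 'a \<Rightarrow> complex) d. continuous_map T euclidean w \<and>
        (\<exists>z\<in>carrier G. w z \<noteq> 0) \<and> (\<forall>z\<in>carrier G. w (x \<otimes> z) = c * w z \<and> w (y \<otimes> z) = d * w z))"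
      by (elim bexE exE conjE) (rule that)
    then have c: "\<And>m. m > 0 \<Longrightarrow> c ^ m \<noteq> 1" by blast
    note eig = eig'[rule_format]
    have xZ: "x \<in> Z" using x K(2) by blast
    then have xc: "x \<in> carrier G" by (simp add: Z_def)
    have char: "\<exists>\<eta> D. continuous_map T euclidean \<eta> \<and> subgroup D G \<and> closedin T D \<and>
      (\<forall>a\<in>D. \<forall>b\<in>D. \<eta> (a \<otimes> b) = \<eta> a * \<eta> b) \<and> (\<forall>b\<in>D. norm (\<eta> b) = 1) \<and> x \<in> D \<and> \<eta> x = c \<and> y \<in> D"
      if y: "y \<in> carrier G" for y
    proof -
      from eig[OF y comm[OF xc y]] obtain w :: "'a \<Rightarrow> complex" and d z0 where
        w: "continuous_map T euclidean w" "z0 \<in> carrier G" "w z0 \<noteq> 0"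
          "\<forall>z\<in>carrier G. w (x \<otimes> z) = c * w z" "\<forall>z\<in>carrier G. w (y \<otimes> z) = d * w z" by blast
      from eigencharacter[OF w(1-3)] obtain \<eta> :: "'a \<Rightarrow> complex" and D where
        "continuous_map T euclidean \<eta>" "subgroup D G" "closedin T D"
        "\<forall>a\<in>D. \<forall>b\<in>D. \<eta> (a \<otimes> b) = \<eta> a * \<eta> b" "\<forall>b\<in>D. norm (\<eta> b) = 1"
        and eigD: "\<forall>b\<in>carrier G. \<forall>d. (\<forall>z\<in>carrier G. w (b \<otimes> z) = d * w z) \<longrightarrow> b \<in> D \<and> \<eta> b = d"
        by (elim exE conjE) (rule that)
      moreover have "x \<in> D \<and> \<eta> x = c" "y \<in> D"
        using eigD[rule_format, OF xc, of c] eigD[rule_format, OF y, of d] w(4,5) by auto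
      ultimately show ?thesis by blast
    qed
    have "norm c = 1" using char[OF one_closed] by blast
    then have "c \<in> \<psi> ` carrier G" by (simp add: onto)
    then obtain y where y: "y \<in> carrier G" "\<psi> y = c" by blast
    from char[OF y(1)] obtain \<eta> :: "'a \<Rightarrow> complex" and D where
      \<eta>: "continuous_map T euclidean \<eta>" and D: "subgroup D G" "closedin T D"
        and \<eta>h: "\<And>a b. a \<in> D \<Longrightarrow> b \<in> D \<Longrightarrow> \<eta> (a \<otimes> b) = \<eta> a * \<eta> b" and \<eta>n: "\<And>b. b \<in> D \<Longrightarrow> norm (\<eta> b) = 1"
        and xy: "x \<in> D" "\<eta> x = c" "y \<in> D" by blast
    have Dc: "D \<subseteq> carrier G" using D(1) by (rule subgroup.subset)
    have "\<psi> ` D = sphere 0 1"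
      by (rule character_onto_circle[OF \<psi> D _ _ xy(3)]) (use hom nrm Dc y c in auto)
    then have DG: "D = carrier G" by (rule minimal[OF D])
    have \<eta>ne: "\<eta> \<one> \<noteq> 0" using \<eta>n[of \<one>] by (force simp: DG)
    define E where "E = {b \<in> carrier G. \<eta> b = 1}"
    have \<eta>h': "\<forall>a\<in>carrier G. \<forall>b\<in>carrier G. \<eta> (a \<otimes> b) = \<eta> a * \<eta> b"
      using \<eta>h by (simp add: DG)
    note E = subgroup_character_kernel[OF \<eta> \<eta>h' \<eta>ne, folded E_def]
    have \<eta>Z: "\<eta> ` Z = sphere 0 1"
      by (rule character_onto_circle[OF \<eta> Z(1,2) _ _ xZ]) (use \<eta>h \<eta>n xy c in \<open>auto simp: DG Z_def\<close>)
    have "\<psi> ` E = sphere 0 1"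
    proof
      show "\<psi> ` E \<subseteq> sphere 0 1" using nrm by (auto simp: E_def)
      show "sphere 0 1 \<subseteq> \<psi> ` E"
      proof
        fix t :: complex assume "t \<in> sphere 0 1"
        then obtain b where b: "b \<in> carrier G" "\<psi> b = t" using onto by (metis imageE)
        have "\<eta> b \<in> \<eta> ` Z" using \<eta>n b by (simp add: \<eta>Z DG)
        then obtain z where z: "z \<in> Z" "\<eta> z = \<eta> b" by force
        have zc: "z \<in> carrier G" "\<psi> z = 1" using z by (auto simp: Z_def)
        have "\<eta> (b \<otimes> inv z) = \<eta> (inv z) * \<eta> z"
          using \<eta>h b zc z(2) by (simp add: DG mult.commute)
        then have "b \<otimes> inv z \<in> E" using E(3)[OF zc(1)] b zc by (simp add: E_def)
        moreover have "\<psi> (b \<otimes> inv z) = t" using hom b zc Z(3)[OF zc(1)] by simp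
        ultimately show "t \<in> \<psi> ` E" by blast
      qed
    qed
    then have "E = carrier G" by (rule minimal[OF E(1,2)])
    then have "c = 1" using xc xy(2) by (auto simp: E_def)
    then show False using c[of 1] by simp
  qed
  \<comment> \<open>Radii shrink by the factor 3 because the three errors in a triple product of
    unimodular values add up.\<close>
  define V where "V = (\<lambda>n. {b \<in> carrier G. norm (\<psi> b - 1) < (1 / 3) ^ n})"
  have oneV: "\<psi> \<one> = 1" using hom[of \<one> \<one>] ne by simp
  have "nhd_chain V"
    unfolding nhd_chain_def
  proof (intro allI conjI ballI)
    fix n
    have "openin T {b \<in> topspace T. \<psi> b \<in> ball 1 ((1 / 3) ^ n)}"
      by (rule openin_continuous_map_preimage[OF \<psi>]) simp
    then show "nhd (V n)" using oneV by (simp add: nhd_def V_def dist_norm norm_minus_commute)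
    show "inv b \<in> V n" if "b \<in> V n" for b
    proof -
      have b: "b \<in> carrier G" "norm (\<psi> b - 1) < (1 / 3) ^ n" using that by (auto simp: V_def)
      have "\<psi> (inv b) - 1 = \<psi> (inv b) * (1 - \<psi> b)" using Z(3)[OF b(1)] by (simp add: right_diff_distrib)
      then have "norm (\<psi> (inv b) - 1) = norm (\<psi> b - 1)" using nrm b by (simp add: norm_mult norm_minus_commute)
      then show ?thesis using b by (simp add: V_def)
    qed
    show "a \<otimes> b \<otimes> d \<in> V n" if "a \<in> V (Suc n)" "b \<in> V (Suc n)" "d \<in> V (Suc n)" for a b d
    proof -
      have abd: "a \<in> carrier G" "b \<in> carrier G" "d \<in> carrier G" using that by (auto simp: V_def)
      have "\<psi> (a \<otimes> b \<otimes> d) - 1 = (\<psi> a - 1) * \<psi> b * \<psi> d + (\<psi> b - 1) * \<psi> d + (\<psi> d - 1)"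
        using hom abd by (simp add: algebra_simps)
      also have "norm \<dots> \<le> norm ((\<psi> a - 1) * \<psi> b * \<psi> d) + norm ((\<psi> b - 1) * \<psi> d) + norm (\<psi> d - 1)"
        by (meson add_right_mono norm_triangle_le order_trans norm_triangle_ineq)
      also have "\<dots> = norm (\<psi> a - 1) + norm (\<psi> b - 1) + norm (\<psi> d - 1)" using nrm abd by (simp add: norm_mult)
      also have "\<dots> < (1 / 3) ^ Suc n + (1 / 3) ^ Suc n + (1 / 3) ^ Suc n"
        using that unfolding V_def by (intro add_strict_mono) auto
      finally show ?thesis using abd by (simp add: V_def)
    qed
    show "V (Suc n) \<noteq> V n"
    proof
      assume eq: "V (Suc n) = V n"
      define r :: real where "r = (1 / 3) ^ Suc n"
      have r: "0 < r" "r \<le> 1" unfolding r_def by (simp, intro power_le_one) auto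
      \<comment> \<open>The point of the circle at distance exactly \<open>r\<close> from 1, hence
        with real part \<open>1 - r^2 / 2\<close>. Since the inequality in \<open>V\<close> is
        strict, an element over it is in \<open>V n\<close> but not in
        \<open>V (Suc n)\<close>.\<close>
      define t where "t = Complex (1 - r\<^sup>2 / 2) (sqrt (r\<^sup>2 - r\<^sup>2 * r\<^sup>2 / 4))"
      have "r\<^sup>2 * r\<^sup>2 \<le> 1 * r\<^sup>2" using r by (intro mult_right_mono) (auto intro: power_le_one)
      then have nn: "r\<^sup>2 - r\<^sup>2 * r\<^sup>2 / 4 \<ge> 0" using zero_le_power2[of r] by linarith
      have "(norm t)\<^sup>2 = (1 - r\<^sup>2 / 2)\<^sup>2 + (r\<^sup>2 - r\<^sup>2 * r\<^sup>2 / 4)"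
        unfolding cmod_power2 t_def using nn by simp
      also have "\<dots> = 1" by (simp add: power2_eq_square field_simps)
      finally have "norm t = 1" by (simp add: power2_eq_1_iff) (smt (verit) norm_ge_zero)
      have "(norm (t - 1))\<^sup>2 = (r\<^sup>2 / 2)\<^sup>2 + (r\<^sup>2 - r\<^sup>2 * r\<^sup>2 / 4)"
        unfolding cmod_power2 t_def using nn by simp
      also have "\<dots> = r\<^sup>2" by (simp add: power2_eq_square field_simps)
      finally have "norm (t - 1) = r" using r by simp
      obtain b where b: "b \<in> carrier G" "\<psi> b = t" using onto \<open>norm t = 1\<close> by (metis imageE mem_sphere_0)
      have "r < (1 / 3) ^ n" by (simp add: r_def)
      then have "b \<in> V n" using b \<open>norm (t - 1) = r\<close> by (simp add: V_def)
      moreover have "b \<notin> V (Suc n)" using b \<open>norm (t - 1) = r\<close> by (simp add: V_def r_def)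
      ultimately show False using eq by blast
    qed
  qed
  moreover have "(\<Inter>n. V n) = Z"
  proof
    show "Z \<subseteq> (\<Inter>n. V n)" by (auto simp: Z_def V_def)
    show "(\<Inter>n. V n) \<subseteq> Z"
    proof
      fix b assume b: "b \<in> (\<Inter>n. V n)"
      then have less: "norm (\<psi> b - 1) < (1 / 3) ^ n" for n by (auto simp: V_def)
      have "\<psi> b = 1"
      proof (rule ccontr)
        assume "\<psi> b \<noteq> 1"
        then have "0 < norm (\<psi> b - 1)" by simp
        then obtain n where "(1 / 3) ^ n < norm (\<psi> b - 1)" using real_arch_pow_inv[of _ "1 / 3 :: real"] by force
        then show False using less[of n] by linarith
      qed
      then show "b \<in> Z" using b by (auto simp: Z_def V_def)
    qed
  qed
  ultimately show ?thesis
    using chain_imp_unconditionally_f_productive[where f = f and V = V, OF f] nZ td by simp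
qed

text \<open>A closed commutative subgroup around \<open>x\<close>: its elements commute with all
  that commutes with \<open>x\<close>, in particular with \<open>x\<close>, and therefore with each
  other.\<close>

definition double_centralizer :: "'a \<Rightarrow> 'a set" where
  "double_centralizer x = {b \<in> carrier G. \<forall>y\<in>carrier G. x \<otimes> y = y \<otimes> x \<longrightarrow> b \<otimes> y = y \<otimes> b}"

lemma double_centralizer:
  assumes x: "x \<in> carrier G"
  shows "subgroup (double_centralizer x) G" "closedin T (double_centralizer x)" "x \<in> double_centralizer x"
    "a \<in> double_centralizer x \<Longrightarrow> b \<in> double_centralizer x \<Longrightarrow> a \<otimes> b = b \<otimes> a"
proof -
  show "x \<in> double_centralizer x" using x by (simp add: double_centralizer_def)
  show "a \<otimes> b = b \<otimes> a" if "a \<in> double_centralizer x" "b \<in> double_centralizer x"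
  proof -
    have "b \<otimes> x = x \<otimes> b" using that x by (simp add: double_centralizer_def)
    then show ?thesis using that by (simp add: double_centralizer_def)
  qed
  show "subgroup (double_centralizer x) G"
  proof (rule subgroupI)
    show "double_centralizer x \<noteq> {}" using x by (auto simp: double_centralizer_def)
    show "inv a \<in> double_centralizer x" if "a \<in> double_centralizer x" for a
    proof -
      have "inv a \<otimes> y = y \<otimes> inv a" if y: "y \<in> carrier G" "a \<otimes> y = y \<otimes> a" and a: "a \<in> carrier G" for y
      proof -
        have "inv a \<otimes> (a \<otimes> y) \<otimes> inv a = inv a \<otimes> (y \<otimes> a) \<otimes> inv a" by (simp only: y(2))
        then show ?thesis using y(1) a by (simp add: m_assoc)
      qed
      then show ?thesis using that by (simp add: double_centralizer_def)
    qed
    show "a \<otimes> b \<in> double_centralizer x" if "a \<in> double_centralizer x" "b \<in> double_centralizer x" for a b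
    proof -
      have "(a \<otimes> b) \<otimes> y = y \<otimes> (a \<otimes> b)"
        if y: "y \<in> carrier G" "a \<otimes> y = y \<otimes> a" "b \<otimes> y = y \<otimes> b" and a: "a \<in> carrier G" "b \<in> carrier G" for y
        using y a by (metis m_assoc)
      then show ?thesis using that by (simp add: double_centralizer_def)
    qed
  qed (auto simp: double_centralizer_def)
  have "double_centralizer x = carrier G \<inter> (\<Inter>y\<in>{y \<in> carrier G. x \<otimes> y = y \<otimes> x}. {b \<in> topspace T. inv (y \<otimes> b) \<otimes> (b \<otimes> y) \<in> {\<one>}})"
  proof -
    have "inv (y \<otimes> b) \<otimes> (b \<otimes> y) = \<one> \<longleftrightarrow> b \<otimes> y = y \<otimes> b" if "y \<in> carrier G" "b \<in> carrier G" for y b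
      using that by (metis inv_mult_cancel(2) inv_closed l_inv m_closed r_one)
    then show ?thesis by (auto simp: double_centralizer_def)
  qed
  moreover have "closedin T {b \<in> topspace T. inv (y \<otimes> b) \<otimes> (b \<otimes> y) \<in> {\<one>}}" if "y \<in> carrier G" for y
    using that closedin_one
    by (intro closedin_preimage continuous_map_mult continuous_map_inv) auto
  ultimately show "closedin T (double_centralizer x)"
    using x closedin_topspace[of T] by (auto intro!: closedin_Int closedin_INT)
qed

text \<open>Zorn's lemma downwards: over each point of the circle the fibres in the members of a
  chain are nonempty compact sets, so the intersection of the chain still maps onto the
  circle.\<close>

lemma minimal_subgroup_onto_circle:
  fixes \<psi> :: "'a \<Rightarrow> complex"
  assumes \<psi>: "continuous_map T euclidean \<psi>" and A: "subgroup A G" "closedin T A" "\<psi> ` A = sphere 0 1"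
  shows "\<exists>B. subgroup B G \<and> closedin T B \<and> B \<subseteq> A \<and> \<psi> ` B = sphere 0 1 \<and>
    (\<forall>C. subgroup C G \<and> closedin T C \<and> C \<subseteq> B \<and> \<psi> ` C = sphere 0 1 \<longrightarrow> C = B)"
proof -
  define \<B> where "\<B> = {B. subgroup B G \<and> closedin T B \<and> B \<subseteq> A \<and> \<psi> ` B = sphere 0 1}"
  have "\<exists>m\<in>\<B>. \<forall>C\<in>\<B>. C \<subseteq> m \<longrightarrow> C = m"
  proof (rule predicate_Zorn)
    show "partial_order_on \<B> (relation_of (\<lambda>B C. C \<subseteq> B) \<B>)"
      by (rule partial_order_on_relation_ofI) auto
    fix \<C> assume "\<C> \<in> Chains (relation_of (\<lambda>B C. C \<subseteq> B) \<B>)"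
    then have chain: "B \<in> \<B> \<and> (B \<subseteq> C \<or> C \<subseteq> B)" if "B \<in> \<C>" "C \<in> \<C>" for B C
      using that unfolding Chains_def relation_of_def by blast
    show "\<exists>U\<in>\<B>. \<forall>B\<in>\<C>. U \<subseteq> B"
    proof (cases "\<C> = {}")
      case True
      then show ?thesis using A by (auto simp: \<B>_def)
    next
      case False
      have mem: "subgroup B G" "closedin T B" "B \<subseteq> A" "\<psi> ` B = sphere 0 1" if "B \<in> \<C>" for B
        using chain[OF that that] by (auto simp: \<B>_def)
      have "subgroup (\<Inter>\<C>) G" using mem(1) False by (intro subgroups_Inter)
      moreover have "closedin T (\<Inter>\<C>)" using mem(2) False by (intro closedin_Inter)
      moreover have "\<Inter>\<C> \<subseteq> A" using mem(3) False by blast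
      moreover have "\<psi> ` \<Inter>\<C> = sphere 0 1"
      proof
        obtain B where "B \<in> \<C>" using False by blast
        then show "\<psi> ` \<Inter>\<C> \<subseteq> sphere 0 1" using mem(4) by blast
        show "sphere 0 1 \<subseteq> \<psi> ` \<Inter>\<C>"
        proof
          fix t :: complex assume t: "t \<in> sphere 0 1"
          let ?F = "{b \<in> topspace T. \<psi> b \<in> {t}}"
          have F: "closedin T ?F" by (rule closedin_continuous_map_preimage[OF \<psi>]) simp
          have "\<Inter>((\<lambda>B. B \<inter> ?F) ` \<C>) \<noteq> {}"
          proof (rule compact_space_chain[OF compact])
            fix D assume "D \<in> (\<lambda>B. B \<inter> ?F) ` \<C>"
            then obtain B where B: "B \<in> \<C>" "D = B \<inter> ?F" by blast
            have "t \<in> \<psi> ` B" using mem(4)[OF B(1)] t by simp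
            then have "D \<noteq> {}" using B(2) subgroup.subset[OF mem(1)[OF B(1)]] by auto
            then show "closedin T D \<and> D \<noteq> {}" using B(2) mem(2)[OF B(1)] F by blast
          next
            fix D E assume "D \<in> (\<lambda>B. B \<inter> ?F) ` \<C>" "E \<in> (\<lambda>B. B \<inter> ?F) ` \<C>"
            then show "D \<subseteq> E \<or> E \<subseteq> D" using chain by blast
          qed (use False in simp)
          then obtain b where b: "\<And>B. B \<in> \<C> \<Longrightarrow> b \<in> B \<inter> ?F" by blast
          then have "b \<in> \<Inter>\<C>" by blast
          moreover have "\<psi> b = t" using b False by blast
          ultimately show "t \<in> \<psi> ` \<Inter>\<C>" by blast
        qed
      qed
      ultimately have "\<Inter>\<C> \<in> \<B>" by (simp add: \<B>_def)
      then show ?thesis by blast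
    qed
  qed
  then obtain B where B: "B \<in> \<B>" and min: "\<And>C. C \<in> \<B> \<Longrightarrow> C \<subseteq> B \<Longrightarrow> C = B" by blast
  then show ?thesis unfolding \<B>_def by (intro exI[of _ B]) auto
qed

section \<open>Existence of unconditionally productive sequences\<close>

theorem compact_unconditionally_f_productive:
  assumes f: "\<And>n. f n \<noteq> 0" and nd: "\<not> openin T {\<one>}"
  shows "\<exists>a. unconditionally_f_productive G T f a"
proof (cases "\<exists>K x0. connectedin T K \<and> \<one> \<in> K \<and> x0 \<in> K \<and> x0 \<noteq> \<one>")
  case False
  have "compactin T (carrier G)" using compact by (simp add: compact_space_def)
  from nhd_chain_exists[OF nd nhd_UNIV this] obtain V where V: "nhd_chain V"
    "\<And>n g x. g \<in> carrier G \<Longrightarrow> x \<in> V (Suc n) \<Longrightarrow> g \<otimes> x \<otimes> inv g \<in> V n" by blast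
  have "(\<Inter>n. V n) \<lhd> G"
    unfolding normal_inv_iff using subgroup_Inter_chain[OF V(1)] V(2) by auto
  moreover have "K \<subseteq> {\<one>}" if "connectedin T K" "\<one> \<in> K" for K
    using False that by blast
  ultimately show ?thesis
    by (rule chain_imp_unconditionally_f_productive[where f = f, OF f V(1)])
next
  case True
  then obtain K x0 where K: "connectedin T K" "\<one> \<in> K" "x0 \<in> K" "x0 \<noteq> \<one>" by blast
  from connected_eigenfunction[OF K] obtain x and c :: complex where x: "x \<in> K"
      and "\<forall>m>0. c ^ m \<noteq> 1"
      and eig': "\<forall>y\<in>carrier G. x \<otimes> y = y \<otimes> x \<longrightarrow> (\<exists>(w :: 'a \<Rightarrow> complex) d. continuous_map T euclidean w \<and>
        (\<exists>z\<in>carrier G. w z \<noteq> 0) \<and> (\<forall>z\<in>carrier G. w (x \<otimes> z) = c * w z \<and> w (y \<otimes> z) = d * w z))"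
      by (elim bexE exE conjE) (rule that)
    then have c: "\<And>m. m > 0 \<Longrightarrow> c ^ m \<noteq> 1" by blast
    note eig = eig'[rule_format]
  have xc: "x \<in> carrier G" using x connectedin_subset_topspace[OF K(1)] by auto
  \<comment> \<open>The choice \<open>y = x\<close> gives some eigenfunction for \<open>c\<close>;
    at this stage one character suffices.\<close>
  from eig[OF xc refl] obtain w :: "'a \<Rightarrow> complex" and d z0 where
    w: "continuous_map T euclidean w" "z0 \<in> carrier G" "w z0 \<noteq> 0"
      and w': "\<forall>z\<in>carrier G. w (x \<otimes> z) = c * w z \<and> w (x \<otimes> z) = d * w z"
    by (elim bexE exE conjE) (rule that)
  have w4: "\<forall>z\<in>carrier G. w (x \<otimes> z) = c * w z" using w' by simp
  from eigencharacter[OF w(1-3)] obtain \<psi> :: "'a \<Rightarrow> complex" and D where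
    \<psi>: "continuous_map T euclidean \<psi>" and D: "subgroup D G" "closedin T D"
    and hom: "\<forall>a\<in>D. \<forall>b\<in>D. \<psi> (a \<otimes> b) = \<psi> a * \<psi> b" and nrm: "\<forall>b\<in>D. norm (\<psi> b) = 1"
    and eigD: "\<forall>b\<in>carrier G. \<forall>d. (\<forall>z\<in>carrier G. w (b \<otimes> z) = d * w z) \<longrightarrow> b \<in> D \<and> \<psi> b = d"
    by (elim exE conjE) (rule that)
  note dc = double_centralizer[OF xc]
  \<comment> \<open>The double centralizer makes the group commutative, so that in
    \<open>minimal_circle_cover\<close> kernels are normal and common eigenfunctions exist for all
    \<open>y\<close>.\<close>
  define A where "A = D \<inter> double_centralizer x"
  have xA: "x \<in> A" "\<psi> x = c" using eigD[rule_format, OF xc, of c] w4 dc(3) by (auto simp: A_def)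
  have A: "subgroup A G" "closedin T A"
    unfolding A_def using D dc by (auto intro: subgroups_Inter_pair closedin_Int)
  have "\<psi> ` A = sphere 0 1"
    by (rule character_onto_circle[OF \<psi> A _ _ xA(1)]) (use hom nrm c xA in \<open>auto simp: A_def\<close>)
  from minimal_subgroup_onto_circle[OF \<psi> A this] obtain B where
    B: "subgroup B G" "closedin T B" "B \<subseteq> A" "\<psi> ` B = sphere 0 1"
    and min: "\<forall>C. subgroup C G \<and> closedin T C \<and> C \<subseteq> B \<and> \<psi> ` C = sphere 0 1 \<longrightarrow> C = B"
    by (elim exE conjE) (rule that)
  interpret B: compact_topological_group "G\<lparr>carrier := B\<rparr>" "subtopology T B"
    by (rule subgroup_compact_topological_group[OF compact_topological_group_axioms B(1,2)])
  have "\<exists>a. unconditionally_f_productive (G\<lparr>carrier := B\<rparr>) (subtopology T B) f a"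
  proof (rule B.minimal_circle_cover[where f = f and \<psi> = \<psi>, OF f])
    show "x \<otimes>\<^bsub>G\<lparr>carrier := B\<rparr>\<^esub> y = y \<otimes>\<^bsub>G\<lparr>carrier := B\<rparr>\<^esub> x"
      if "x \<in> carrier (G\<lparr>carrier := B\<rparr>)" "y \<in> carrier (G\<lparr>carrier := B\<rparr>)" for x y
      using that B(3) dc(4) by (auto simp: A_def)
    show "continuous_map (subtopology T B) euclidean \<psi>" using \<psi> by (rule continuous_map_from_subtopology)
    show "\<psi> (a \<otimes>\<^bsub>G\<lparr>carrier := B\<rparr>\<^esub> b) = \<psi> a * \<psi> b"
      if "a \<in> carrier (G\<lparr>carrier := B\<rparr>)" "b \<in> carrier (G\<lparr>carrier := B\<rparr>)" for a b
      using that B(3) hom by (auto simp: A_def)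
    show "\<psi> ` carrier (G\<lparr>carrier := B\<rparr>) = sphere 0 1" using B(4) by simp
    show "C = carrier (G\<lparr>carrier := B\<rparr>)"
      if "subgroup C (G\<lparr>carrier := B\<rparr>)" "closedin (subtopology T B) C" "\<psi> ` C = sphere 0 1" for C
      using min[rule_format, of C] that incl_subgroup[OF B(1) that(1)] closedin_trans_full[OF that(2) B(2)]
        subgroup.subset[OF that(1)] by simp
  qed
  then show ?thesis using unconditionally_f_productive_subgroup[OF B(1)] by blast
qed

end

context hausdorff_topological_group
begin

theorem locally_compact_unconditionally_f_productive:
  assumes lc: "locally_compact_space T" and nd: "\<not> openin T {\<one>}" and f: "\<And>n. f n \<noteq> 0"
  shows "\<exists>a. unconditionally_f_productive G T f a"
proof -
  obtain U K where UK: "openin T U" "compactin T K" "\<one> \<in> U" "U \<subseteq> K"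
    using lc[unfolded locally_compact_space_def, rule_format, of \<one>] by auto
  then have U: "nhd U" by (simp add: nhd_def)
  obtain V where V: "nhd_chain V" "\<And>n. V n \<subseteq> U"
    using nhd_chain_exists[OF nd, of "\<lambda>_. U" "{}"] U by auto
  define L where "L = (\<Inter>n. V n)"
  have L: "subgroup L G" "closedin T L"
    using subgroup_Inter_chain[OF V(1)] closedin_Inter_chain[OF V(1)] by (simp_all add: L_def)
  show ?thesis
  proof (cases "finite L")
    case False
    have "L \<subseteq> K" using V(2)[of 0] UK(4) by (auto simp: L_def)
    then have "compactin T L" using UK(2) L(2) closed_compactin by blast
    then have cL: "compact_space (subtopology T L)" by (rule compact_space_subtopology)
    interpret L: hausdorff_topological_group "G\<lparr>carrier := L\<rparr>" "subtopology T L"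
      by (rule subgroup_topological_group[OF L(1)])
    interpret L: compact_topological_group "G\<lparr>carrier := L\<rparr>" "subtopology T L"
      by unfold_locales (rule cL)
    have "\<not> openin (subtopology T L) {\<one>\<^bsub>G\<lparr>carrier := L\<rparr>\<^esub>}"
    proof
      assume "openin (subtopology T L) {\<one>\<^bsub>G\<lparr>carrier := L\<rparr>\<^esub>}"
      from L.discrete_if_nhd_one[OF this] have "subtopology T L = discrete_topology L" by simp
      then show False using cL False by (simp add: compact_space_discrete_topology)
    qed
    from L.compact_unconditionally_f_productive[where f = f, OF f this] show ?thesis
      using unconditionally_f_productive_subgroup[OF L(1)] by blast
  next
    case True
    \<comment> \<open>A finite \<open>L\<close> can be cut away: a second chain, inside the first
      one and avoiding the closed set \<open>L - {\<one>}\<close>, intersects in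
      \<open>{\<one>}\<close>.\<close>
    have "closedin T (L - {\<one>})"
      using True L(1) Hausdorff subgroup.subset by (intro closedin_Hausdorff_finite) auto
    then have W: "nhd (carrier G - (L - {\<one>}))" by (simp add: nhd_def closedin_def)
    have "nhd (V n \<inter> (carrier G - (L - {\<one>})))" for n
      using nhd_chainD(1)[OF V(1)] W by (rule nhd_Int)
    then obtain V' where V': "nhd_chain V'" "\<And>n. V' n \<subseteq> V n \<inter> (carrier G - (L - {\<one>}))"
      using nhd_chain_exists[OF nd, of "\<lambda>n. V n \<inter> (carrier G - (L - {\<one>}))" "{}"] by auto
    have "(\<Inter>n. V' n) \<subseteq> {\<one>}"
    proof
      fix x assume "x \<in> (\<Inter>n. V' n)"
      then have "x \<in> V n" "x \<notin> L - {\<one>}" for n using V'(2)[of n] by auto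
      then show "x \<in> {\<one>}" by (auto simp: L_def)
    qed
    moreover have "\<one> \<in> (\<Inter>n. V' n)" using nhd_chainD(2)[OF V'(1)] by simp
    ultimately have L': "{\<one>} = (\<Inter>n. V' n)" by blast
    have "V' 0 \<subseteq> K" using V'(2)[of 0] V(2)[of 0] UK(4) by blast
    from summable_mod_exists[OF V'(1) UK(2) this L', of f] obtain a where
      a: "summable_mod f {\<one>} a" "\<And>m n. m < n \<Longrightarrow> inv (a m) \<otimes> a n \<notin> {\<one>}" by blast
    have ac: "a n \<in> carrier G" for n using a(1) by (auto simp: summable_mod_def)
    have "a m \<noteq> a n" if "m < n" for m n using a(2)[OF that] ac by auto
    then have "inj a" by (metis injI linorder_neq_iff)
    then show ?thesis using summable_imp_unconditionally_f_productive[OF lc a(1)] by blast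
  qed
qed

end

theorem theorem7p4:
  fixes G :: "('a, 'b) monoid_scheme" and T :: "'a topology"
  assumes "hausdorff_topological_group G T"
    and "locally_compact_space T"
    and "T \<noteq> discrete_topology (carrier G)"
  shows "\<forall>f :: nat \<Rightarrow> nat. (\<forall>n. f n \<noteq> 0) \<longrightarrow>
    (\<exists>a :: nat \<Rightarrow> 'a. unconditionally_f_productive G T f a)"
proof -
  interpret hausdorff_topological_group G T by (rule assms(1))
  have "\<not> openin T {\<one>\<^bsub>G\<^esub>}" using discrete_if_nhd_one assms(3) by blast
  then show ?thesis using locally_compact_unconditionally_f_productive[OF assms(2)] by blast
qed

end
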